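(* Let $E$ be a finite directed graph without sinks in which every loop has an exit. Then $\mathrm{End}_{\mathcal D_E}(C^*(E))=\mathrm{Aut}_{\mathcal D_E}(C^*(E))$, and the mapping $u\mapsto\lambda_u$ establishes a group isomorphism from $\mathcal U(\mathcal D_E)$ onto $\mathrm{Aut}_{\mathcal D_E}(C^*(E))$.
   Context: A directed graph $E=(E^0,E^1,r,s)$ has vertex set $E^0$, edge set $E^1$, and range and source maps $r,s:E^1\to E^0$; it is finite if $E^0$ and $E^1$ are finite. $C^*(E)$ is the universal $C^*$-algebra generated by mutually orthogonal projections $P_v$ ($v\in E^0$) and partial isometries $S_e$ ($e\in E^1$) with $S_e^*S_e=P_{r(e)}$, $S_e^*S_f=0$ for $e\ne f$, $S_eS_e^*\le P_{s(e)}$, and $P_v=\sum_{s(e)=v}S_eS_e^*$ whenever $v$ emits finitely many and at least one edge. A path of length $k\ge1$ is $\mu=(\mu_1,\ldots,\mu_k)$ with $\mu_j\in E^1$ and $r(\mu_j)=s(\mu_{j+1})$; vertices are the paths of length $0$; put $s(\mu)=s(\mu_1)$, $r(\mu)=r(\mu_k)$, $S_\mu=S_{\mu_1}\cdots S_{\mu_k}$, $S_v=P_v$, and $P_\mu=S_\mu S_\mu^*$. A sink is a vertex emitting no edges. A loop is a path $\mu$ of length at least $1$ with $s(\mu)=r(\mu)$; it has an exit if some $s(\mu_j)$ emits at least two distinct edges. $\mathcal D_E$ (the diagonal) is the $C^*$-subalgebra of $C^*(E)$ generated by all $P_\mu$, and $\mathcal U(A)$ is the unitary group of a unital algebra $A$.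 For a unitary $u\in C^*(E)$ commuting with all $P_v$, $v\in E^0$ (in particular for $u\in\mathcal U(\mathcal D_E)$), $\lambda_u$ is the unital $*$-endomorphism of $C^*(E)$ with $\lambda_u(S_e)=uS_e$ and $\lambda_u(P_v)=P_v$ for all $e\in E^1$, $v\in E^0$. $\mathrm{Aut}_{\mathcal D_E}(C^*(E))$ (respectively $\mathrm{End}_{\mathcal D_E}(C^*(E))$) is the set of all automorphisms (respectively unital $*$-endomorphisms) of $C^*(E)$ which fix $\mathcal D_E$ pointwise. *)

theory Defs
  imports "HOL-Analysis.Analysis" "HOL-Algebra.Module" "Graph_Theory.Arc_Walk"
begin

section \<open>C*-algebras\<close>

text \<open>A unit is not required, and the zero algebra is allowed.\<close>

class cstar_algebra = real_normed_algebra + banach +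
  fixes scaleC :: "complex \<Rightarrow> 'a \<Rightarrow> 'a"
    and adj :: "'a \<Rightarrow> 'a"
  assumes scaleC_of_real: "scaleC (complex_of_real r) x = r *\<^sub>R x"
    and scaleC_add_right: "scaleC c (x + y) = scaleC c x + scaleC c y"
    and scaleC_add_left: "scaleC (c + d) x = scaleC c x + scaleC d x"
    and scaleC_scaleC: "scaleC c (scaleC d x) = scaleC (c * d) x"
    and scaleC_mult_left: "scaleC c x * y = scaleC c (x * y)"
    and scaleC_mult_right: "x * scaleC c y = scaleC c (x * y)"
    and norm_scaleC: "norm (scaleC c x) = cmod c * norm x"
    and adj_adj: "adj (adj x) = x"
    and adj_add: "adj (x + y) = adj x + adj y"
    and adj_scaleC: "adj (scaleC c x) = scaleC (cnj c) (adj x)"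
    and adj_mult: "adj (x * y) = adj y * adj x"
    and cstar_identity: "norm (adj x * x) = norm x ^ 2"

text \<open>The class \<open>monoid_mult\<close> provides the unit without requiring it to differ from zero.\<close>

class unital_cstar_algebra = cstar_algebra + monoid_mult

definition cstar_subalgebra :: "'a::cstar_algebra set \<Rightarrow> bool" where
  "cstar_subalgebra C \<longleftrightarrow> closed C \<and> 0 \<in> C \<and>
     (\<forall>x\<in>C. \<forall>y\<in>C. x + y \<in> C) \<and> (\<forall>x\<in>C. \<forall>y\<in>C. x * y \<in> C) \<and>
     (\<forall>c. \<forall>x\<in>C. scaleC c x \<in> C) \<and> (\<forall>x\<in>C. adj x \<in> C)"

definition cstar_generated :: "'a::cstar_algebra set \<Rightarrow> 'a set" where
  "cstar_generated X = \<Inter>{C. cstar_subalgebra C \<and> X \<subseteq> C}"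

definition cstar_le :: "'a::cstar_algebra \<Rightarrow> 'a \<Rightarrow> bool" where
  "cstar_le a b \<longleftrightarrow> (\<exists>x. b - a = adj x * x)"

definition star_hom :: "('a::cstar_algebra \<Rightarrow> 'b::cstar_algebra) \<Rightarrow> bool" where
  "star_hom \<phi> \<longleftrightarrow> (\<forall>x y. \<phi> (x + y) = \<phi> x + \<phi> y) \<and> (\<forall>x y. \<phi> (x * y) = \<phi> x * \<phi> y) \<and>
     (\<forall>c x. \<phi> (scaleC c x) = scaleC c (\<phi> x)) \<and> (\<forall>x. \<phi> (adj x) = adj (\<phi> x))"

definition unitary :: "'a::unital_cstar_algebra \<Rightarrow> bool" where
  "unitary u \<longleftrightarrow> adj u * u = 1 \<and> u * adj u = 1"


section \<open>C*-algebras given by explicit operations\<close>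

text \<open>
  A universal property quantifies over all C*-algebras, hence over C*-algebras as values rather
  than as types. The field \<open>one\<close> inherited from the ring record is not used.
\<close>

record 'b cstar = "(complex, 'b) module" +
  star :: "'b \<Rightarrow> 'b"
  cnorm :: "'b \<Rightarrow> real"

locale cstar_structure = abelian_group B for B :: "'b cstar" (structure) +
  assumes mult_closed: "\<lbrakk>x \<in> carrier B; y \<in> carrier B\<rbrakk> \<Longrightarrow> x \<otimes> y \<in> carrier B"
    and mult_assoc: "\<lbrakk>x \<in> carrier B; y \<in> carrier B; z \<in> carrier B\<rbrakk> \<Longrightarrow>
      (x \<otimes> y) \<otimes> z = x \<otimes> (y \<otimes> z)"
    and distrib_right: "\<lbrakk>x \<in> carrier B; y \<in> carrier B; z \<in> carrier B\<rbrakk> \<Longrightarrow>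
      (x \<oplus> y) \<otimes> z = x \<otimes> z \<oplus> y \<otimes> z"
    and distrib_left: "\<lbrakk>x \<in> carrier B; y \<in> carrier B; z \<in> carrier B\<rbrakk> \<Longrightarrow>
      z \<otimes> (x \<oplus> y) = z \<otimes> x \<oplus> z \<otimes> y"
    and smult_closed: "x \<in> carrier B \<Longrightarrow> c \<odot> x \<in> carrier B"
    and smult_one: "x \<in> carrier B \<Longrightarrow> 1 \<odot> x = x"
    and smult_add_right: "\<lbrakk>x \<in> carrier B; y \<in> carrier B\<rbrakk> \<Longrightarrow> c \<odot> (x \<oplus> y) = c \<odot> x \<oplus> c \<odot> y"
    and smult_add_left: "x \<in> carrier B \<Longrightarrow> (c + d) \<odot> x = c \<odot> x \<oplus> d \<odot> x"
    and smult_smult: "x \<in> carrier B \<Longrightarrow> c \<odot> (d \<odot> x) = (c * d) \<odot> x"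
    and smult_mult_left: "\<lbrakk>x \<in> carrier B; y \<in> carrier B\<rbrakk> \<Longrightarrow> (c \<odot> x) \<otimes> y = c \<odot> (x \<otimes> y)"
    and smult_mult_right: "\<lbrakk>x \<in> carrier B; y \<in> carrier B\<rbrakk> \<Longrightarrow> x \<otimes> (c \<odot> y) = c \<odot> (x \<otimes> y)"
    and star_closed: "x \<in> carrier B \<Longrightarrow> star B x \<in> carrier B"
    and star_star: "x \<in> carrier B \<Longrightarrow> star B (star B x) = x"
    and star_add: "\<lbrakk>x \<in> carrier B; y \<in> carrier B\<rbrakk> \<Longrightarrow> star B (x \<oplus> y) = star B x \<oplus> star B y"
    and star_smult: "x \<in> carrier B \<Longrightarrow> star B (c \<odot> x) = cnj c \<odot> star B x"
    and star_mult: "\<lbrakk>x \<in> carrier B; y \<in> carrier B\<rbrakk> \<Longrightarrow> star B (x \<otimes> y) = star B y \<otimes> star B x"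
    and cnorm_eq_zero: "x \<in> carrier B \<Longrightarrow> cnorm B x = 0 \<longleftrightarrow> x = \<zero>"
    and cnorm_add: "\<lbrakk>x \<in> carrier B; y \<in> carrier B\<rbrakk> \<Longrightarrow> cnorm B (x \<oplus> y) \<le> cnorm B x + cnorm B y"
    and cnorm_smult: "x \<in> carrier B \<Longrightarrow> cnorm B (c \<odot> x) = cmod c * cnorm B x"
    and cnorm_mult: "\<lbrakk>x \<in> carrier B; y \<in> carrier B\<rbrakk> \<Longrightarrow> cnorm B (x \<otimes> y) \<le> cnorm B x * cnorm B y"
    and cnorm_star_mult: "x \<in> carrier B \<Longrightarrow> cnorm B (star B x \<otimes> x) = cnorm B x ^ 2"
    and complete: "\<lbrakk>\<And>n::nat. X n \<in> carrier B;
        \<And>\<epsilon>. \<epsilon> > 0 \<Longrightarrow> \<exists>N. \<forall>m\<ge>N. \<forall>n\<ge>N. cnorm B (X m \<ominus> X n) < \<epsilon>\<rbrakk> \<Longrightarrow>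
        \<exists>L\<in>carrier B. (\<lambda>n. cnorm B (X n \<ominus> L)) \<longlonglongrightarrow> 0"

definition star_hom_into :: "'b cstar \<Rightarrow> ('a::cstar_algebra \<Rightarrow> 'b) \<Rightarrow> bool" where
  "star_hom_into B \<phi> \<longleftrightarrow> (\<forall>x. \<phi> x \<in> carrier B) \<and>
     (\<forall>x y. \<phi> (x + y) = \<phi> x \<oplus>\<^bsub>B\<^esub> \<phi> y) \<and> (\<forall>x y. \<phi> (x * y) = \<phi> x \<otimes>\<^bsub>B\<^esub> \<phi> y) \<and>
     (\<forall>c x. \<phi> (scaleC c x) = c \<odot>\<^bsub>B\<^esub> \<phi> x) \<and> (\<forall>x. \<phi> (adj x) = star B (\<phi> x))"


section \<open>Graph C*-algebras\<close>

text \<open>Source and range of an edge are its \<open>tail\<close> and \<open>head\<close>.\<close>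

definition ck_family ::
  "('v, 'e) pre_digraph \<Rightarrow> ('v \<Rightarrow> 'a::cstar_algebra) \<Rightarrow> ('e \<Rightarrow> 'a) \<Rightarrow> bool" where
  "ck_family G P S \<longleftrightarrow>
     (\<forall>v\<in>verts G. adj (P v) = P v \<and> P v * P v = P v) \<and>
     (\<forall>v\<in>verts G. \<forall>w\<in>verts G. v \<noteq> w \<longrightarrow> P v * P w = 0) \<and>
     (\<forall>e\<in>arcs G. S e * adj (S e) * S e = S e) \<and>
     (\<forall>e\<in>arcs G. adj (S e) * S e = P (head G e)) \<and>
     (\<forall>e\<in>arcs G. \<forall>f\<in>arcs G. e \<noteq> f \<longrightarrow> adj (S e) * S f = 0) \<and>
     (\<forall>e\<in>arcs G. cstar_le (S e * adj (S e)) (P (tail G e))) \<and>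
     (\<forall>v\<in>verts G. finite (out_arcs G v) \<and> out_arcs G v \<noteq> {} \<longrightarrow>
        P v = (\<Sum>e\<in>out_arcs G v. S e * adj (S e)))"

definition ck_family_in ::
  "'b cstar \<Rightarrow> ('v, 'e) pre_digraph \<Rightarrow> ('v \<Rightarrow> 'b) \<Rightarrow> ('e \<Rightarrow> 'b) \<Rightarrow> bool" where
  "ck_family_in B G Q T \<longleftrightarrow>
     (\<forall>v\<in>verts G. Q v \<in> carrier B) \<and> (\<forall>e\<in>arcs G. T e \<in> carrier B) \<and>
     (\<forall>v\<in>verts G. star B (Q v) = Q v \<and> Q v \<otimes>\<^bsub>B\<^esub> Q v = Q v) \<and>
     (\<forall>v\<in>verts G. \<forall>w\<in>verts G. v \<noteq> w \<longrightarrow> Q v \<otimes>\<^bsub>B\<^esub> Q w = \<zero>\<^bsub>B\<^esub>) \<and>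
     (\<forall>e\<in>arcs G. T e \<otimes>\<^bsub>B\<^esub> star B (T e) \<otimes>\<^bsub>B\<^esub> T e = T e) \<and>
     (\<forall>e\<in>arcs G. star B (T e) \<otimes>\<^bsub>B\<^esub> T e = Q (head G e)) \<and>
     (\<forall>e\<in>arcs G. \<forall>f\<in>arcs G. e \<noteq> f \<longrightarrow> star B (T e) \<otimes>\<^bsub>B\<^esub> T f = \<zero>\<^bsub>B\<^esub>) \<and>
     (\<forall>e\<in>arcs G. \<exists>x\<in>carrier B.
        Q (tail G e) \<ominus>\<^bsub>B\<^esub> T e \<otimes>\<^bsub>B\<^esub> star B (T e) = star B x \<otimes>\<^bsub>B\<^esub> x) \<and>
     (\<forall>v\<in>verts G. finite (out_arcs G v) \<and> out_arcs G v \<noteq> {} \<longrightarrow>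
        Q v = (\<Oplus>\<^bsub>B\<^esub>e\<in>out_arcs G v. T e \<otimes>\<^bsub>B\<^esub> star B (T e)))"

text \<open>
  The type \<open>'a\<close>, with the elements \<open>P v\<close> and \<open>S e\<close>, is the universal C*-algebra generated by a
  Cuntz-Krieger family of the graph \<open>G\<close>. HOL cannot quantify over the type of the target algebra,
  so the targets \<open>B\<close> range over all C*-algebras whose elements are taken from the fixed type
  \<open>nat \<Rightarrow> real\<close>. For a countable graph this is no restriction: the subalgebra generated by a
  Cuntz-Krieger family is separable, and an element of a separable metric space is determined by
  its distances to a dense sequence. See \<open>graph_cstar_algebra_universal\<close> below.
  Homomorphisms are not required to preserve units. Uniqueness of \<open>\<phi>\<close> follows from generation.
\<close>

definition graph_cstar_algebra ::
  "('v, 'e) pre_digraph \<Rightarrow> ('v \<Rightarrow> 'a::cstar_algebra) \<Rightarrow> ('e \<Rightarrow> 'a) \<Rightarrow> bool" where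
  "graph_cstar_algebra G P S \<longleftrightarrow>
     ck_family G P S \<and>
     cstar_generated (P ` verts G \<union> S ` arcs G) = UNIV \<and>
     (\<forall>(B :: (nat \<Rightarrow> real) cstar) Q T. cstar_structure B \<and> ck_family_in B G Q T \<longrightarrow>
        (\<exists>\<phi>. star_hom_into B \<phi> \<and> (\<forall>v\<in>verts G. \<phi> (P v) = Q v) \<and> (\<forall>e\<in>arcs G. \<phi> (S e) = T e)))"

text \<open>\<open>path_isometry P S v \<mu>\<close> is the element $S_{\mu}$ for the path \<open>\<mu>\<close> starting at \<open>v\<close>;
  the empty list is the vertex \<open>v\<close> as a path of length 0.\<close>

definition path_isometry ::
  "('v \<Rightarrow> 'a::unital_cstar_algebra) \<Rightarrow> ('e \<Rightarrow> 'a) \<Rightarrow> 'v \<Rightarrow> 'e list \<Rightarrow> 'a" where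
  "path_isometry P S v \<mu> = (if \<mu> = [] then P v else prod_list (map S \<mu>))"

definition diagonal ::
  "('v, 'e) pre_digraph \<Rightarrow> ('v \<Rightarrow> 'a::unital_cstar_algebra) \<Rightarrow> ('e \<Rightarrow> 'a) \<Rightarrow> 'a set" where
  "diagonal G P S = cstar_generated
     {path_isometry P S v \<mu> * adj (path_isometry P S v \<mu>) |v \<mu> w. pre_digraph.awalk G v \<mu> w}"

definition End_fixing :: "'a::unital_cstar_algebra set \<Rightarrow> ('a \<Rightarrow> 'a) set" where
  "End_fixing D = {\<alpha>. star_hom \<alpha> \<and> \<alpha> 1 = 1 \<and> (\<forall>x\<in>D. \<alpha> x = x)}"

definition Aut_fixing :: "'a::unital_cstar_algebra set \<Rightarrow> ('a \<Rightarrow> 'a) set" where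
  "Aut_fixing D = {\<alpha>. star_hom \<alpha> \<and> bij \<alpha> \<and> (\<forall>x\<in>D. \<alpha> x = x)}"

definition unitary_group :: "'a::unital_cstar_algebra set \<Rightarrow> 'a monoid" where
  "unitary_group D = \<lparr>carrier = {u \<in> D. unitary u}, mult = (*), one = 1\<rparr>"

definition Aut_fixing_group :: "'a::unital_cstar_algebra set \<Rightarrow> ('a \<Rightarrow> 'a) monoid" where
  "Aut_fixing_group D = \<lparr>carrier = Aut_fixing D, mult = (\<circ>), one = id\<rparr>"

text \<open>Existence is \<open>lambda_endo_exists\<close> below; uniqueness holds because the \<open>P v\<close> and \<open>S e\<close> generate.\<close>

definition lambda_endo ::
  "('v, 'e) pre_digraph \<Rightarrow> ('v \<Rightarrow> 'a::unital_cstar_algebra) \<Rightarrow> ('e \<Rightarrow> 'a) \<Rightarrow> 'a \<Rightarrow> 'a \<Rightarrow> 'a" where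
  "lambda_endo G P S u = (SOME \<phi>. star_hom \<phi> \<and> \<phi> 1 = 1 \<and>
     (\<forall>e\<in>arcs G. \<phi> (S e) = u * S e) \<and> (\<forall>v\<in>verts G. \<phi> (P v) = P v))"

section \<open>Adequacy of the definitions\<close>

lemma norm_adj: "norm (adj x) = norm (x::'a::cstar_algebra)"
proof -
  have *: "norm y \<le> norm (adj y)" for y :: 'a
  proof (cases "y = 0")
    case False
    have "norm y * norm y = norm (adj y * y)" by (simp add: cstar_identity power2_eq_square)
    also have "\<dots> \<le> norm (adj y) * norm y" by (rule norm_mult_ineq)
    finally show ?thesis using False by simp
  qed simp
  from *[of x] *[of "adj x"] show ?thesis by (simp add: adj_adj)
qed

lemma adj_0 [simp]: "adj 0 = (0::'a::cstar_algebra)"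
  by (metis norm_adj norm_eq_zero)

lemma scaleC_neg_one: "scaleC (-1) x = - (x::'a::cstar_algebra)"
  using scaleC_of_real[of "-1" x] by simp

lemma adj_minus: "adj (- x) = - adj (x::'a::cstar_algebra)"
  using adj_scaleC[of "-1" x] by (simp add: scaleC_neg_one)

lemma adj_diff: "adj (x - y) = adj x - adj (y::'a::cstar_algebra)"
  using adj_add[of x "- y"] by (simp add: adj_minus)

lemma adj_1 [simp]: "adj 1 = (1::'a::unital_cstar_algebra)"
  by (metis adj_adj adj_mult mult.right_neutral)

lemma scaleC_diff_right: "scaleC c (x - y) = scaleC c x - scaleC c (y::'a::cstar_algebra)"
  using scaleC_add_right[of c "x - y" y] by simp

lemma scaleC_diff_left: "scaleC (c - d) x = scaleC c x - scaleC d (x::'a::cstar_algebra)"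
  using scaleC_add_left[of "c - d" d x] by simp

lemma scaleC_1: "scaleC 1 x = (x::'a::cstar_algebra)"
  using scaleC_of_real[of 1 x] by simp

lemma tendsto_adj: "(f \<longlongrightarrow> l) F \<Longrightarrow> ((\<lambda>x. adj (f x)) \<longlongrightarrow> adj (l::'a::cstar_algebra)) F"
  by (simp add: tendsto_iff dist_norm norm_adj flip: adj_diff)

lemma tendsto_scaleC:
  fixes l :: "'a::cstar_algebra"
  assumes "(c \<longlongrightarrow> d) F" "(f \<longlongrightarrow> l) F"
  shows "((\<lambda>x. scaleC (c x) (f x)) \<longlongrightarrow> scaleC d l) F"
proof -
  have "bounded_bilinear (scaleC :: complex \<Rightarrow> 'a \<Rightarrow> 'a)"
  proof
    show "scaleC (a + a') b = scaleC a b + scaleC a' b" for a a' and b :: 'a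
      by (rule scaleC_add_left)
    show "scaleC a (b + b') = scaleC a b + scaleC a b'" for a and b b' :: 'a
      by (rule scaleC_add_right)
    show "scaleC (r *\<^sub>R a) b = r *\<^sub>R scaleC a b" for r a and b :: 'a
      by (simp add: scaleR_conv_of_real scaleC_scaleC flip: scaleC_of_real)
    show "scaleC a (r *\<^sub>R b) = r *\<^sub>R scaleC a b" for r a and b :: 'a
      by (simp add: scaleC_scaleC mult.commute flip: scaleC_of_real)
    show "\<exists>K. \<forall>a (b::'a). norm (scaleC a b) \<le> norm a * norm b * K"
      by (rule exI[of _ 1]) (simp add: norm_scaleC)
  qed
  from bounded_bilinear.tendsto[OF this assms] show ?thesis .
qed

lemma cstar_subalgebra_generated: "cstar_subalgebra (cstar_generated X)"
  unfolding cstar_generated_def cstar_subalgebra_def by (auto intro!: closed_Inter)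

lemma cstar_generated_superset: "X \<subseteq> cstar_generated X"
  unfolding cstar_generated_def by auto

lemma ck_familyD:
  assumes "ck_family G P S"
  shows "v \<in> verts G \<Longrightarrow> adj (P v) = P v" "v \<in> verts G \<Longrightarrow> P v * P v = P v"
    and "\<lbrakk>v \<in> verts G; w \<in> verts G; v \<noteq> w\<rbrakk> \<Longrightarrow> P v * P w = 0"
    and "e \<in> arcs G \<Longrightarrow> S e * adj (S e) * S e = S e"
    and "e \<in> arcs G \<Longrightarrow> adj (S e) * S e = P (head G e)"
    and "\<lbrakk>e \<in> arcs G; f \<in> arcs G; e \<noteq> f\<rbrakk> \<Longrightarrow> adj (S e) * S f = 0"
    and "e \<in> arcs G \<Longrightarrow> cstar_le (S e * adj (S e)) (P (tail G e))"
    and "\<lbrakk>v \<in> verts G; finite (out_arcs G v); out_arcs G v \<noteq> {}\<rbrakk> \<Longrightarrow>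
      P v = (\<Sum>e\<in>out_arcs G v. S e * adj (S e))"
proof -
  note c = assms[unfolded ck_family_def]
  show "v \<in> verts G \<Longrightarrow> adj (P v) = P v" "v \<in> verts G \<Longrightarrow> P v * P v = P v"
    using c[THEN conjunct1, rule_format, of v] by blast+
  note c = c[THEN conjunct2]
  show "\<lbrakk>v \<in> verts G; w \<in> verts G; v \<noteq> w\<rbrakk> \<Longrightarrow> P v * P w = 0"
    by (rule c[THEN conjunct1, rule_format])
  note c = c[THEN conjunct2]
  show "e \<in> arcs G \<Longrightarrow> S e * adj (S e) * S e = S e" by (rule c[THEN conjunct1, rule_format])
  note c = c[THEN conjunct2]
  show "e \<in> arcs G \<Longrightarrow> adj (S e) * S e = P (head G e)" by (rule c[THEN conjunct1, rule_format])
  note c = c[THEN conjunct2]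
  show "\<lbrakk>e \<in> arcs G; f \<in> arcs G; e \<noteq> f\<rbrakk> \<Longrightarrow> adj (S e) * S f = 0"
    by (rule c[THEN conjunct1, rule_format])
  note c = c[THEN conjunct2]
  show "e \<in> arcs G \<Longrightarrow> cstar_le (S e * adj (S e)) (P (tail G e))"
    by (rule c[THEN conjunct1, rule_format])
  note c = c[THEN conjunct2]
  show "\<lbrakk>v \<in> verts G; finite (out_arcs G v); out_arcs G v \<noteq> {}\<rbrakk> \<Longrightarrow>
      P v = (\<Sum>e\<in>out_arcs G v. S e * adj (S e))"
    by (rule c[rule_format]) auto
qed

text \<open>Transport of a C*-subalgebra along an injection.\<close>

definition transport :: "('a::cstar_algebra \<Rightarrow> 'b) \<Rightarrow> 'a set \<Rightarrow> 'b cstar" where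
  "transport h C = (let g = the_inv_into C h in
     \<lparr>carrier = h ` C, mult = \<lambda>x y. h (g x * g y), one = h 0, zero = h 0,
      add = \<lambda>x y. h (g x + g y), smult = \<lambda>c x. h (scaleC c (g x)),
      star = \<lambda>x. h (adj (g x)), cnorm = \<lambda>x. norm (g x)\<rparr>)"

context
  fixes C :: "'a::cstar_algebra set" and h :: "'a \<Rightarrow> 'b"
  assumes C: "cstar_subalgebra C" and inj: "inj_on h C"
begin

lemma C_closed:
  "0 \<in> C" "x \<in> C \<Longrightarrow> y \<in> C \<Longrightarrow> x + y \<in> C" "x \<in> C \<Longrightarrow> y \<in> C \<Longrightarrow> x * y \<in> C"
  "x \<in> C \<Longrightarrow> scaleC c x \<in> C" "x \<in> C \<Longrightarrow> adj x \<in> C" "x \<in> C \<Longrightarrow> - x \<in> C"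
  "x \<in> C \<Longrightarrow> y \<in> C \<Longrightarrow> x - y \<in> C"
proof -
  show 1: "0 \<in> C" "x \<in> C \<Longrightarrow> y \<in> C \<Longrightarrow> x + y \<in> C" "x \<in> C \<Longrightarrow> y \<in> C \<Longrightarrow> x * y \<in> C"
    "x \<in> C \<Longrightarrow> scaleC c x \<in> C" "x \<in> C \<Longrightarrow> adj x \<in> C" for x y c
    using C by (auto simp: cstar_subalgebra_def)
  show 2: "x \<in> C \<Longrightarrow> - x \<in> C" for x using 1(4)[of x "-1"] by (simp add: scaleC_neg_one)
  show "x \<in> C \<Longrightarrow> y \<in> C \<Longrightarrow> x - y \<in> C" using 1(2)[of x "- y"] 2 by simp
qed

lemma transport_simps:
  "carrier (transport h C) = h ` C"
  "\<zero>\<^bsub>transport h C\<^esub> = h 0"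
  "x \<in> C \<Longrightarrow> y \<in> C \<Longrightarrow> h x \<oplus>\<^bsub>transport h C\<^esub> h y = h (x + y)"
  "x \<in> C \<Longrightarrow> y \<in> C \<Longrightarrow> h x \<otimes>\<^bsub>transport h C\<^esub> h y = h (x * y)"
  "x \<in> C \<Longrightarrow> c \<odot>\<^bsub>transport h C\<^esub> h x = h (scaleC c x)"
  "x \<in> C \<Longrightarrow> star (transport h C) (h x) = h (adj x)"
  "x \<in> C \<Longrightarrow> cnorm (transport h C) (h x) = norm x"
  by (auto simp: transport_def Let_def the_inv_into_f_f[OF inj])

lemma abelian_group_transport: "abelian_group (transport h C)"
proof (rule abelian_groupI)
  fix x assume "x \<in> carrier (transport h C)"
  then obtain a where "a \<in> C" "x = h a" by (auto simp: transport_simps)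
  then show "\<exists>y\<in>carrier (transport h C). y \<oplus>\<^bsub>transport h C\<^esub> x = \<zero>\<^bsub>transport h C\<^esub>"
    by (intro bexI[of _ "h (- a)"]) (auto simp: transport_simps C_closed)
qed (auto simp: transport_simps C_closed add_ac)

lemma transport_minus:
  assumes "x \<in> C" "y \<in> C"
  shows "h x \<ominus>\<^bsub>transport h C\<^esub> h y = h (x - y)"
proof -
  interpret abelian_group "transport h C" by (rule abelian_group_transport)
  have "\<ominus>\<^bsub>transport h C\<^esub> h y = h (- y)"
    by (rule minus_equality) (use assms in \<open>auto simp: transport_simps C_closed\<close>)
  then show ?thesis using assms by (simp add: a_minus_def transport_simps C_closed)
qed

lemma transport_sum:
  assumes "finite I" "\<And>i. i \<in> I \<Longrightarrow> f i \<in> C"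
  shows "(\<Oplus>\<^bsub>transport h C\<^esub>i\<in>I. h (f i)) = h (\<Sum>i\<in>I. f i) \<and> (\<Sum>i\<in>I. f i) \<in> C"
proof -
  interpret abelian_group "transport h C" by (rule abelian_group_transport)
  show ?thesis using assms
    by (induction I rule: finite_induct)
       (auto simp: transport_simps C_closed finsum_insert Pi_def)
qed

lemma cstar_structure_transport: "cstar_structure (transport h C)"
proof -
  interpret abelian_group "transport h C" by (rule abelian_group_transport)
  show ?thesis
  proof
    fix X :: "nat \<Rightarrow> 'b"
    assume X: "\<And>n. X n \<in> carrier (transport h C)"
      and Cau: "\<And>\<epsilon>. \<epsilon> > 0 \<Longrightarrow> \<exists>N. \<forall>m\<ge>N. \<forall>n\<ge>N.
        cnorm (transport h C) (X m \<ominus>\<^bsub>transport h C\<^esub> X n) < \<epsilon>"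
    from X have "\<forall>n. \<exists>a. a \<in> C \<and> X n = h a" by (auto simp: transport_simps)
    then obtain Y where Y: "\<And>n. Y n \<in> C" "\<And>n. X n = h (Y n)" by metis
    have "Cauchy Y"
      using Cau by (simp add: Y transport_minus transport_simps C_closed Cauchy_def dist_norm)
    then obtain L where L: "Y \<longlonglongrightarrow> L" by (auto simp: Cauchy_convergent_iff convergent_def)
    have LC: "L \<in> C"
      using C L Y(1) by (auto simp: cstar_subalgebra_def closed_sequential_limits)
    have "(\<lambda>n. norm (Y n - L)) \<longlonglongrightarrow> 0" using L by (simp add: LIM_zero tendsto_norm_zero)
    then show "\<exists>L\<in>carrier (transport h C).
        (\<lambda>n. cnorm (transport h C) (X n \<ominus>\<^bsub>transport h C\<^esub> L)) \<longlonglongrightarrow> 0"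
      using LC by (intro bexI[of _ "h L"])
        (simp_all add: Y transport_minus transport_simps C_closed)
  qed (auto simp: transport_simps C_closed algebra_simps scaleC_add_right scaleC_add_left
      scaleC_scaleC scaleC_mult_left scaleC_mult_right norm_scaleC adj_adj adj_add adj_scaleC
      adj_mult cstar_identity scaleC_1 norm_triangle_ineq norm_mult_ineq
      inj_on_eq_iff[OF inj])
qed

lemma ck_family_transport:
  assumes ck: "ck_family G Q T" and V: "\<And>v. v \<in> verts G \<Longrightarrow> Q v \<in> C"
    and A: "\<And>e. e \<in> arcs G \<Longrightarrow> T e \<in> C"
    and pos: "\<And>e. e \<in> arcs G \<Longrightarrow> \<exists>x\<in>C. Q (tail G e) - T e * adj (T e) = adj x * x"
    and wf: "wf_digraph G"
  shows "ck_family_in (transport h C) G (\<lambda>v. h (Q v)) (\<lambda>e. h (T e))"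
proof -
  have t: "tail G e \<in> verts G" if "e \<in> arcs G" for e using wf that by (simp add: wf_digraph_def)
  have sum: "(\<Oplus>\<^bsub>transport h C\<^esub>e\<in>out_arcs G v. h (T e) \<otimes>\<^bsub>transport h C\<^esub> star (transport h C) (h (T e)))
     = h (\<Sum>e\<in>out_arcs G v. T e * adj (T e))" if "finite (out_arcs G v)" for v
  proof -
    interpret abelian_group "transport h C" by (rule abelian_group_transport)
    have "(\<Oplus>\<^bsub>transport h C\<^esub>e\<in>out_arcs G v. h (T e) \<otimes>\<^bsub>transport h C\<^esub> star (transport h C) (h (T e)))
      = (\<Oplus>\<^bsub>transport h C\<^esub>e\<in>out_arcs G v. h (T e * adj (T e)))"
      by (rule finsum_cong') (auto simp: transport_simps C_closed A)
    then show ?thesis using transport_sum[OF that, of "\<lambda>e. T e * adj (T e)"]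
      by (auto simp: C_closed A)
  qed
  have p: "\<exists>x\<in>carrier (transport h C). h (Q (tail G e)) \<ominus>\<^bsub>transport h C\<^esub>
      h (T e) \<otimes>\<^bsub>transport h C\<^esub> star (transport h C) (h (T e)) =
      star (transport h C) x \<otimes>\<^bsub>transport h C\<^esub> x" if e: "e \<in> arcs G" for e
  proof -
    obtain x where x: "x \<in> C" "Q (tail G e) - T e * adj (T e) = adj x * x" using pos e by blast
    show ?thesis using x e
      by (intro bexI[of _ "h x"]) (auto simp: transport_simps C_closed transport_minus V A t)
  qed
  have hd: "head G e \<in> verts G" if "e \<in> arcs G" for e using wf that by (simp add: wf_digraph_def)
  note D = ck_familyD[OF ck]
  have "h (Q v) = (\<Oplus>\<^bsub>transport h C\<^esub>e\<in>out_arcs G v.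
      h (T e) \<otimes>\<^bsub>transport h C\<^esub> star (transport h C) (h (T e)))"
    if v: "v \<in> verts G" "finite (out_arcs G v)" "out_arcs G v \<noteq> {}" for v
    unfolding sum[OF v(2)] by (subst D(8)[OF v]) (rule refl)
  with p show ?thesis unfolding ck_family_in_def
    by (intro conjI ballI impI) (simp_all add: transport_simps C_closed V A hd D(1-6))
qed

end

text \<open>Countably generated subalgebras are separable: terms are evaluated with scalars from a
  countable dense set.\<close>

datatype pterm = Pt_Gen nat | Pt_Add pterm pterm | Pt_Mul pterm pterm | Pt_Adj pterm | Pt_Scl nat pterm

instance pterm :: countable by countable_datatype

lemma separable_subalgebra:
  fixes X :: "'a::cstar_algebra set"
  assumes "countable X"
  obtains D C where "countable D" "D \<noteq> {}" "cstar_subalgebra C" "X \<subseteq> C" "C = closure D"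
proof -
  obtain K :: "complex set" where K: "countable K" "\<And>U. open U \<Longrightarrow> U \<noteq> {} \<Longrightarrow> \<exists>d\<in>K. d \<in> U"
    by (rule countable_dense_setE) blast
  have K0: "K \<noteq> {}" using K(2)[of UNIV] by auto
  define g where "g = from_nat_into (insert 0 X)"
  have rg: "range g = insert 0 X" unfolding g_def by (rule range_from_nat_into) (use assms in auto)
  define k where "k = from_nat_into K"
  have rk: "range k = K" unfolding k_def by (rule range_from_nat_into) (use K K0 in auto)
  define ev where "ev = rec_pterm g (\<lambda>_ _ x y. x + y) (\<lambda>_ _ x y. x * y) (\<lambda>_ x. adj x)
    (\<lambda>n _ x. scaleC (k n) x)"
  have ev: "ev (Pt_Gen n) = g n" "ev (Pt_Add s t) = ev s + ev t" "ev (Pt_Mul s t) = ev s * ev t"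
    "ev (Pt_Adj s) = adj (ev s)" "ev (Pt_Scl n s) = scaleC (k n) (ev s)" for n s t
    by (simp_all add: ev_def)
  define D where "D = range ev"
  have XD: "insert 0 X \<subseteq> D" unfolding D_def rg[symmetric] by (auto simp flip: ev)
  have D: "x \<in> D \<Longrightarrow> y \<in> D \<Longrightarrow> x + y \<in> D" "x \<in> D \<Longrightarrow> y \<in> D \<Longrightarrow> x * y \<in> D"
    "x \<in> D \<Longrightarrow> adj x \<in> D" for x y
    unfolding D_def by (auto simp flip: ev)
  have DK: "scaleC c x \<in> D" if "x \<in> D" "c \<in> K" for c x
    using that unfolding D_def rk[symmetric] by (auto simp flip: ev)
  have clK: "closure K = UNIV"
  proof -
    have "\<exists>d\<in>K. dist d c < e" if "e > 0" for c e
      using K(2)[of "ball c e"] that by (auto simp: dist_commute)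
    then show ?thesis by (auto simp: closure_approachable)
  qed
  have "cstar_subalgebra (closure D)"
    unfolding cstar_subalgebra_def
  proof (intro conjI ballI allI)
    show "0 \<in> closure D" using XD closure_subset by blast
    fix x y assume "x \<in> closure D" "y \<in> closure D"
    then obtain s t where s: "\<And>n. s n \<in> D" "s \<longlonglongrightarrow> x" and t: "\<And>n. t n \<in> D" "t \<longlonglongrightarrow> y"
      unfolding closure_sequential by blast
    show "x + y \<in> closure D" "x * y \<in> closure D" unfolding closure_sequential
      by (rule exI[of _ "\<lambda>n. s n + t n"] exI[of _ "\<lambda>n. s n * t n"],
          use s t D in \<open>auto intro: tendsto_add tendsto_mult\<close>)+
  next
    fix c x assume "x \<in> closure D"
    then obtain s where s: "\<And>n. s n \<in> D" "s \<longlonglongrightarrow> x" unfolding closure_sequential by blast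
    have "c \<in> closure K" using clK by simp
    then obtain t where t: "\<And>n. t n \<in> K" "t \<longlonglongrightarrow> c" unfolding closure_sequential by blast
    show "scaleC c x \<in> closure D" unfolding closure_sequential
      by (rule exI[of _ "\<lambda>n. scaleC (t n) (s n)"]) (use s t DK in \<open>auto intro: tendsto_scaleC\<close>)
  next
    fix x assume "x \<in> closure D"
    then obtain s where s: "\<And>n. s n \<in> D" "s \<longlonglongrightarrow> x" unfolding closure_sequential by blast
    show "adj x \<in> closure D" unfolding closure_sequential
      by (rule exI[of _ "\<lambda>n. adj (s n)"]) (use s D in \<open>auto intro: tendsto_adj\<close>)
  qed simp
  moreover have "X \<subseteq> closure D" using XD closure_subset by blast
  moreover have "countable D" "D \<noteq> {}" unfolding D_def by auto
  ultimately show ?thesis using that by blast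
qed

lemma separable_injection:
  fixes D :: "'a::metric_space set"
  assumes "countable D" "D \<noteq> {}"
  shows "inj_on (\<lambda>x (n::nat). dist x (from_nat_into D n)) (closure D)"
proof (rule inj_onI)
  fix x y assume x: "x \<in> closure D" and
    eq: "(\<lambda>n. dist x (from_nat_into D n)) = (\<lambda>n. dist y (from_nat_into D n))"
  have "dist x y < e" if "e > 0" for e
  proof -
    have "e / 2 > 0" using that by simp
    then obtain d where d: "d \<in> D" "dist d x < e / 2" using x unfolding closure_approachable by blast
    obtain n where n: "from_nat_into D n = d" using from_nat_into_surj[OF assms(1) d(1)] by blast
    have yd: "dist x d = dist y d" using fun_cong[OF eq, of n] unfolding n .
    have "dist x y \<le> dist x d + dist y d" by (rule dist_triangle2)
    moreover have "dist x d < e / 2" using d(2) by (simp only: dist_commute)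
    ultimately show ?thesis using yd by linarith
  qed
  from this[of "dist x y"] show "x = y" by (cases "x = y") simp_all
qed

theorem graph_cstar_algebra_universal:
  fixes P :: "'v \<Rightarrow> 'a::cstar_algebra" and Q :: "'v \<Rightarrow> 'b::cstar_algebra"
  assumes G: "fin_digraph G" and univ: "graph_cstar_algebra G P S" and ck: "ck_family G Q T"
  obtains \<phi> where "star_hom \<phi>" "\<And>v. v \<in> verts G \<Longrightarrow> \<phi> (P v) = Q v"
    "\<And>e. e \<in> arcs G \<Longrightarrow> \<phi> (S e) = T e"
proof -
  interpret fin_digraph G by (rule G)
  have "\<forall>e\<in>arcs G. \<exists>x. Q (tail G e) - T e * adj (T e) = adj x * x"
    using ck by (auto simp: ck_family_def cstar_le_def)
  then obtain R where R: "\<And>e. e \<in> arcs G \<Longrightarrow> Q (tail G e) - T e * adj (T e) = adj (R e) * R e"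
    by metis
  define X where "X = Q ` verts G \<union> T ` arcs G \<union> R ` arcs G"
  have "countable X" unfolding X_def by (intro countable_Un countable_finite) auto
  then obtain D C where DC: "countable D" "D \<noteq> {}" "cstar_subalgebra C" "X \<subseteq> C" "C = closure D"
    by (rule separable_subalgebra)
  define h where "h = (\<lambda>x (n::nat). dist x (from_nat_into D n))"
  have inj: "inj_on h C" unfolding h_def DC(5) by (rule separable_injection) (use DC in auto)
  note tr = transport_simps[OF DC(3) inj]
  have "cstar_structure (transport h C)" by (rule cstar_structure_transport[OF DC(3) inj])
  moreover have "ck_family_in (transport h C) G (\<lambda>v. h (Q v)) (\<lambda>e. h (T e))"
    by (rule ck_family_transport[OF DC(3) inj ck])
       (use DC(4) R in \<open>auto simp: X_def intro: wf_digraph\<close>)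
  ultimately obtain \<psi> where \<psi>: "star_hom_into (transport h C) \<psi>"
      "\<And>v. v \<in> verts G \<Longrightarrow> \<psi> (P v) = h (Q v)" "\<And>e. e \<in> arcs G \<Longrightarrow> \<psi> (S e) = h (T e)"
    using univ unfolding graph_cstar_algebra_def by blast
  have "\<forall>x. \<exists>y. y \<in> C \<and> \<psi> x = h y" using \<psi>(1) by (auto simp: star_hom_into_def tr)
  then obtain \<phi> where \<phi>: "\<And>x. \<phi> x \<in> C" "\<And>x. \<psi> x = h (\<phi> x)" by metis
  have eq: "h a = h b \<Longrightarrow> a \<in> C \<Longrightarrow> b \<in> C \<Longrightarrow> a = b" for a b using inj by (auto dest: inj_onD)
  show ?thesis
  proof
    show "star_hom \<phi>" unfolding star_hom_def
      by (intro conjI allI eq)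
        (use \<psi>(1) in \<open>auto simp: star_hom_into_def \<phi> tr C_closed[OF DC(3) inj]\<close>)
    show "\<phi> (P v) = Q v" if "v \<in> verts G" for v
      using \<psi>(2)[OF that] DC(4) that by (intro eq) (auto simp: \<phi> X_def)
    show "\<phi> (S e) = T e" if "e \<in> arcs G" for e
      using \<psi>(3)[OF that] DC(4) that by (intro eq) (auto simp: \<phi> X_def)
  qed
qed


lemma graph_cstar_unit:
  fixes P :: "'v \<Rightarrow> 'a::unital_cstar_algebra"
  assumes G: "fin_digraph G" and univ: "graph_cstar_algebra G P S"
  shows "(\<Sum>v\<in>verts G. P v) = 1"
proof -
  interpret fin_digraph G by (rule G)
  have ck: "ck_family G P S" and gen: "cstar_generated (P ` verts G \<union> S ` arcs G) = UNIV"
    using univ by (auto simp: graph_cstar_algebra_def)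
  have proj: "adj (P v) = P v" "P v * P v = P v" if "v \<in> verts G" for v
    using ck_familyD(1,2)[OF ck] that by auto
  have orth: "P v * P w = 0" if "v \<in> verts G" "w \<in> verts G" "v \<noteq> w" for v w
    using ck_familyD(3)[OF ck] that by auto
  define q where "q = (\<Sum>v\<in>verts G. P v)"
  have qP: "q * P v = P v" "P v * q = P v" if "v \<in> verts G" for v
  proof -
    have "P w * P v = (if w = v then P v else 0)" "P v * P w = (if w = v then P v else 0)"
      if "w \<in> verts G" for w
      using proj orth that \<open>v \<in> verts G\<close> by auto
    then show "q * P v = P v" "P v * q = P v"
      using that by (simp_all add: q_def sum_distrib_left sum_distrib_right)
  qed
  have qa: "adj q = q"
  proof -
    have "adj (\<Sum>v\<in>F. P v) = (\<Sum>v\<in>F. P v)" if "F \<subseteq> verts G" for F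
      using finite_subset[OF that finite_verts] that
      by (induction F rule: finite_induct) (auto simp: adj_add proj)
    then show ?thesis by (simp add: q_def)
  qed
  have qS: "q * S e = S e" "S e * q = S e" if e: "e \<in> arcs G" for e
  proof -
    have P: "P (head G e) = adj (S e) * S e" and S: "S e * adj (S e) * S e = S e"
      using ck_familyD(4,5)[OF ck e] by simp_all
    have SP: "S e * P (head G e) = S e" using S by (simp add: P mult.assoc)
    have "S e * q = S e * (P (head G e) * q)" by (subst SP[symmetric]) (rule mult.assoc)
    also have "\<dots> = S e" using e by (simp add: qP SP)
    finally show "S e * q = S e" .
    have o: "e \<in> out_arcs G (tail G e)" using e by (simp add: out_arcs_def)
    moreover have fin: "finite (out_arcs G (tail G e))"
      by (rule finite_subset[OF _ finite_arcs]) (auto simp: out_arcs_def)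
    ultimately have "P (tail G e) = (\<Sum>f\<in>out_arcs G (tail G e). S f * adj (S f))"
      using e by (intro ck_familyD(8)[OF ck]) auto
    moreover have "S f * adj (S f) * S e = (if f = e then S e else 0)"
      if "f \<in> out_arcs G (tail G e)" for f
    proof (cases "f = e")
      case False
      then have "adj (S f) * S e = 0"
        using e that by (intro ck_familyD(6)[OF ck]) (auto simp: out_arcs_def)
      then show ?thesis using False by (simp add: mult.assoc)
    qed (simp add: S)
    ultimately have "P (tail G e) * S e = S e"
      using o fin by (simp add: sum_distrib_right)
    then have PS: "P (tail G e) * S e = S e" .
    have "q * S e = (q * P (tail G e)) * S e" by (subst PS[symmetric]) (rule mult.assoc[symmetric])
    then show "q * S e = S e" using e by (simp add: qP PS)
  qed
  let ?F = "{x. q * x = x \<and> x * q = x}"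
  have "cstar_subalgebra ?F" unfolding cstar_subalgebra_def
  proof (intro conjI ballI allI)
    show "closed ?F" by (intro closed_Collect_conj closed_Collect_eq continuous_intros)
    show "adj x \<in> ?F" if "x \<in> ?F" for x
      using that adj_mult[of q x] adj_mult[of x q] by (simp add: qa)
    show "x * y \<in> ?F" if "x \<in> ?F" "y \<in> ?F" for x y
    proof -
      have "q * (x * y) = (q * x) * y" "(x * y) * q = x * (y * q)" by (simp_all add: mult.assoc)
      then show ?thesis using that by simp
    qed
  qed (auto simp: distrib_left distrib_right scaleC_mult_left scaleC_mult_right)
  then have "UNIV \<subseteq> ?F" unfolding gen[symmetric] unfolding cstar_generated_def
    using qP qS by (intro Inter_lower) auto
  then have "q * 1 = 1" by blast
  then show ?thesis by (simp add: q_def)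
qed

lemma ck_family_unitary:
  fixes P :: "'v \<Rightarrow> 'a::unital_cstar_algebra"
  assumes wf: "wf_digraph G" and ck: "ck_family G P S" and u: "unitary u"
    and comm: "\<And>v. v \<in> verts G \<Longrightarrow> u * P v = P v * u"
  shows "ck_family G P (\<lambda>e. u * S e)"
proof -
  have uu: "adj u * u = 1" "u * adj u = 1" using u by (auto simp: unitary_def)
  have cancel: "adj u * (u * x) = x" "u * (adj u * x) = x" for x
    by (simp_all add: uu flip: mult.assoc)
  have conj: "u * P v * adj u = P v" if "v \<in> verts G" for v
    using comm[OF that] by (simp add: mult.assoc uu)
  have t: "tail G e \<in> verts G" if "e \<in> arcs G" for e using wf that by (simp add: wf_digraph_def)
  have le: "cstar_le (u * S e * adj (u * S e)) (P (tail G e))" if e: "e \<in> arcs G" for e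
  proof -
    obtain x where x: "P (tail G e) - S e * adj (S e) = adj x * x"
      using ck_familyD(7)[OF ck e] by (auto simp: cstar_le_def)
    have "P (tail G e) - u * S e * adj (u * S e) = u * (P (tail G e) - S e * adj (S e)) * adj u"
      using conj[OF t[OF e]] by (simp add: algebra_simps adj_mult)
    also have "\<dots> = adj (x * adj u) * (x * adj u)" by (simp add: x adj_mult adj_adj mult.assoc)
    finally show ?thesis by (auto simp: cstar_le_def)
  qed
  have sum: "P v = (\<Sum>e\<in>out_arcs G v. u * S e * adj (u * S e))"
    if v: "v \<in> verts G" "finite (out_arcs G v)" "out_arcs G v \<noteq> {}" for v
  proof -
    have "(\<Sum>e\<in>out_arcs G v. u * S e * adj (u * S e))
        = u * (\<Sum>e\<in>out_arcs G v. S e * adj (S e)) * adj u"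
      by (simp add: sum_distrib_left sum_distrib_right adj_mult mult.assoc)
    also have "(\<Sum>e\<in>out_arcs G v. S e * adj (S e)) = P v" using ck_familyD(8)[OF ck v] by simp
    finally show ?thesis using conj v by simp
  qed
  have SS: "adj (u * S e) * (u * S f) = adj (S e) * S f" for e f
    by (simp add: adj_mult mult.assoc cancel)
  have "u * S e * adj (u * S e) * (u * S e) = u * (S e * adj (S e) * S e)" for e
    by (simp add: adj_mult mult.assoc cancel)
  then show ?thesis
    unfolding ck_family_def SS
    by (intro conjI ballI impI le sum) (simp_all add: ck_familyD(1-7)[OF ck])
qed

theorem lambda_endo_exists:
  fixes P :: "'v \<Rightarrow> 'a::unital_cstar_algebra"
  assumes G: "fin_digraph G" and univ: "graph_cstar_algebra G P S" and u: "unitary u"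
    and comm: "\<And>v. v \<in> verts G \<Longrightarrow> u * P v = P v * u"
  shows "star_hom (lambda_endo G P S u)" "lambda_endo G P S u 1 = 1"
    and "e \<in> arcs G \<Longrightarrow> lambda_endo G P S u (S e) = u * S e"
    and "v \<in> verts G \<Longrightarrow> lambda_endo G P S u (P v) = P v"
proof -
  interpret fin_digraph G by (rule G)
  have "ck_family G P (\<lambda>e. u * S e)"
    using univ by (intro ck_family_unitary wf_digraph u comm) (auto simp: graph_cstar_algebra_def)
  from graph_cstar_algebra_universal[OF G univ this] obtain \<phi> where \<phi>:
    "star_hom \<phi>" "\<And>v. v \<in> verts G \<Longrightarrow> \<phi> (P v) = P v" "\<And>e. e \<in> arcs G \<Longrightarrow> \<phi> (S e) = u * S e"
    by blast
  have add: "\<phi> (x + y) = \<phi> x + \<phi> y" for x y using \<phi>(1) by (simp add: star_hom_def)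
  have zero: "\<phi> 0 = 0" using add[of 0 0] by simp
  have "\<phi> (\<Sum>v\<in>F. P v) = (\<Sum>v\<in>F. \<phi> (P v))" if "finite F" for F
    using that by (induction F rule: finite_induct) (auto simp: add zero)
  then have "\<phi> (\<Sum>v\<in>verts G. P v) = (\<Sum>v\<in>verts G. P v)" using \<phi>(2) by simp
  then have "\<phi> 1 = 1" by (simp add: graph_cstar_unit[OF G univ])
  with \<phi> have "\<exists>\<phi>. star_hom \<phi> \<and> \<phi> 1 = 1 \<and> (\<forall>e\<in>arcs G. \<phi> (S e) = u * S e) \<and>
      (\<forall>v\<in>verts G. \<phi> (P v) = P v)" by blast
  from someI_ex[OF this, folded lambda_endo_def]
  show "star_hom (lambda_endo G P S u)" "lambda_endo G P S u 1 = 1"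
    and "e \<in> arcs G \<Longrightarrow> lambda_endo G P S u (S e) = u * S e"
    and "v \<in> verts G \<Longrightarrow> lambda_endo G P S u (P v) = P v" by auto
qed

end

theory Submission
  imports Defs
begin

text \<open>
Write \<open>D\<close> for the diagonal and \<open>D'\<close> for the set of elements that commute with it. Everything rests
on \<open>D' = D\<close> (\<open>diagonal_maximal_abelian\<close>). Granted this, let \<open>\<alpha>\<close> be a unital endomorphism that
fixes \<open>D\<close> and put \<open>u = (\<Sum>e. \<alpha> (S e) * adj (S e))\<close>. The relations make \<open>u\<close> a unitary with
\<open>\<alpha> (S e) = u * S e\<close>, and comparing \<open>u * x\<close> with \<open>\<alpha> x * u\<close> shows that \<open>u\<close> commutes with every \<open>x\<close>
in \<open>D\<close>; hence \<open>u\<close> lies in \<open>D\<close> and \<open>\<alpha> = \<lambda>\<^sub>u\<close> (\<open>endo_is_lambda\<close>). Conversely, for unitary \<open>u\<close> in \<open>D\<close>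
the endomorphism \<open>\<lambda>\<^sub>u\<close> fixes \<open>D\<close> because \<open>D\<close> is commutative (\<open>lambda_fixes_diagonal\<close>), so
\<open>\<lambda>\<^sub>u \<circ> \<lambda>\<^sub>v = \<lambda>\<^bsub>uv\<^esub>\<close>, and \<open>\<lambda>\<^sub>u\<close> is invertible with inverse \<open>\<lambda>\<^bsub>adj u\<^esub>\<close>.

For \<open>D' = D\<close>, let \<open>x\<close> commute with \<open>D\<close>. The gauge action \<open>S e \<mapsto> z S e\<close> fixes \<open>D\<close>, so the Fourier
coefficients of \<open>x\<close> along it commute with \<open>D\<close> too, and the Cesaro means of its Fourier series
converge to \<open>x\<close>. It therefore suffices to treat one coefficient, of degree \<open>n\<close>, say. It is close
to a linear combination \<open>y\<close> of monomials \<open>S\<^sub>\<mu> S\<^sub>\<nu>\<^sup>*\<close> with \<open>\<mu>\<close> longer than \<open>\<nu>\<close> by \<open>n\<close>, and compressing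
by the range projections \<open>P\<^sub>\<mu>\<close> of all paths of one large length, which does not change \<open>x\<close>, leaves
only multiples \<open>c S\<^sub>\<mu> S\<^sub>\<nu>\<^sup>*\<close> with \<open>\<nu>\<close> a prefix of \<open>\<mu>\<close>. If \<open>n = 0\<close>, this is an element of \<open>D\<close>. If
\<open>n > 0\<close>, then \<open>\<mu> = \<nu>\<tau>\<close> with a loop \<open>\<tau>\<close>, and \<open>P\<^sub>\<mu> x (P\<^sub>\<nu> - P\<^sub>\<mu>) = x P\<^sub>\<mu> (P\<^sub>\<nu> - P\<^sub>\<mu>) = 0\<close>, whereas
\<open>P\<^sub>\<mu> y (P\<^sub>\<nu> - P\<^sub>\<mu>) = c S\<^sub>\<mu> S\<^sub>\<nu>\<^sup>* (P\<^sub>\<nu> - P\<^sub>\<mu>)\<close> has norm \<open>\<bar>c\<bar>\<close>, because an exit of \<open>\<tau>\<close> forces \<open>P\<^sub>\<nu> \<noteq> P\<^sub>\<mu>\<close>.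
Thus \<open>c\<close> is as small as \<open>x - y\<close>, and so is the whole coefficient (\<open>homogeneous_coefficient_le\<close>,
\<open>homogeneous_positive_near_zero\<close>). Negative degrees follow by taking adjoints.

Two facts of a different kind are used. Unital *-homomorphisms are contractive
(\<open>star_hom_contractive\<close>), hence are determined on generators. And the projections \<open>P v\<close> do not
vanish in the universal algebra (\<open>graph_vertex_projection_nonzero\<close>); this needs an actual
representation, which is the one by shifts on the square-summable functions on infinite paths.
\<close>

section \<open>Unital C*-algebras: homomorphisms are contractive\<close>

lemma norm_one_le: "norm (1::'a::unital_cstar_algebra) \<le> 1"
proof -
  have "norm (1::'a) = (norm (1::'a))\<^sup>2"
    using cstar_identity[of "1::'a"] by simp
  then have "norm (1::'a) = 0 \<or> norm (1::'a) = 1"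
    by (simp add: power2_eq_square)
  then show ?thesis by auto
qed

lemma norm_power_le: "norm (a ^ n) \<le> norm (a::'a::unital_cstar_algebra) ^ n"
proof (induction n)
  case (Suc n)
  have "norm (a * a ^ n) \<le> norm a * norm (a ^ n)" by (rule norm_mult_ineq)
  also have "\<dots> \<le> norm a * norm a ^ n" using Suc by (intro mult_left_mono) auto
  finally show ?case by simp
qed (simp add: norm_one_le)

lemma norm_unitary_le: "norm w \<le> 1" if "adj w * w = (1::'a::unital_cstar_algebra)"
  using cstar_identity[of w] norm_one_le[where 'a='a] by (simp add: that power_le_one_iff)

lemma adj_scaleR: "adj (r *\<^sub>R x) = r *\<^sub>R adj (x::'a::cstar_algebra)"
  using adj_scaleC[of "complex_of_real r" x] by (simp add: scaleC_of_real)

lemma bounded_linear_adj: "bounded_linear (adj :: 'a::cstar_algebra \<Rightarrow> 'a)"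
  by (rule bounded_linear_intro[where K=1]) (simp_all add: adj_add adj_scaleR norm_adj)

lemma scaleC_zero_right [simp]: "scaleC c 0 = (0::'a::cstar_algebra)"
  using scaleC_diff_right[of c "0::'a" 0] by simp

lemma bounded_linear_scaleC: "bounded_linear (scaleC c :: 'a::cstar_algebra \<Rightarrow> 'a)"
  by (rule bounded_linear_intro[where K="cmod c"])
     (simp_all add: scaleC_add_right norm_scaleC scaleC_scaleC mult.commute flip: scaleC_of_real)

lemma adj_power: "adj (a ^ n) = adj (a::'a::unital_cstar_algebra) ^ n"
  by (induction n) (simp_all add: adj_mult power_commutes)

lemma adj_sum: "adj (\<Sum>i\<in>I. f i) = (\<Sum>i\<in>I. adj (f i :: 'a::cstar_algebra))"
  by (induction I rule: infinite_finite_induct) (simp_all add: adj_add)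

lemma scaleC_sum_left: "scaleC (\<Sum>i\<in>I. c i) x = (\<Sum>i\<in>I. scaleC (c i) (x::'a::cstar_algebra))"
proof (induction I rule: infinite_finite_induct)
  case empty
  show ?case using scaleC_diff_left[of 0 0 x] by simp
qed (simp_all add: scaleC_add_left scaleC_of_real[of 0, simplified])

lemma scaleC_sum_right: "scaleC c (\<Sum>i\<in>I. f i) = (\<Sum>i\<in>I. scaleC c (f i :: 'a::cstar_algebra))"
  by (induction I rule: infinite_finite_induct) (simp_all add: scaleC_add_right)

lemma unitary_mult: "unitary u \<Longrightarrow> unitary v \<Longrightarrow> unitary (u * v)" for u v :: "'a::unital_cstar_algebra"
  unfolding unitary_def adj_mult by (metis mult.assoc mult.right_neutral)

lemma unitary_one: "unitary (1 :: 'a::unital_cstar_algebra)"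
  by (simp add: unitary_def)

text \<open>
The binomial series of \<open>(1 - t)\<^bsup>1/2\<^esup>\<close> converges absolutely at \<open>h\<close>, and its Cauchy square collapses
to \<open>1 - t\<close> by Vandermonde's identity. The commutation clause is what later makes \<open>a + \<i> b\<close>
unitary.
\<close>

lemma sqrt_one_minus:
  fixes h :: "'a::unital_cstar_algebra"
  assumes h: "adj h = h" "norm h < 1"
  obtains b where "adj b = b" "b * b = 1 - h" "\<And>a. a * h = h * a \<Longrightarrow> a * b = b * a"
proof -
  define c :: "nat \<Rightarrow> real" where "c = (\<lambda>n. ((1/2) gchoose n) * (-1) ^ n)"
  define t where "t = (\<lambda>n. c n *\<^sub>R h ^ n)"
  \<comment> \<open>The series converges absolutely at \<open>norm h\<close>, because it converges at a larger point \<open>r\<close>.\<close>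
  obtain r where r: "norm h < r" "r < 1" using dense[OF h(2)] by blast
  have "summable (\<lambda>n. c n * r ^ n)"
    using gen_binomial_real[of "-r" "1/2"] r norm_ge_zero[of h]
    by (simp add: sums_iff c_def power_mult_distrib[symmetric] mult.assoc)
  from powser_insidea[OF this, of "norm h"]
  have "summable (\<lambda>n. norm (c n * norm h ^ n))" using r by simp
  then have sn: "summable (\<lambda>n. norm (t n))"
  proof (rule summable_comparison_test')
    show "norm (norm (t n)) \<le> norm (c n * norm h ^ n)" for n
      using norm_power_le[of h n] by (simp add: t_def abs_mult mult_left_mono)
  qed
  then have s: "summable t" by (rule summable_norm_cancel)
  define b where "b = suminf t"
  have "adj b = (\<Sum>n. adj (t n))"
    unfolding b_def by (rule bounded_linear.suminf[OF bounded_linear_adj s])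
  also have "(\<lambda>n. adj (t n)) = t"
    by (simp add: t_def adj_power adj_scaleR h)
  finally have 1: "adj b = b" by (simp add: b_def)
  have conv: "(\<Sum>i\<le>k. c i * c (k - i)) = (if k = 0 then 1 else if k = 1 then -1 else 0)" for k
  proof -
    have "(\<Sum>i\<le>k. c i * c (k - i)) = (\<Sum>i=0..k. ((1/2) gchoose i) * ((1/2) gchoose (k - i)) * (-1) ^ k)"
      unfolding atLeast0AtMost
      by (intro sum.cong refl) (simp add: c_def flip: power_add)
    also have "\<dots> = (1 gchoose k) * (-1) ^ k"
      using gbinomial_Vandermonde[of "1/2::real" "1/2" k] by (simp flip: sum_distrib_right)
    also have "(1::real) gchoose k = of_nat (1 choose k)" by (simp add: binomial_gbinomial)
    finally show ?thesis by (auto simp: binomial_eq_0)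
  qed
  have "b * b = (\<Sum>k. \<Sum>i\<le>k. t i * t (k - i))"
    unfolding b_def by (rule Cauchy_product[OF sn sn])
  also have "(\<lambda>k. \<Sum>i\<le>k. t i * t (k - i)) = (\<lambda>k. (if k = 0 then 1 else if k = 1 then -1 else 0) *\<^sub>R h ^ k)"
    by (rule ext) (simp add: t_def mult_ac flip: conv scaleR_sum_left power_add)
  also have "(\<Sum>k. ((if k = 0 then 1 else if k = 1 then -1 else 0)::real) *\<^sub>R h ^ k)
      = (\<Sum>k\<in>{0,1}. ((if k = 0 then 1 else if k = 1 then -1 else 0)::real) *\<^sub>R h ^ k)"
    by (rule suminf_finite) auto
  also have "\<dots> = 1 - h" by simp
  finally have 2: "b * b = 1 - h" .
  have 3: "a * b = b * a" if "a * h = h * a" for a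
  proof -
    have "a * b = (\<Sum>n. a * t n)" unfolding b_def by (rule suminf_mult[OF s, symmetric])
    also have "\<dots> = (\<Sum>n. t n * a)"
      by (simp add: t_def power_commuting_commutes[OF that[symmetric]])
    also have "\<dots> = b * a" unfolding b_def by (rule suminf_mult2[OF s, symmetric])
    finally show ?thesis .
  qed
  from 1 2 3 that show ?thesis by blast
qed

lemma star_homD:
  assumes "star_hom \<phi>"
  shows "\<phi> (x + y) = \<phi> x + \<phi> y" "\<phi> (x * y) = \<phi> x * \<phi> y" "\<phi> (scaleC c x) = scaleC c (\<phi> x)"
    "\<phi> (adj x) = adj (\<phi> x)" "\<phi> (x - y) = \<phi> x - \<phi> y" "\<phi> (r *\<^sub>R x) = r *\<^sub>R \<phi> x" "\<phi> 0 = 0"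
proof -
  show *: "\<phi> (x + y) = \<phi> x + \<phi> y" "\<phi> (x * y) = \<phi> x * \<phi> y" "\<phi> (scaleC c x) = scaleC c (\<phi> x)"
    "\<phi> (adj x) = adj (\<phi> x)" for x y c using assms by (auto simp: star_hom_def)
  show "\<phi> (x - y) = \<phi> x - \<phi> y" using *(1)[of "x - y" y] by simp
  show "\<phi> (r *\<^sub>R x) = r *\<^sub>R \<phi> x" using *(3)[of "complex_of_real r" x] by (simp add: scaleC_of_real)
  show "\<phi> 0 = 0" using *(1)[of 0 0] by simp
qed

lemma star_hom_sum: "star_hom \<phi> \<Longrightarrow> \<phi> (\<Sum>i\<in>I. f i) = (\<Sum>i\<in>I. \<phi> (f i))"
  by (induction I rule: infinite_finite_induct) (auto simp: star_homD)

text \<open>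
A selfadjoint \<open>a\<close> of norm less than 1 is the real part of the unitary \<open>w = a + \<i> (1 - a\<^sup>2)\<^bsup>1/2\<^esup>\<close>. A
homomorphism maps unitaries to unitaries, which have norm at most 1, so the real part of \<open>\<phi> w\<close> has
norm at most 1 as well.
\<close>

lemma star_hom_contractive_selfadjoint:
  fixes \<phi> :: "'a::unital_cstar_algebra \<Rightarrow> 'b::unital_cstar_algebra"
  assumes \<phi>: "star_hom \<phi>" "\<phi> 1 = 1" and a: "adj a = a" "norm a < 1"
  shows "norm (\<phi> a) \<le> 1"
proof -
  have "norm (a * a) < 1"
    using cstar_identity[of a] a by (simp add: power_less_one_iff)
  moreover have "adj (a * a) = a * a" by (simp add: adj_mult a)
  ultimately obtain b where b: "adj b = b" "b * b = 1 - a * a" "a * b = b * a"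
    using sqrt_one_minus[of "a * a"] by (metis mult.assoc)
  define w where "w = a + scaleC \<i> b"
  have aw: "adj w = a - scaleC \<i> b"
    using scaleC_scaleC[of "-1" \<i> b] by (simp add: w_def adj_add adj_scaleC a b scaleC_neg_one)
  have "scaleC \<i> (b * a) - scaleC \<i> (a * b) = 0" using b by simp
  then have "adj w * w = a * a + b * b" "w * adj w = a * a + b * b"
    unfolding aw unfolding w_def using scaleC_neg_one[of "b * b"]
    by (simp_all add: algebra_simps scaleC_mult_left scaleC_mult_right scaleC_scaleC
        scaleC_add_right scaleC_diff_right)
  then have u: "adj w * w = 1" "w * adj w = 1" using b by simp_all
  have "adj (\<phi> w) * \<phi> w = 1" "adj (\<phi> (adj w)) * \<phi> (adj w) = 1"
    using u \<phi> by (simp_all add: adj_adj flip: star_homD[OF \<phi>(1)])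
  then have n: "norm (\<phi> w) \<le> 1" "norm (\<phi> (adj w)) \<le> 1" by (simp_all add: norm_unitary_le)
  have "w + adj w = 2 *\<^sub>R a" unfolding aw unfolding w_def by (simp add: scaleR_2)
  then have "2 *\<^sub>R \<phi> a = \<phi> w + \<phi> (adj w)"
    by (simp flip: star_homD[OF \<phi>(1)])
  then have "2 * norm (\<phi> a) = norm (\<phi> w + \<phi> (adj w))" by (metis norm_scaleR abs_numeral)
  also have "\<dots> \<le> 2" using norm_triangle_ineq[of "\<phi> w" "\<phi> (adj w)"] n by linarith
  finally show ?thesis by simp
qed

text \<open>
The C*-identity reduces the claim to selfadjoint elements, and scaling reduces it to norm less
than 1.
\<close>

theorem star_hom_contractive:
  fixes \<phi> :: "'a::unital_cstar_algebra \<Rightarrow> 'b::unital_cstar_algebra"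
  assumes \<phi>: "star_hom \<phi>" "\<phi> 1 = 1"
  shows "norm (\<phi> x) \<le> norm x"
proof -
  have sa: "norm (\<phi> a) \<le> norm a" if a: "adj a = a" for a
  proof (rule field_le_epsilon)
    fix e :: real assume e: "e > 0"
    define r where "r = norm a + e"
    have r: "r > 0" using e norm_ge_zero[of a] unfolding r_def by linarith
    have "adj (inverse r *\<^sub>R a) = inverse r *\<^sub>R a"
      by (simp add: adj_scaleR a)
    moreover have "norm (inverse r *\<^sub>R a) < 1" using r e by (simp add: r_def divide_simps)
    ultimately have "norm (\<phi> (inverse r *\<^sub>R a)) \<le> 1"
      by (rule star_hom_contractive_selfadjoint[OF \<phi>])
    then show "norm (\<phi> a) \<le> norm a + e"
      using r by (simp add: star_homD[OF \<phi>(1)] r_def divide_simps)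
  qed
  have "norm (\<phi> x) ^ 2 = norm (\<phi> (adj x * x))"
    by (simp add: star_homD[OF \<phi>(1)] cstar_identity)
  also have "\<dots> \<le> norm (adj x * x)" by (rule sa) (simp add: adj_mult adj_adj)
  also have "\<dots> = norm x ^ 2" by (rule cstar_identity)
  finally show ?thesis by (simp add: power2_le_iff_abs_le)
qed

lemma star_hom_bounded_linear:
  fixes \<phi> :: "'a::unital_cstar_algebra \<Rightarrow> 'b::unital_cstar_algebra"
  assumes "star_hom \<phi>" "\<phi> 1 = 1"
  shows "bounded_linear \<phi>"
  by (rule bounded_linear_intro[where K=1])
     (use assms star_hom_contractive[OF assms] in \<open>auto simp: star_homD\<close>)

lemma cstar_generated_minimal: "cstar_subalgebra C \<Longrightarrow> X \<subseteq> C \<Longrightarrow> cstar_generated X \<subseteq> C"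
  by (auto simp: cstar_generated_def)

text \<open>
Two unital homomorphisms that agree on generators agree everywhere; contractivity is what makes
this set closed.
\<close>

lemma cstar_subalgebra_equalizer:
  fixes \<phi> \<psi> :: "'a::unital_cstar_algebra \<Rightarrow> 'b::unital_cstar_algebra"
  assumes \<phi>: "star_hom \<phi>" "\<phi> 1 = 1" and \<psi>: "star_hom \<psi>" "\<psi> 1 = 1"
  shows "cstar_subalgebra {x. \<phi> x = \<psi> x}"
proof -
  note [continuous_intros] = bounded_linear.continuous_on[OF star_hom_bounded_linear[OF \<phi>]]
    bounded_linear.continuous_on[OF star_hom_bounded_linear[OF \<psi>]]
  have "closed {x. \<phi> x = \<psi> x}"
    by (intro closed_Collect_eq continuous_intros)
  then show ?thesis
    by (auto simp: cstar_subalgebra_def star_homD[OF \<phi>(1)] star_homD[OF \<psi>(1)])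
qed

lemma star_hom_id: "star_hom (\<lambda>x. x)"
  by (simp add: star_hom_def)

lemma cstar_subalgebra_sum:
  "cstar_subalgebra C \<Longrightarrow> (\<And>i. i \<in> I \<Longrightarrow> f i \<in> C) \<Longrightarrow> (\<Sum>i\<in>I. f i) \<in> C"
  by (induction I rule: infinite_finite_induct) (auto simp: cstar_subalgebra_def)

section \<open>Commutants\<close>

definition commutant :: "'a::cstar_algebra set \<Rightarrow> 'a set" where
  "commutant X = {y. \<forall>x\<in>X. x * y = y * x}"

lemma cstar_subalgebra_commutant:
  assumes X: "\<And>x. x \<in> X \<Longrightarrow> adj x \<in> X"
  shows "cstar_subalgebra (commutant X)"
  unfolding cstar_subalgebra_def
proof (intro conjI ballI allI)
  have "commutant X = (\<Inter>x\<in>X. {y. x * y = y * x})" by (auto simp: commutant_def)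
  moreover have "closed {y. x * y = y * x}" for x :: 'a
    by (intro closed_Collect_eq continuous_intros)
  ultimately show "closed (commutant X)" by auto
  fix y assume y: "y \<in> commutant X"
  show "adj y \<in> commutant X"
    unfolding commutant_def
  proof (clarify)
    fix x assume "x \<in> X"
    then have "adj x * y = y * adj x" using X y by (auto simp: commutant_def)
    then have "adj (adj x * y) = adj (y * adj x)" by simp
    then show "x * adj y = adj y * x" by (simp add: adj_mult adj_adj)
  qed
  show "y * z \<in> commutant X" if "z \<in> commutant X" for z
    using y that by (simp add: commutant_def) (metis mult.assoc)
qed (auto simp: commutant_def distrib_left distrib_right scaleC_mult_left scaleC_mult_right)

text \<open>
The commutant of a selfadjoint set is itself a C*-subalgebra, hence so is the second commutant,
which contains \<open>X\<close> and therefore everything that \<open>X\<close> generates.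
\<close>

lemma commutant_cstar_generated:
  assumes X: "\<And>x. x \<in> X \<Longrightarrow> adj x \<in> X"
  shows "commutant (cstar_generated X) = commutant X"
proof
  show "commutant (cstar_generated X) \<subseteq> commutant X"
    using cstar_generated_superset[of X] by (auto simp: commutant_def)
  have "cstar_generated X \<subseteq> commutant (commutant X)"
  proof (rule cstar_generated_minimal)
    have "adj y \<in> commutant X" if "y \<in> commutant X" for y
      using that cstar_subalgebra_commutant[OF X] by (simp add: cstar_subalgebra_def)
    then show "cstar_subalgebra (commutant (commutant X))" by (rule cstar_subalgebra_commutant)
  qed (auto simp: commutant_def)
  then show "commutant X \<subseteq> commutant (cstar_generated X)" by (auto simp: commutant_def)
qed

section \<open>Block decompositions\<close>

lemma norm_compress_le:
  fixes a b x :: "'a::real_normed_algebra"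
  assumes "norm a \<le> 1" "norm b \<le> 1"
  shows "norm (a * x * b) \<le> norm x"
proof -
  have "norm (a * x * b) \<le> norm a * norm x * norm b"
    by (meson norm_mult_ineq mult_right_mono norm_ge_zero order_trans)
  also have "\<dots> \<le> 1 * norm x * 1" using assms by (intro mult_mono) auto
  finally show ?thesis by simp
qed

lemma norm_projection_le: "norm (p::'a::cstar_algebra) \<le> 1" if "adj p * p = p"
proof -
  have "norm p = norm p ^ 2" using cstar_identity[of p] that by simp
  then have "norm p = 0 \<or> norm p = 1" by (simp add: power2_eq_square)
  then show ?thesis by auto
qed

lemma norm_projection_eq: "norm (p::'a::cstar_algebra) = 1" if "adj p * p = p" "p \<noteq> 0"
proof -
  have "norm p = norm p ^ 2" using cstar_identity[of p] that by simp
  then show ?thesis using that by (simp add: power2_eq_square)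
qed

lemma norm_selfadjoint_power:
  fixes a :: "'a::unital_cstar_algebra"
  assumes "adj a = a"
  shows "norm (a ^ (2 ^ m)) = norm a ^ (2 ^ m)"
proof (induction m)
  case (Suc m)
  have "a ^ (2 ^ Suc m) = adj (a ^ (2 ^ m)) * a ^ (2 ^ m)"
    by (simp add: adj_power assms flip: power_add mult_2)
  then have "norm (a ^ (2 ^ Suc m)) = norm (a ^ (2 ^ m)) ^ 2" by (simp only: cstar_identity)
  also have "\<dots> = norm a ^ (2 ^ Suc m)" by (simp add: Suc mult.commute flip: power_mult)
  finally show ?case .
qed simp

text \<open>
The norm of a block diagonal element is the maximum of the norms of its blocks. The triangle
inequality loses a factor \<open>card I\<close>; since powers of \<open>a = x\<^sup>* x\<close> are block diagonal again and
\<open>\<parallel>a\<^bsup>2^m\<^esup>\<parallel> = \<parallel>a\<parallel>\<^bsup>2^m\<^esup>\<close>, this factor disappears when roots are taken and \<open>m\<close> grows.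
\<close>

lemma norm_le_of_blocks:
  fixes x :: "'a::unital_cstar_algebra"
  assumes fin: "finite I" and p: "\<And>i. i \<in> I \<Longrightarrow> adj (p i) = p i" "\<And>i. i \<in> I \<Longrightarrow> p i * p i = p i"
    and one: "(\<Sum>i\<in>I. p i) = 1" and comm: "\<And>i. i \<in> I \<Longrightarrow> p i * x = x * p i"
    and K: "\<And>i. i \<in> I \<Longrightarrow> norm (p i * x) \<le> K" "K \<ge> 0"
  shows "norm x \<le> K"
proof -
  define a where "a = adj x * x"
  have a: "adj a = a" by (simp add: a_def adj_mult adj_adj)
  have comma: "p i * a = a * p i" if "i \<in> I" for i
  proof -
    have "adj x * p i = p i * adj x"
      using comm[OF that] p(1)[OF that] by (metis adj_mult)
    then show ?thesis using comm[OF that] unfolding a_def by (metis mult.assoc)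
  qed
  have pw: "p i * a ^ Suc k = (p i * a) ^ Suc k" if "i \<in> I" for i k
  proof (induction k)
    case (Suc k)
    have "(p i * a) ^ Suc (Suc k) = p i * a * (p i * a ^ Suc k)"
      unfolding Suc by (rule power_Suc)
    also have "\<dots> = a * (p i * p i) * a ^ Suc k"
      by (simp add: comma[OF that] mult.assoc)
    also have "\<dots> = (a * p i) * a ^ Suc k" by (simp only: p that)
    also have "\<dots> = p i * a ^ Suc (Suc k)" by (simp add: comma[OF that, symmetric] mult.assoc)
    finally show ?case by simp
  qed simp
  have blk: "norm (p i * a) \<le> K\<^sup>2" if "i \<in> I" for i
  proof -
    have "p i * a = adj (p i * x) * (p i * x)"
    proof -
      have "adj (p i * x) * (p i * x) = adj x * (p i * p i) * x"
        by (simp add: adj_mult p(1) that mult.assoc)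
      also have "\<dots> = adj x * (p i * x)" by (simp only: p that) (rule mult.assoc)
      also have "\<dots> = a * p i" by (simp only: comm[OF that] a_def mult.assoc)
      finally show ?thesis by (simp add: comma that)
    qed
    then have "norm (p i * a) = norm (p i * x) ^ 2" by (simp only: cstar_identity)
    then show ?thesis using K(1)[OF that] by (simp add: power_mono)
  qed
  have bound: "norm a ^ (2 ^ m) \<le> real (card I) * (K\<^sup>2) ^ (2 ^ m)" for m
  proof -
    obtain k where k: "(2::nat) ^ m = Suc k" by (metis Suc_pred zero_less_numeral zero_less_power)
    have "norm a ^ (2 ^ m) = norm ((\<Sum>i\<in>I. p i) * a ^ Suc k)"
      using norm_selfadjoint_power[OF a, of m] by (simp only: one k) simp
    also have "\<dots> = norm (\<Sum>i\<in>I. (p i * a) ^ Suc k)"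
      unfolding sum_distrib_right using pw by simp
    also have "\<dots> \<le> (\<Sum>i\<in>I. (K\<^sup>2) ^ Suc k)"
    proof (rule sum_norm_le)
      show "norm ((p i * a) ^ Suc k) \<le> (K\<^sup>2) ^ Suc k" if "i \<in> I" for i
        by (rule order_trans[OF norm_power_le power_mono[OF blk[OF that] norm_ge_zero]])
    qed
    finally show ?thesis by (simp add: k)
  qed
  have "norm a \<le> K\<^sup>2"
  proof (rule ccontr)
    assume "\<not> norm a \<le> K\<^sup>2"
    then have less: "K\<^sup>2 < norm a" by simp
    show False
    proof (cases "K = 0")
      case True
      then show ?thesis using bound[of 0] less by simp
    next
      case False
      define q where "q = norm a / K\<^sup>2"
      have q: "q > 1" using less False by (simp add: q_def divide_simps)
      have le: "q ^ (2 ^ m) \<le> real (card I)" for m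
        using bound[of m] False by (simp add: q_def power_divide divide_simps)
      obtain n where n: "real (card I) < q ^ n" using real_arch_pow[OF q] by blast
      have "q ^ n \<le> q ^ (2 ^ n)" using q by (intro power_increasing) auto
      then show False using le[of n] n by linarith
    qed
  qed
  then have "norm x ^ 2 \<le> K\<^sup>2" by (simp add: a_def cstar_identity)
  then show ?thesis using K(2) by (simp add: power2_le_iff_abs_le)
qed

section \<open>The Hilbert space of square-summable families\<close>

typedef 'i ell2 = "{f :: 'i \<Rightarrow> complex. (\<lambda>i. (norm (f i))\<^sup>2) summable_on UNIV}"
  by (rule exI[of _ "\<lambda>_. 0"]) simp

setup_lifting type_definition_ell2

lemma summable_inner:
  fixes f g :: "'i \<Rightarrow> complex"
  assumes "(\<lambda>i. (norm (f i))\<^sup>2) summable_on UNIV" "(\<lambda>i. (norm (g i))\<^sup>2) summable_on UNIV"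
  shows "(\<lambda>i. f i \<bullet> g i) summable_on UNIV"
proof -
  have "(\<lambda>i. norm (f i \<bullet> g i)) summable_on UNIV"
  proof (rule summable_on_comparison_test)
    show "(\<lambda>i. (norm (f i))\<^sup>2 + (norm (g i))\<^sup>2) summable_on UNIV"
      by (rule summable_on_add[OF assms])
    show "norm (f i \<bullet> g i) \<le> (norm (f i))\<^sup>2 + (norm (g i))\<^sup>2" for i
      using Cauchy_Schwarz_ineq2[of "f i" "g i"] sum_squares_bound[of "norm (f i)" "norm (g i)"]
        mult_nonneg_nonneg[OF norm_ge_zero[of "f i"] norm_ge_zero[of "g i"]]
      unfolding real_norm_def by linarith
  qed auto
  then show ?thesis by (rule abs_summable_summable)
qed

lemma summable_norm_add:
  fixes f g :: "'i \<Rightarrow> complex"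
  assumes "(\<lambda>i. (norm (f i))\<^sup>2) summable_on UNIV" "(\<lambda>i. (norm (g i))\<^sup>2) summable_on UNIV"
  shows "(\<lambda>i. (norm (f i + g i))\<^sup>2) summable_on UNIV"
proof -
  have "(\<lambda>i. (norm (f i))\<^sup>2 + (norm (g i))\<^sup>2 + 2 * (f i \<bullet> g i)) summable_on UNIV"
    by (intro summable_on_add assms summable_on_cmult_right summable_inner)
  moreover have "(norm (f i + g i))\<^sup>2 = (norm (f i))\<^sup>2 + (norm (g i))\<^sup>2 + 2 * (f i \<bullet> g i)" for i
    by (simp add: power2_norm_eq_inner inner_add_left inner_add_right inner_commute)
  ultimately show ?thesis by simp
qed

lemma summable_norm_mult:
  fixes f :: "'i \<Rightarrow> complex"
  assumes "(\<lambda>i. (norm (f i))\<^sup>2) summable_on UNIV"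
  shows "(\<lambda>i. (norm (c * f i))\<^sup>2) summable_on UNIV"
  using summable_on_cmult_right[OF assms, of "(cmod c)\<^sup>2"] by (simp add: norm_mult power_mult_distrib)

instantiation ell2 :: (type) real_vector
begin
lift_definition zero_ell2 :: "'a ell2" is "\<lambda>_. 0" by simp
lift_definition plus_ell2 :: "'a ell2 \<Rightarrow> 'a ell2 \<Rightarrow> 'a ell2" is "\<lambda>f g i. f i + g i"
  by (rule summable_norm_add)
lift_definition uminus_ell2 :: "'a ell2 \<Rightarrow> 'a ell2" is "\<lambda>f i. - f i" by simp
lift_definition minus_ell2 :: "'a ell2 \<Rightarrow> 'a ell2 \<Rightarrow> 'a ell2" is "\<lambda>f g i. f i - g i"
  using summable_norm_add[where g="\<lambda>i. - g i" for g] by fastforce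
lift_definition scaleR_ell2 :: "real \<Rightarrow> 'a ell2 \<Rightarrow> 'a ell2" is "\<lambda>r f i. r *\<^sub>R f i"
  using summable_norm_mult by (simp add: scaleR_conv_of_real)
instance
  by standard (transfer; simp add: algebra_simps fun_eq_iff)+
end

instantiation ell2 :: (type) real_inner
begin
lift_definition inner_ell2 :: "'a ell2 \<Rightarrow> 'a ell2 \<Rightarrow> real" is "\<lambda>f g. \<Sum>\<^sub>\<infinity>i. f i \<bullet> g i" .
definition norm_ell2 :: "'a ell2 \<Rightarrow> real" where "norm_ell2 x = sqrt (x \<bullet> x)"
definition sgn_ell2 :: "'a ell2 \<Rightarrow> 'a ell2" where "sgn_ell2 x = inverse (norm x) *\<^sub>R x"
definition dist_ell2 :: "'a ell2 \<Rightarrow> 'a ell2 \<Rightarrow> real" where "dist_ell2 x y = norm (x - y)"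
definition uniformity_ell2 :: "('a ell2 \<times> 'a ell2) filter" where
  "uniformity_ell2 = (INF e\<in>{0 <..}. principal {(x, y). dist x y < e})"
definition open_ell2 :: "'a ell2 set \<Rightarrow> bool" where
  "open_ell2 U = (\<forall>x\<in>U. \<forall>\<^sub>F (x', y) in uniformity. x' = x \<longrightarrow> y \<in> U)"
instance
proof
  fix x y z :: "'a ell2" and r :: real
  show "x \<bullet> y = y \<bullet> x" by transfer (simp add: inner_commute)
  show "(x + y) \<bullet> z = x \<bullet> z + y \<bullet> z"
    by transfer (simp add: inner_add_left infsum_add summable_inner)
  show "(r *\<^sub>R x) \<bullet> y = r * (x \<bullet> y)"
    by transfer (simp add: infsum_cmult_right')
  show "0 \<le> x \<bullet> x" by transfer (simp add: infsum_nonneg)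
  show "x \<bullet> x = 0 \<longleftrightarrow> x = 0"
  proof (transfer, rule iffI)
    fix f :: "'a \<Rightarrow> complex"
    assume f: "(\<lambda>i. (norm (f i))\<^sup>2) summable_on UNIV" and 0: "(\<Sum>\<^sub>\<infinity>i. f i \<bullet> f i) = 0"
    have "f i \<bullet> f i = 0" for i
      by (rule nonneg_infsum_le_0D[where A=UNIV and f="\<lambda>i. f i \<bullet> f i"])
         (use 0 summable_inner[OF f f] in auto)
    then show "f = (\<lambda>_. 0)" by (simp add: fun_eq_iff)
  qed simp
qed (rule norm_ell2_def sgn_ell2_def dist_ell2_def uniformity_ell2_def open_ell2_def)+
end

lemma summable_ell2: "(\<lambda>i. (norm (Rep_ell2 x i))\<^sup>2) summable_on UNIV"
  using Rep_ell2[of x] by simp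

lemma norm_ell2_square: "(norm (x :: 'i ell2))\<^sup>2 = (\<Sum>\<^sub>\<infinity>i. (norm (Rep_ell2 x i))\<^sup>2)"
  unfolding power2_norm_eq_inner by transfer (simp add: power2_norm_eq_inner)

lemma sum_le_norm_ell2: "finite F \<Longrightarrow> (\<Sum>i\<in>F. (norm (Rep_ell2 x i))\<^sup>2) \<le> (norm x)\<^sup>2"
  unfolding norm_ell2_square by (rule finite_sum_le_infsum[OF summable_ell2]) auto

lemma norm_coordinate_le: "norm (Rep_ell2 x i) \<le> norm x"
  using sum_le_norm_ell2[of "{i}" x] by (simp add: power2_le_iff_abs_le)

lemma Rep_ell2_simps:
  "Rep_ell2 (x + y) i = Rep_ell2 x i + Rep_ell2 y i" "Rep_ell2 (x - y) i = Rep_ell2 x i - Rep_ell2 y i"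
  "Rep_ell2 (- x) i = - Rep_ell2 x i"
  "Rep_ell2 (r *\<^sub>R x) i = r *\<^sub>R Rep_ell2 x i" "Rep_ell2 0 i = 0"
  by (transfer, simp)+

text \<open>Completeness: the coordinatewise limit of a Cauchy sequence is bounded on finite sets of
  coordinates uniformly, by the Cauchy estimate.\<close>

instance ell2 :: (type) banach
proof
  fix X :: "nat \<Rightarrow> 'a ell2" assume X: "Cauchy X"
  have "Cauchy (\<lambda>n. Rep_ell2 (X n) i)" for i
  proof (rule CauchyI)
    fix e :: real assume "e > 0"
    then obtain M where M: "\<And>m n. m \<ge> M \<Longrightarrow> n \<ge> M \<Longrightarrow> norm (X m - X n) < e"
      using CauchyD[OF X] by blast
    have "norm (Rep_ell2 (X m) i - Rep_ell2 (X n) i) \<le> norm (X m - X n)" for m n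
      using norm_coordinate_le[of "X m - X n" i] by (simp add: Rep_ell2_simps)
    then show "\<exists>M. \<forall>m\<ge>M. \<forall>n\<ge>M. norm (Rep_ell2 (X m) i - Rep_ell2 (X n) i) < e"
      by (intro exI[of _ M] allI impI le_less_trans[OF _ M])
  qed
  then have "\<forall>i. \<exists>l. (\<lambda>n. Rep_ell2 (X n) i) \<longlonglongrightarrow> l"
    by (simp add: Cauchy_convergent_iff convergent_def)
  from choice[OF this] obtain f where f: "\<And>i. (\<lambda>n. Rep_ell2 (X n) i) \<longlonglongrightarrow> f i"
    by blast
  have est: "\<exists>M. \<forall>n\<ge>M. \<forall>F. finite F \<longrightarrow> (\<Sum>i\<in>F. (norm (Rep_ell2 (X n) i - f i))\<^sup>2) \<le> e\<^sup>2"
    if e: "e > 0" for e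
  proof -
    obtain M where M: "\<And>m n. m \<ge> M \<Longrightarrow> n \<ge> M \<Longrightarrow> norm (X m - X n) < e"
      using CauchyD[OF X e] by blast
    have "(\<Sum>i\<in>F. (norm (Rep_ell2 (X n) i - f i))\<^sup>2) \<le> e\<^sup>2" if n: "n \<ge> M" and F: "finite F" for n F
    proof (rule LIMSEQ_le_const2)
      show "(\<lambda>m. \<Sum>i\<in>F. (norm (Rep_ell2 (X n) i - Rep_ell2 (X m) i))\<^sup>2)
          \<longlonglongrightarrow> (\<Sum>i\<in>F. (norm (Rep_ell2 (X n) i - f i))\<^sup>2)"
        by (intro tendsto_intros f)
      have "(\<Sum>i\<in>F. (norm (Rep_ell2 (X n) i - Rep_ell2 (X m) i))\<^sup>2) \<le> e\<^sup>2" if "m \<ge> M" for m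
      proof -
        have "(\<Sum>i\<in>F. (norm (Rep_ell2 (X n) i - Rep_ell2 (X m) i))\<^sup>2) \<le> (norm (X n - X m))\<^sup>2"
          using sum_le_norm_ell2[OF F, of "X n - X m"] by (simp add: Rep_ell2_simps)
        also have "\<dots> \<le> e\<^sup>2" using M[OF n that] by (intro power_mono) auto
        finally show ?thesis .
      qed
      then show "\<exists>N. \<forall>m\<ge>N. (\<Sum>i\<in>F. (norm (Rep_ell2 (X n) i - Rep_ell2 (X m) i))\<^sup>2) \<le> e\<^sup>2"
        by blast
    qed
    then show ?thesis by blast
  qed
  have sq: "(\<lambda>i. (norm (g i))\<^sup>2) summable_on UNIV"
    if "\<And>F. finite F \<Longrightarrow> (\<Sum>i\<in>F. (norm (g i))\<^sup>2) \<le> K" for g :: "'a \<Rightarrow> complex" and K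
    by (rule nonneg_bdd_above_summable_on) (use that in \<open>auto intro!: bdd_aboveI\<close>)
  obtain M where "\<forall>F. finite F \<longrightarrow> (\<Sum>i\<in>F. (norm (Rep_ell2 (X M) i - f i))\<^sup>2) \<le> 1\<^sup>2"
    using est[of 1] by auto
  then have "(\<lambda>i. (norm (Rep_ell2 (X M) i - f i))\<^sup>2) summable_on UNIV" by (intro sq) blast
  from summable_norm_add[OF summable_ell2[of "X M"] summable_norm_mult[OF this, of "-1"]]
  have fs: "(\<lambda>i. (norm (f i))\<^sup>2) summable_on UNIV" by simp
  define L where "L = Abs_ell2 f"
  have L: "Rep_ell2 L = f" unfolding L_def by (rule Abs_ell2_inverse) (simp add: fs)
  have "X \<longlonglongrightarrow> L"
  proof (rule LIMSEQ_I)
    fix e :: real assume e: "e > 0"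
    then obtain M where
      M: "\<And>n F. n \<ge> M \<Longrightarrow> finite F \<Longrightarrow> (\<Sum>i\<in>F. (norm (Rep_ell2 (X n) i - f i))\<^sup>2) \<le> (e / 2)\<^sup>2"
      using est[of "e / 2"] by auto
    have "norm (X n - L) < e" if "n \<ge> M" for n
    proof -
      have "(norm (X n - L))\<^sup>2 = (\<Sum>\<^sub>\<infinity>i. (norm (Rep_ell2 (X n) i - f i))\<^sup>2)"
        by (simp add: norm_ell2_square Rep_ell2_simps L)
      also have "\<dots> \<le> (e / 2)\<^sup>2"
        by (rule infsum_le_finite_sums) (use summable_ell2[of "X n - L"] M that in \<open>auto simp: Rep_ell2_simps L\<close>)
      finally have "norm (X n - L) \<le> e / 2" using e by (simp add: power2_le_iff_abs_le)
      then show ?thesis using e by simp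
    qed
    then show "\<exists>no. \<forall>n\<ge>no. norm (X n - L) < e" by blast
  qed
  then show "convergent X" by (auto simp: convergent_def)
qed

lift_definition cscale :: "complex \<Rightarrow> 'i ell2 \<Rightarrow> 'i ell2" is "\<lambda>c f i. c * f i"
  by (rule summable_norm_mult)

lemma Rep_cscale: "Rep_ell2 (cscale c x) i = c * Rep_ell2 x i"
  by transfer simp

text \<open>The operator induced by a partial injection \<open>g\<close> of the index set with domain \<open>A\<close>. The
  hypothesis on \<open>g\<close> is part of the term because the composition would leave the space without it.\<close>

lift_definition pullback :: "'i set \<Rightarrow> ('i \<Rightarrow> 'i) \<Rightarrow> 'i ell2 \<Rightarrow> 'i ell2" is
  "\<lambda>A g f i. if inj_on g A \<and> i \<in> A then f (g i) else 0"
proof -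
  fix A and g :: "'i \<Rightarrow> 'i" and f :: "'i \<Rightarrow> complex"
  assume f: "(\<lambda>i. (norm (f i))\<^sup>2) summable_on UNIV"
  show "(\<lambda>i. (norm (if inj_on g A \<and> i \<in> A then f (g i) else 0))\<^sup>2) summable_on UNIV"
  proof (cases "inj_on g A")
    case True
    have "(\<lambda>i. (norm (f i))\<^sup>2) summable_on g ` A" by (rule summable_on_subset_banach[OF f]) auto
    then have "((\<lambda>i. (norm (f i))\<^sup>2) \<circ> g) summable_on A" by (simp add: summable_on_reindex True)
    then show ?thesis
      by (rule summable_on_cong_neutral[THEN iffD1, rotated -1]) (auto simp: True)
  qed simp
qed

lemma Rep_pullback: "inj_on g A \<Longrightarrow> Rep_ell2 (pullback A g x) i = (if i \<in> A then Rep_ell2 x (g i) else 0)"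
  by transfer simp

lemma inner_pullback:
  assumes bij: "bij_betw g A B" and h: "\<And>i. i \<in> A \<Longrightarrow> h (g i) = i"
  shows "pullback A g x \<bullet> y = x \<bullet> pullback B h y"
proof -
  have inj: "inj_on g A" "inj_on h B"
    using bij h by (auto simp: bij_betw_def inj_on_def)
  have "pullback A g x \<bullet> y = (\<Sum>\<^sub>\<infinity>i. Rep_ell2 (pullback A g x) i \<bullet> Rep_ell2 y i)"
    by transfer simp
  also have "\<dots> = (\<Sum>\<^sub>\<infinity>i\<in>A. Rep_ell2 x (g i) \<bullet> Rep_ell2 y (h (g i)))"
    by (rule infsum_cong_neutral) (auto simp: Rep_pullback inj h)
  also have "\<dots> = (\<Sum>\<^sub>\<infinity>j\<in>B. Rep_ell2 x j \<bullet> Rep_ell2 y (h j))"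
    by (rule infsum_reindex_bij_betw[OF bij, of "\<lambda>j. Rep_ell2 x j \<bullet> Rep_ell2 y (h j)"])
  also have "\<dots> = (\<Sum>\<^sub>\<infinity>j. Rep_ell2 x j \<bullet> Rep_ell2 (pullback B h y) j)"
    by (rule infsum_cong_neutral) (auto simp: Rep_pullback inj)
  also have "\<dots> = x \<bullet> pullback B h y" by transfer simp
  finally show ?thesis .
qed

lemma norm_pullback_le:
  assumes inj: "inj_on g A"
  shows "norm (pullback A g x) \<le> norm x"
proof -
  have "(norm (pullback A g x))\<^sup>2 = (\<Sum>\<^sub>\<infinity>i\<in>A. (norm (Rep_ell2 x (g i)))\<^sup>2)"
    unfolding norm_ell2_square by (rule infsum_cong_neutral) (auto simp: Rep_pullback inj)
  also have "\<dots> = (\<Sum>\<^sub>\<infinity>j\<in>g ` A. (norm (Rep_ell2 x j))\<^sup>2)"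
    using infsum_reindex[OF inj, of "\<lambda>j. (norm (Rep_ell2 x j))\<^sup>2"] by (simp add: o_def)
  also have "\<dots> \<le> (norm x)\<^sup>2"
    unfolding norm_ell2_square
    by (rule infsum_mono2[OF summable_on_subset_banach[OF summable_ell2] summable_ell2]) auto
  finally show ?thesis by (rule power2_le_imp_le) simp
qed

lift_definition basis_vector :: "'i \<Rightarrow> 'i ell2" is "\<lambda>j i. if i = j then 1 else 0"
proof -
  fix j :: 'i
  have "(\<lambda>i. (norm (if i = j then 1 else (0::complex)))\<^sup>2) summable_on {j}" by simp
  then show "(\<lambda>i. (norm (if i = j then 1 else (0::complex)))\<^sup>2) summable_on UNIV"
    by (rule summable_on_cong_neutral[THEN iffD1, rotated -1]) auto
qed

lemma Rep_basis_vector: "Rep_ell2 (basis_vector j) i = (if i = j then 1 else 0)"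
  by transfer simp

lemma inner_cscale: "cscale c x \<bullet> y = x \<bullet> cscale (cnj c) (y :: 'i ell2)"
  by transfer (auto simp: inner_complex_def algebra_simps intro!: infsum_cong)

lemma ell2_eqI: "(\<And>i. Rep_ell2 x i = Rep_ell2 y i) \<Longrightarrow> x = y"
  by (metis Rep_ell2_inject ext)

lemma norm_cscale: "norm (cscale c x) = cmod c * norm (x :: 'i ell2)"
proof -
  have "cscale (cnj c) (cscale c x) = (cmod c)\<^sup>2 *\<^sub>R x"
    by (rule ell2_eqI)
       (simp add: Rep_cscale Rep_ell2_simps scaleR_conv_of_real complex_norm_square mult_ac
         del: of_real_power)
  then have "(norm (cscale c x))\<^sup>2 = (cmod c * norm x)\<^sup>2"
    by (simp add: power2_norm_eq_inner[of "cscale c x"] inner_cscale power_mult_distrib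
        power2_norm_eq_inner[of x])
  then show ?thesis by (simp add: power2_eq_iff_nonneg)
qed


lemma cscale_simps:
  "cscale c 0 = 0" "cscale c (x + y) = cscale c x + cscale c y"
  "cscale c (x - y) = cscale c x - cscale c y" "cscale c (- x) = - cscale c x"
  "cscale c (r *\<^sub>R x) = r *\<^sub>R cscale c x" "cscale c (cscale d x) = cscale (c * d) x"
  "cscale (complex_of_real r) x = r *\<^sub>R x" "cscale (c + d) x = cscale c x + cscale d x"
  "cscale 0 x = 0" "cscale 1 x = x"
  by (rule ell2_eqI; simp add: Rep_cscale Rep_ell2_simps algebra_simps scaleR_conv_of_real)+

section \<open>Adjointable operators as a C*-algebra\<close>

text \<open>
Operators are bounded maps of the underlying real Hilbert space that respect complex scalars.
\<close>

typedef 'i bop = "{A :: 'i ell2 \<Rightarrow>\<^sub>L 'i ell2. (\<exists>B. \<forall>x y. blinfun_apply A x \<bullet> y = x \<bullet> blinfun_apply B y) \<and>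
    (\<forall>c x. blinfun_apply A (cscale c x) = cscale c (blinfun_apply A x))}"
  by (rule exI[of _ 0]) (auto simp: cscale_simps intro: exI[of _ 0])

lifting_forget ell2.lifting

setup_lifting type_definition_bop

lift_definition ap :: "'i bop \<Rightarrow> 'i ell2 \<Rightarrow> 'i ell2" is blinfun_apply .

lemma bop_eqI: "(\<And>x. ap a x = ap b x) \<Longrightarrow> a = b"
  by transfer (simp add: blinfun_eqI)

lemma ap_cscale: "ap a (cscale c x) = cscale c (ap a x)"
  by transfer auto

lemma ap_linear: "ap a (x + y) = ap a x + ap a y" "ap a (x - y) = ap a x - ap a y"
    "ap a (r *\<^sub>R x) = r *\<^sub>R ap a x" "ap a 0 = 0"
  by (transfer; simp add: blinfun.bilinear_simps)+

text \<open>
Every operator below is introduced by its action \<open>f\<close> together with an explicit adjoint \<open>g\<close>.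
\<close>

lemma bop_exists:
  fixes f :: "'i ell2 \<Rightarrow> 'i ell2"
  assumes f: "bounded_linear f" "bounded_linear g" "\<And>x y. f x \<bullet> y = x \<bullet> g y"
    and c: "\<And>c x. f (cscale c x) = cscale c (f x)"
  shows "\<exists>a. ap a = f"
proof
  have "Blinfun f \<in> {A. (\<exists>B. \<forall>x y. blinfun_apply A x \<bullet> y = x \<bullet> blinfun_apply B y) \<and>
    (\<forall>c x. blinfun_apply A (cscale c x) = cscale c (blinfun_apply A x))}"
    using assms by (auto simp: bounded_linear_Blinfun_apply intro!: exI[of _ "Blinfun g"])
  then show "ap (Abs_bop (Blinfun f)) = f"
    using f by (simp add: ap.rep_eq Abs_bop_inverse bounded_linear_Blinfun_apply)
qed

lemma bounded_linear_ap: "bounded_linear (ap a)"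
  by transfer (rule blinfun.bounded_linear_right)

lemma bounded_linear_cscale: "bounded_linear (cscale c)"
  by (rule bounded_linear_intro[where K="cmod c"])
     (simp_all add: norm_cscale mult.commute ell2_eqI Rep_cscale Rep_ell2_simps algebra_simps)

lemma ap_adjoint_exists: "\<exists>b. \<forall>x y. ap a x \<bullet> y = x \<bullet> ap b y"
proof -
  obtain B where B: "ap a x \<bullet> y = x \<bullet> blinfun_apply B y" for x y
    using Rep_bop[of a] by (auto simp: ap.rep_eq)
  have "\<exists>b. ap b = blinfun_apply B"
  proof (rule bop_exists)
    show "blinfun_apply B x \<bullet> y = x \<bullet> ap a y" for x y by (metis B inner_commute)
    show "blinfun_apply B (cscale c x) = cscale c (blinfun_apply B x)" for c x
    proof (rule vector_eq_ldot[THEN iffD1, rule_format])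
      fix z
      have "z \<bullet> blinfun_apply B (cscale c x) = cscale (cnj c) (ap a z) \<bullet> x"
        by (simp add: inner_cscale flip: B)
      also have "\<dots> = z \<bullet> cscale c (blinfun_apply B x)"
        using B[of "cscale (cnj c) z" x] by (simp add: ap_cscale inner_cscale)
      finally show "z \<bullet> blinfun_apply B (cscale c x) = z \<bullet> cscale c (blinfun_apply B x)" .
    qed
  qed (rule bounded_linear_ap blinfun.bounded_linear_right)+
  then show ?thesis using B by metis
qed

definition bop_adjoint :: "'a bop \<Rightarrow> 'a bop" where
  "bop_adjoint a = (SOME b. \<forall>x y. ap a x \<bullet> y = x \<bullet> ap b y)"

lemma inner_bop_adjoint: "ap a x \<bullet> y = x \<bullet> ap (bop_adjoint a) y"
  using someI_ex[OF ap_adjoint_exists[of a]] unfolding bop_adjoint_def by blast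

text \<open>
The operations are specified by their action on vectors. The witnesses for the choices below are
supplied by \<open>bop_exists\<close>, in the proof of \<open>ap_simps\<close>.
\<close>

instantiation bop :: (type) real_normed_algebra
begin
definition zero_bop :: "'a bop" where "zero_bop = (SOME a. ap a = (\<lambda>x. 0))"
definition plus_bop :: "'a bop \<Rightarrow> 'a bop \<Rightarrow> 'a bop" where "plus_bop a b = (SOME d. ap d = (\<lambda>x. ap a x + ap b x))"
definition minus_bop :: "'a bop \<Rightarrow> 'a bop \<Rightarrow> 'a bop" where "minus_bop a b = (SOME d. ap d = (\<lambda>x. ap a x - ap b x))"
definition uminus_bop :: "'a bop \<Rightarrow> 'a bop" where "uminus_bop a = (SOME d. ap d = (\<lambda>x. - ap a x))"
definition times_bop :: "'a bop \<Rightarrow> 'a bop \<Rightarrow> 'a bop" where "times_bop a b = (SOME d. ap d = (\<lambda>x. ap a (ap b x)))"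
definition scaleR_bop :: "real \<Rightarrow> 'a bop \<Rightarrow> 'a bop" where "scaleR_bop r a = (SOME d. ap d = (\<lambda>x. r *\<^sub>R ap a x))"
lift_definition norm_bop :: "'a bop \<Rightarrow> real" is norm .
definition sgn_bop :: "'a bop \<Rightarrow> 'a bop" where "sgn_bop x = inverse (norm x) *\<^sub>R x"
definition dist_bop :: "'a bop \<Rightarrow> 'a bop \<Rightarrow> real" where "dist_bop x y = norm (x - y)"
definition uniformity_bop :: "('a bop \<times> 'a bop) filter" where
  "uniformity_bop = (INF e\<in>{0 <..}. principal {(x, y). dist x y < e})"
definition open_bop :: "'a bop set \<Rightarrow> bool" where
  "open_bop U = (\<forall>x\<in>U. \<forall>\<^sub>F (x', y) in uniformity. x' = x \<longrightarrow> y \<in> U)"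

lemma ap_simps: "ap 0 x = 0" "ap (a + b) x = ap a x + ap b x" "ap (a - b) x = ap a x - ap b x"
  "ap (- a) x = - ap a x" "ap (a * b) x = ap a (ap b x)" "ap (r *\<^sub>R a) x = r *\<^sub>R ap a x"
proof -
  note bl = bounded_linear_ap bounded_linear_cscale bounded_linear_compose bounded_linear_add bounded_linear_sub
    bounded_linear_minus bounded_linear_zero
  note csc = ap_cscale cscale_simps
  have "\<exists>d::'a bop. ap d = (\<lambda>x. 0)"
    by (rule bop_exists[where g="\<lambda>x. 0"]) (auto simp: csc)
  from someI_ex[OF this] show "ap 0 x = 0" by (simp add: zero_bop_def)
  have "\<exists>d. ap d = (\<lambda>x. ap a x + ap b x)"
    by (rule bop_exists[where g="\<lambda>x. ap (bop_adjoint a) x + ap (bop_adjoint b) x"])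
       (auto simp: csc inner_add_left inner_add_right inner_bop_adjoint intro: bl)
  from someI_ex[OF this] show "ap (a + b) x = ap a x + ap b x" by (simp add: plus_bop_def)
  have "\<exists>d. ap d = (\<lambda>x. ap a x - ap b x)"
    by (rule bop_exists[where g="\<lambda>x. ap (bop_adjoint a) x - ap (bop_adjoint b) x"])
       (auto simp: csc inner_diff_left inner_diff_right inner_bop_adjoint intro: bl)
  from someI_ex[OF this] show "ap (a - b) x = ap a x - ap b x" by (simp add: minus_bop_def)
  have "\<exists>d. ap d = (\<lambda>x. - ap a x)"
    by (rule bop_exists[where g="\<lambda>x. - ap (bop_adjoint a) x"]) (auto simp: csc inner_bop_adjoint intro: bl)
  from someI_ex[OF this] show "ap (- a) x = - ap a x" by (simp add: uminus_bop_def)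
  have "\<exists>d. ap d = (\<lambda>x. ap a (ap b x))"
    by (rule bop_exists[where g="\<lambda>x. ap (bop_adjoint b) (ap (bop_adjoint a) x)"]) (auto simp: csc inner_bop_adjoint intro: bl)
  from someI_ex[OF this] show "ap (a * b) x = ap a (ap b x)" by (simp add: times_bop_def)
  have "\<exists>d. ap d = (\<lambda>x. r *\<^sub>R ap a x)"
    by (rule bop_exists[where g="\<lambda>x. r *\<^sub>R ap (bop_adjoint a) x"])
       (auto simp: csc inner_bop_adjoint intro: bl bounded_linear_scaleR_right)
  from someI_ex[OF this] show "ap (r *\<^sub>R a) x = r *\<^sub>R ap a x" by (simp add: scaleR_bop_def)
qed

lemma norm_ap_le: "norm (ap a x) \<le> norm a * norm x"
  by transfer (rule norm_blinfun)

lemma norm_bop_bound: "K \<ge> 0 \<Longrightarrow> (\<And>x. norm (ap a x) \<le> K * norm x) \<Longrightarrow> norm a \<le> K"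
  by transfer (rule norm_blinfun_bound)

lemma bop_ext_adjoint: "(\<And>x y. x \<bullet> ap a y = x \<bullet> ap b y) \<Longrightarrow> a = b"
  by (rule bop_eqI) (metis vector_eq_ldot)

lemma norm_times_bop: "norm (a * b) \<le> norm a * norm b" for a b :: "'a bop"
proof (rule norm_bop_bound)
  show "norm (ap (a * b) x) \<le> norm a * norm b * norm x" for x
    using order_trans[OF norm_ap_le[of a "ap b x"] mult_left_mono[OF norm_ap_le[of b x], of "norm a"]]
    by (simp add: ap_simps norm_bop.rep_eq mult_ac)
qed (simp add: norm_bop.rep_eq)

instance
proof
  fix a b d :: "'a bop" and r s :: real
  show "a + b + d = a + (b + d)" "a + b = b + a" "0 + a = a" "- a + a = 0" "a - b = a + - b"
    "r *\<^sub>R (a + b) = r *\<^sub>R a + r *\<^sub>R b" "(r + s) *\<^sub>R a = r *\<^sub>R a + s *\<^sub>R a"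
    "r *\<^sub>R s *\<^sub>R a = (r * s) *\<^sub>R a" "1 *\<^sub>R a = a"
    "a * b * d = a * (b * d)" "(a + b) * d = a * d + b * d" "a * (b + d) = a * b + a * d"
    "r *\<^sub>R a * b = r *\<^sub>R (a * b)" "a * r *\<^sub>R b = r *\<^sub>R (a * b)"
    by (rule bop_eqI, simp add: ap_simps ap_linear algebra_simps)+
  show "norm (a + b) \<le> norm a + norm b"
  proof (rule norm_bop_bound)
    show "norm (ap (a + b) x) \<le> (norm a + norm b) * norm x" for x
      using norm_triangle_ineq[of "ap a x" "ap b x"] norm_ap_le[of a x] norm_ap_le[of b x]
      by (simp add: ap_simps algebra_simps)
  qed (simp add: norm_bop.rep_eq)
  show "norm a = 0 \<longleftrightarrow> a = 0"
  proof
    assume "norm a = 0"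
    then show "a = 0" using norm_ap_le[of a] by (intro bop_eqI) (simp add: ap_simps)
  next
    assume "a = 0"
    then show "norm a = 0"
      using norm_bop_bound[of 0 "0 :: 'a bop"] by (simp add: ap_simps norm_bop.rep_eq)
  qed
  have "blinfun_apply (Rep_bop (r *\<^sub>R a)) = blinfun_apply (r *\<^sub>R Rep_bop a)"
    by (simp add: fun_eq_iff ap_simps blinfun.bilinear_simps flip: ap.rep_eq)
  then have "Rep_bop (r *\<^sub>R a) = r *\<^sub>R Rep_bop a" by (simp only: blinfun_apply_inject)
  then show "norm (r *\<^sub>R a) = \<bar>r\<bar> * norm a" by (simp add: norm_bop.rep_eq)
  show "norm (a * b) \<le> norm a * norm b" by (rule norm_times_bop)
  show "dist a b = norm (a - b)" "sgn a = inverse (norm a) *\<^sub>R a" by (simp_all add: dist_bop_def sgn_bop_def)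
next
  show "uniformity = (INF e\<in>{0 <..}. principal {(x, y :: 'a bop). dist x y < e})"
    by (rule uniformity_bop_def)
  show "open U \<longleftrightarrow> (\<forall>x\<in>U. \<forall>\<^sub>F (x', y) in uniformity. x' = x \<longrightarrow> y \<in> U)" for U :: "'a bop set"
    by (rule open_bop_def)
qed

end

text \<open>
This half of the C*-identity holds because \<open>\<parallel>a x\<parallel>\<^sup>2 = \<langle>x, a\<^sup>* a x\<rangle>\<close>; with submultiplicativity it
forces \<open>a\<close> and \<open>a\<^sup>*\<close> to have the same norm, which gives the other half.
\<close>

lemma norm_square_le: "(norm a)\<^sup>2 \<le> norm (bop_adjoint a * a)" for a :: "'a bop"
proof -
  have "norm (ap a x) \<le> sqrt (norm (bop_adjoint a * a)) * norm x" for x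
  proof -
    have "(norm (ap a x))\<^sup>2 = x \<bullet> ap (bop_adjoint a * a) x"
      by (simp add: power2_norm_eq_inner ap_simps inner_bop_adjoint)
    also have "\<dots> \<le> norm x * norm (ap (bop_adjoint a * a) x)" by (rule norm_cauchy_schwarz)
    also have "\<dots> \<le> norm x * (norm (bop_adjoint a * a) * norm x)" by (intro mult_left_mono norm_ap_le) auto
    also have "\<dots> = (sqrt (norm (bop_adjoint a * a)) * norm x)\<^sup>2"
      by (simp add: power_mult_distrib norm_bop.rep_eq) (simp add: power2_eq_square)
    finally show ?thesis by (rule power2_le_imp_le) (simp add: norm_bop.rep_eq)
  qed
  then have "norm a \<le> sqrt (norm (bop_adjoint a * a))" by (rule norm_bop_bound[rotated]) (simp add: norm_bop.rep_eq)
  then have "(norm a)\<^sup>2 \<le> (sqrt (norm (bop_adjoint a * a)))\<^sup>2"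
    by (rule power_mono) (simp add: norm_bop.rep_eq)
  then show ?thesis by (simp add: norm_bop.rep_eq)
qed

lemma bop_adjoint_bop_adjoint: "bop_adjoint (bop_adjoint a) = a" for a :: "'a bop"
  by (rule bop_ext_adjoint) (metis inner_bop_adjoint inner_commute)

lemma norm_bop_adjoint: "norm (bop_adjoint a) = norm a" for a :: "'a bop"
proof -
  have *: "norm b \<le> norm (bop_adjoint b)" for b :: "'a bop"
  proof (cases "norm b = 0")
    case False
    have "norm b * norm b \<le> norm (bop_adjoint b) * norm b"
      using order_trans[OF norm_square_le norm_times_bop] by (simp add: power2_eq_square)
    then show ?thesis using False by (simp add: norm_bop.rep_eq)
  qed (simp add: norm_bop.rep_eq)
  from *[of a] *[of "bop_adjoint a"] show ?thesis by (simp add: bop_adjoint_bop_adjoint)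
qed

lemma bop_adjoint_diff: "bop_adjoint (a - b) = bop_adjoint a - bop_adjoint b"
  by (rule bop_ext_adjoint) (simp add: ap_simps inner_diff_left inner_diff_right flip: inner_bop_adjoint)

text \<open>The norm limit of a Cauchy sequence of operators is adjointable, because the sequence of
  adjoints is a Cauchy sequence too.\<close>

instance bop :: (type) banach
proof
  fix X :: "nat \<Rightarrow> 'a bop" assume X: "Cauchy X"
  have Rep_diff: "blinfun_apply (Rep_bop a - Rep_bop b) = ap (a - b)" for a b :: "'a bop"
    by (simp add: fun_eq_iff ap_simps blinfun.bilinear_simps flip: ap.rep_eq)
  have norm_diff: "norm (Rep_bop a - Rep_bop b) = norm (a - b)" for a b :: "'a bop"
    unfolding norm_bop.rep_eq
    by (rule arg_cong[of _ _ norm], rule blinfun_eqI) (simp add: Rep_diff flip: ap.rep_eq)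
  have conv: "\<exists>A. (\<lambda>n. Rep_bop (Y n)) \<longlonglongrightarrow> A" if "Cauchy Y" for Y :: "nat \<Rightarrow> 'a bop"
  proof -
    have "Cauchy (\<lambda>n. Rep_bop (Y n))"
      using that by (simp add: Cauchy_def dist_norm norm_diff)
    then show ?thesis by (simp add: Cauchy_convergent_iff convergent_def)
  qed
  have "Cauchy (\<lambda>n. bop_adjoint (X n))"
    using X by (simp add: Cauchy_def dist_norm norm_bop_adjoint flip: bop_adjoint_diff)
  from conv[OF this] obtain B where B: "(\<lambda>n. Rep_bop (bop_adjoint (X n))) \<longlonglongrightarrow> B" by blast
  from conv[OF X] obtain A where A: "(\<lambda>n. Rep_bop (X n)) \<longlonglongrightarrow> A" by blast
  have Ax: "(\<lambda>n. ap (X n) x) \<longlonglongrightarrow> blinfun_apply A x" for x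
    unfolding ap.rep_eq by (intro tendsto_intros A)
  have Bx: "(\<lambda>n. ap (bop_adjoint (X n)) x) \<longlonglongrightarrow> blinfun_apply B x" for x
    unfolding ap.rep_eq by (intro tendsto_intros B)
  have "\<exists>a. ap a = blinfun_apply A"
  proof (rule bop_exists)
    show "blinfun_apply A x \<bullet> y = x \<bullet> blinfun_apply B y" for x y
    proof (rule LIMSEQ_unique)
      show "(\<lambda>n. ap (X n) x \<bullet> y) \<longlonglongrightarrow> blinfun_apply A x \<bullet> y" by (intro tendsto_intros Ax)
      show "(\<lambda>n. ap (X n) x \<bullet> y) \<longlonglongrightarrow> x \<bullet> blinfun_apply B y"
        unfolding inner_bop_adjoint by (intro tendsto_intros Bx)
    qed
    show "blinfun_apply A (cscale c x) = cscale c (blinfun_apply A x)" for c x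
    proof (rule LIMSEQ_unique[OF Ax])
      show "(\<lambda>n. ap (X n) (cscale c x)) \<longlonglongrightarrow> cscale c (blinfun_apply A x)"
        unfolding ap_cscale by (rule bounded_linear.tendsto[OF bounded_linear_cscale Ax])
    qed
  qed (rule blinfun.bounded_linear_right)+
  then obtain a where a: "ap a = blinfun_apply A" by blast
  then have "Rep_bop a = A" by (simp add: ap.rep_eq blinfun_apply_inject)
  then have "X \<longlonglongrightarrow> a" using A by (simp add: LIMSEQ_iff flip: norm_diff)
  then show "convergent X" by (auto simp: convergent_def)
qed

instantiation bop :: (type) cstar_algebra
begin
definition scaleC_bop :: "complex \<Rightarrow> 'a bop \<Rightarrow> 'a bop" where "scaleC_bop c a = (SOME d. ap d = (\<lambda>x. cscale c (ap a x)))"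
definition adj_bop :: "'a bop \<Rightarrow> 'a bop" where "adj_bop = bop_adjoint"

lemma ap_scaleC: "ap (scaleC c a) x = cscale c (ap a x)"
proof -
  have "\<exists>d. ap d = (\<lambda>x. cscale c (ap a x))"
    by (rule bop_exists[where g="\<lambda>x. ap (bop_adjoint a) (cscale (cnj c) x)"])
       (auto simp: cscale_simps ap_cscale inner_bop_adjoint inner_cscale mult.commute
         intro: bounded_linear_ap bounded_linear_cscale bounded_linear_compose)
  from someI_ex[OF this] show ?thesis by (simp add: scaleC_bop_def)
qed

instance
proof
  fix a b d :: "'a bop" and c c' :: complex and r :: real
  note lin = ap_simps ap_scaleC cscale_simps ap_cscale ap_linear
  show "scaleC (complex_of_real r) a = r *\<^sub>R a"
    "scaleC c (a + b) = scaleC c a + scaleC c b" "scaleC (c + c') a = scaleC c a + scaleC c' a"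
    "scaleC c (scaleC c' a) = scaleC (c * c') a" "scaleC c a * b = scaleC c (a * b)"
    "a * scaleC c b = scaleC c (a * b)"
    by (rule bop_eqI, simp add: lin)+
  have sc: "norm (scaleC c a) \<le> cmod c * norm a" for c and a :: "'a bop"
  proof (rule norm_bop_bound)
    show "norm (ap (scaleC c a) x) \<le> cmod c * norm a * norm x" for x
      using mult_left_mono[OF norm_ap_le[of a x], of "cmod c"] by (simp add: ap_scaleC norm_cscale mult.assoc)
  qed (simp add: norm_bop.rep_eq)
  have nc: "norm (scaleC c a) = cmod c * norm a" for c and a :: "'a bop"
  proof (cases "c = 0")
    case True
    then have "scaleC c a = 0" by (intro bop_eqI) (simp add: lin)
    then show ?thesis using True by simp
  next
    case False
    have "scaleC (inverse c) (scaleC c a) = a"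
      using False by (intro bop_eqI) (simp add: lin)
    then have "norm a \<le> norm (scaleC c a) / cmod c"
      using sc[of "inverse c" "scaleC c a"] by (simp add: norm_inverse divide_inverse mult.commute)
    then show ?thesis using sc[of c a] False by (simp add: divide_simps mult.commute)
  qed
  then show "norm (scaleC c a) = cmod c * norm a" .
  show "adj (adj a) = a" unfolding adj_bop_def by (rule bop_adjoint_bop_adjoint)
  show "adj (a + b) = adj a + adj b" "adj (a * b) = adj b * adj a" unfolding adj_bop_def
    by (rule bop_ext_adjoint, simp add: ap_simps inner_add_left inner_add_right flip: inner_bop_adjoint)+
  show "adj (scaleC c a) = scaleC (cnj c) (adj a)" unfolding adj_bop_def
  proof (rule bop_ext_adjoint)
    show "x \<bullet> ap (bop_adjoint (scaleC c a)) y = x \<bullet> ap (scaleC (cnj c) (bop_adjoint a)) y" for x y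
      using inner_bop_adjoint[of "scaleC c a" x y] inner_cscale[of c "ap a x" y]
      by (simp add: ap_scaleC flip: ap_cscale inner_bop_adjoint)
  qed
  show "norm (adj a * a) = (norm a)\<^sup>2" unfolding adj_bop_def
    using norm_square_le[of a] norm_mult_ineq[of "bop_adjoint a" a]
    by (simp add: norm_bop_adjoint power2_eq_square)
qed

end

lemma ap_adj: "ap a x \<bullet> y = x \<bullet> ap (adj a) y"
  unfolding adj_bop_def by (rule inner_bop_adjoint)


section \<open>The Cuntz-Krieger family on infinite paths\<close>

definition pullback_op :: "'i set \<Rightarrow> ('i \<Rightarrow> 'i) \<Rightarrow> 'i bop" where
  "pullback_op A g = (SOME a. ap a = pullback A g)"

lemma ap_pullback_op:
  assumes inj: "inj_on g A"
  shows "ap (pullback_op A g) = pullback A g"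
proof -
  have bl: "bounded_linear (pullback A g)" if "inj_on g A" for A and g :: "'i \<Rightarrow> 'i"
    using norm_pullback_le[OF that]
    by (intro bounded_linear_intro[where K=1] ell2_eqI) (auto simp: Rep_pullback that Rep_ell2_simps)
  have "\<exists>a. ap a = pullback A g"
  proof (rule bop_exists)
    show "pullback A g x \<bullet> y = x \<bullet> pullback (g ` A) (inv_into A g) y" for x y
      by (rule inner_pullback) (simp_all add: inj inj_on_imp_bij_betw)
    show "pullback A g (cscale c x) = cscale c (pullback A g x)" for c x
      by (rule ell2_eqI) (simp add: Rep_pullback inj Rep_cscale)
  qed (simp_all add: bl inj inj_on_inv_into)
  then show ?thesis unfolding pullback_op_def by (rule someI_ex)
qed

lemma Rep_pullback_op:
  "inj_on g A \<Longrightarrow> Rep_ell2 (ap (pullback_op A g) x) i = (if i \<in> A then Rep_ell2 x (g i) else 0)"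
  by (simp add: ap_pullback_op Rep_pullback)

lemma adj_pullback_op:
  assumes bij: "bij_betw g A B" and h: "\<And>i. i \<in> A \<Longrightarrow> h (g i) = i"
  shows "adj (pullback_op A g) = pullback_op B h"
proof (rule bop_ext_adjoint)
  have "inj_on g A" "inj_on h B" using bij h by (auto simp: bij_betw_def inj_on_def)
  then show "x \<bullet> ap (adj (pullback_op A g)) y = x \<bullet> ap (pullback_op B h) y" for x y
    using inner_pullback[OF bij h, of x y] by (simp add: ap_pullback_op flip: ap_adj)
qed

lemma ap_sum: "ap (\<Sum>i\<in>I. f i) x = (\<Sum>i\<in>I. ap (f i) x)"
  by (induction I rule: infinite_finite_induct) (simp_all add: ap_simps)

lemma Rep_ell2_sum: "Rep_ell2 (\<Sum>i\<in>I. f i) j = (\<Sum>i\<in>I. Rep_ell2 (f i) j)"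
  by (induction I rule: infinite_finite_induct) (simp_all add: Rep_ell2_simps)

lemma bop_coordinate_eqI: "(\<And>x i. Rep_ell2 (ap a x) i = Rep_ell2 (ap b x) i) \<Longrightarrow> a = b"
  by (intro bop_eqI ell2_eqI)

definition infinite_paths :: "('v, 'e) pre_digraph \<Rightarrow> (nat \<Rightarrow> 'e) set" where
  "infinite_paths G = {x. \<forall>n. x n \<in> arcs G \<and> head G (x n) = tail G (x (Suc n))}"

text \<open>
Infinite paths carry the shift representation: \<open>S e\<close> maps the basis vector of \<open>x\<close> to that of the
path \<open>e\<close> followed by \<open>x\<close>. As an operation on coordinates this reads the value at the shifted path.
\<close>

definition path_vertex_op :: "('v, 'e) pre_digraph \<Rightarrow> 'v \<Rightarrow> (nat \<Rightarrow> 'e) bop" where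
  "path_vertex_op G v = pullback_op {x \<in> infinite_paths G. tail G (x 0) = v} (\<lambda>x. x)"

definition path_edge_op :: "('v, 'e) pre_digraph \<Rightarrow> 'e \<Rightarrow> (nat \<Rightarrow> 'e) bop" where
  "path_edge_op G e = pullback_op {x \<in> infinite_paths G. x 0 = e} (\<lambda>x n. x (Suc n))"

lemma case_nat_shift: "x 0 = e \<Longrightarrow> case_nat e (\<lambda>n. x (Suc n)) = x"
  by (auto simp: fun_eq_iff split: nat.split)

lemma infinite_path_shift:
  "x \<in> infinite_paths G \<Longrightarrow> (\<lambda>n. x (Suc n)) \<in> infinite_paths G"
  "x \<in> infinite_paths G \<Longrightarrow> tail G (x (Suc 0)) = head G (x 0)"
  by (auto simp: infinite_paths_def)

lemma infinite_path_prepend: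
  "case_nat e x \<in> infinite_paths G \<longleftrightarrow> x \<in> infinite_paths G \<and> e \<in> arcs G \<and> tail G (x 0) = head G e"
  unfolding infinite_paths_def by (auto split: nat.split)

lemma adj_path_vertex_op: "adj (path_vertex_op G v) = path_vertex_op G v"
  unfolding path_vertex_op_def by (rule adj_pullback_op) (auto simp: bij_betw_def)

lemma inj_shift: "inj_on (\<lambda>x n. x (Suc n)) {x \<in> infinite_paths G. x 0 = e}"
  by (rule inj_on_inverseI[of _ "case_nat e"]) (simp add: case_nat_shift)

lemma inj_prepend: "inj_on (case_nat e) X"
  by (auto simp: inj_on_def fun_eq_iff split: nat.splits)

lemma adj_path_edge_op:
  assumes "e \<in> arcs G"
  shows "adj (path_edge_op G e) = pullback_op {x \<in> infinite_paths G. tail G (x 0) = head G e} (case_nat e)"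
  unfolding path_edge_op_def
proof (rule adj_pullback_op)
  show "bij_betw (\<lambda>x n. x (Suc n)) {x \<in> infinite_paths G. x 0 = e} {x \<in> infinite_paths G. tail G (x 0) = head G e}"
    by (rule bij_betw_byWitness[where f'="case_nat e"])
       (use assms in \<open>auto simp: case_nat_shift infinite_path_shift infinite_path_prepend\<close>)
qed (simp add: case_nat_shift)

lemma Rep_path_ops:
  "Rep_ell2 (ap (path_vertex_op G v) x) i = (if i \<in> infinite_paths G \<and> tail G (i 0) = v then Rep_ell2 x i else 0)"
  "Rep_ell2 (ap (path_edge_op G e) x) i = (if i \<in> infinite_paths G \<and> i 0 = e then Rep_ell2 x (\<lambda>n. i (Suc n)) else 0)"
  "e \<in> arcs G \<Longrightarrow> Rep_ell2 (ap (adj (path_edge_op G e)) x) i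
    = (if i \<in> infinite_paths G \<and> tail G (i 0) = head G e then Rep_ell2 x (case_nat e i) else 0)"
  by (simp add: path_vertex_op_def Rep_pullback_op)
     (simp add: path_edge_op_def Rep_pullback_op inj_shift,
      simp add: adj_path_edge_op Rep_pullback_op inj_prepend)

lemma Rep_range_projection:
  "e \<in> arcs G \<Longrightarrow> Rep_ell2 (ap (path_edge_op G e) (ap (adj (path_edge_op G e)) x)) i
    = (if i \<in> infinite_paths G \<and> i 0 = e then Rep_ell2 x i else 0)"
  by (auto simp: Rep_path_ops infinite_path_shift case_nat_shift)

lemma ck_family_infinite_paths:
  fixes G :: "('v, 'e) pre_digraph"
  shows "ck_family G (path_vertex_op G) (path_edge_op G)"
  unfolding ck_family_def
proof (intro conjI ballI impI)
  fix v w :: 'v assume "v \<noteq> w"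
  then show "path_vertex_op G v * path_vertex_op G w = 0"
    by (intro bop_coordinate_eqI) (auto simp: ap_simps Rep_path_ops Rep_ell2_simps)
next
  fix v
  show "adj (path_vertex_op G v) = path_vertex_op G v" by (rule adj_path_vertex_op)
  show "path_vertex_op G v * path_vertex_op G v = path_vertex_op G v"
    by (rule bop_coordinate_eqI) (auto simp: ap_simps Rep_path_ops)
next
  fix e assume e: "e \<in> arcs G"
  show "path_edge_op G e * adj (path_edge_op G e) * path_edge_op G e = path_edge_op G e"
    by (rule bop_coordinate_eqI)
       (simp add: ap_simps mult.assoc Rep_range_projection e, simp add: Rep_path_ops)
  show "adj (path_edge_op G e) * path_edge_op G e = path_vertex_op G (head G e)"
    by (rule bop_coordinate_eqI) (auto simp: ap_simps Rep_path_ops e infinite_path_prepend)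
  \<comment> \<open>The difference is the projection onto the paths from \<open>tail G e\<close> that do not begin with \<open>e\<close>.\<close>
  define q where "q = pullback_op {x \<in> infinite_paths G. tail G (x 0) = tail G e \<and> x 0 \<noteq> e} (\<lambda>x. x)"
  have q: "Rep_ell2 (ap q x) i
      = (if i \<in> infinite_paths G \<and> tail G (i 0) = tail G e \<and> i 0 \<noteq> e then Rep_ell2 x i else 0)" for x i
    by (simp add: q_def Rep_pullback_op)
  have "adj q = q" unfolding q_def by (rule adj_pullback_op) (auto simp: bij_betw_def)
  then have "path_vertex_op G (tail G e) - path_edge_op G e * adj (path_edge_op G e) = adj q * q"
    by (intro bop_coordinate_eqI)
       (auto simp: ap_simps Rep_ell2_simps Rep_range_projection e q, auto simp: Rep_path_ops)
  then show "cstar_le (path_edge_op G e * adj (path_edge_op G e)) (path_vertex_op G (tail G e))"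
    by (auto simp: cstar_le_def)
  fix f assume "e \<noteq> f"
  then show "adj (path_edge_op G e) * path_edge_op G f = 0"
    by (intro bop_coordinate_eqI) (auto simp: ap_simps Rep_path_ops Rep_ell2_simps e)
next
  fix v assume v: "finite (out_arcs G v) \<and> out_arcs G v \<noteq> {}"
  show "path_vertex_op G v = (\<Sum>e\<in>out_arcs G v. path_edge_op G e * adj (path_edge_op G e))"
  proof (rule bop_coordinate_eqI)
    fix x i
    have "Rep_ell2 (ap (\<Sum>e\<in>out_arcs G v. path_edge_op G e * adj (path_edge_op G e)) x) i
        = (\<Sum>e\<in>out_arcs G v. if e = i 0 then (if i \<in> infinite_paths G then Rep_ell2 x i else 0) else 0)"
      unfolding ap_sum Rep_ell2_sum
      by (intro sum.cong refl) (auto simp: ap_simps Rep_range_projection)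
    also have "\<dots> = (if i \<in> infinite_paths G \<and> i 0 \<in> out_arcs G v then Rep_ell2 x i else 0)"
      using v by (simp add: sum.delta')
    also have "\<dots> = Rep_ell2 (ap (path_vertex_op G v) x) i"
      by (auto simp: Rep_path_ops infinite_paths_def)
    finally show "Rep_ell2 (ap (path_vertex_op G v) x) i
      = Rep_ell2 (ap (\<Sum>e\<in>out_arcs G v. path_edge_op G e * adj (path_edge_op G e)) x) i" ..
  qed
qed

lemma infinite_path_exists:
  assumes wf: "wf_digraph G" and no_sinks: "\<And>v. v \<in> verts G \<Longrightarrow> out_arcs G v \<noteq> {}" and v: "v \<in> verts G"
  obtains x where "x \<in> infinite_paths G" "tail G (x 0) = v"
proof -
  have "\<exists>x. \<forall>n. (x n \<in> arcs G \<and> (n = 0 \<longrightarrow> tail G (x n) = v)) \<and> head G (x n) = tail G (x (Suc n))"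
  proof (rule dependent_nat_choice)
    show "\<exists>e. e \<in> arcs G \<and> (0 = 0 \<longrightarrow> tail G e = v)" using no_sinks[OF v] by auto
    show "\<exists>f. (f \<in> arcs G \<and> (Suc n = 0 \<longrightarrow> tail G f = v)) \<and> head G e = tail G f"
      if "e \<in> arcs G \<and> (n = 0 \<longrightarrow> tail G e = v)" for e n
    proof -
      have "head G e \<in> verts G" using that wf_digraph.head_in_verts[OF wf] by blast
      then show ?thesis using no_sinks[of "head G e"] by (force simp: out_arcs_def)
    qed
  qed
  then show ?thesis using that by (auto simp: infinite_paths_def)
qed

text \<open>
Universality maps \<open>P v\<close> to the projection onto the infinite paths that start at \<open>v\<close>, and in a
finite graph without sinks there is such a path.
\<close>

theorem graph_vertex_projection_nonzero:
  fixes P :: "'v \<Rightarrow> 'a::cstar_algebra"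
  assumes G: "fin_digraph G" and no_sinks: "\<And>v. v \<in> verts G \<Longrightarrow> out_arcs G v \<noteq> {}"
    and univ: "graph_cstar_algebra G P S" and v: "v \<in> verts G"
  shows "P v \<noteq> 0"
proof
  assume "P v = 0"
  interpret fin_digraph G by (rule G)
  obtain \<phi> where "star_hom \<phi>" "\<And>v. v \<in> verts G \<Longrightarrow> \<phi> (P v) = path_vertex_op G v"
    using graph_cstar_algebra_universal[OF G univ ck_family_infinite_paths] by metis
  then have 0: "path_vertex_op G v = 0" using v \<open>P v = 0\<close> by (metis star_homD(7))
  obtain x where x: "x \<in> infinite_paths G" "tail G (x 0) = v"
    by (rule infinite_path_exists[OF wf_digraph_axioms no_sinks v])
  have "Rep_ell2 (ap (path_vertex_op G v) (basis_vector x)) x = 1"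
    by (simp add: Rep_path_ops Rep_basis_vector x)
  then show False by (simp add: 0 ap_simps Rep_ell2_simps)
qed

section \<open>Paths and the diagonal\<close>

lemma closure_UNIV_approx: "closure V = UNIV \<Longrightarrow> e > 0 \<Longrightarrow> \<exists>y\<in>V. norm (x - y) < e" for x :: "'a::real_normed_vector"
  using closure_approachable[of x V] by (auto simp: dist_norm norm_minus_commute)

locale graph_algebra = fin_digraph G for G :: "('v, 'e) pre_digraph" +
  fixes P :: "'v \<Rightarrow> 'a::unital_cstar_algebra" and S :: "'e \<Rightarrow> 'a"
  assumes no_sinks: "\<And>v. v \<in> verts G \<Longrightarrow> out_arcs G v \<noteq> {}"
    and universal: "graph_cstar_algebra G P S"
begin

lemma ck: "ck_family G P S"
  using universal by (simp add: graph_cstar_algebra_def)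

lemma generated: "cstar_generated (P ` verts G \<union> S ` arcs G) = UNIV"
  using universal by (simp add: graph_cstar_algebra_def)

lemmas adj_P = ck_familyD(1)[OF ck]
lemmas P_P = ck_familyD(2)[OF ck]
lemmas S_adj_S_S = ck_familyD(4)[OF ck]
lemmas adj_S_S = ck_familyD(5)[OF ck]
lemmas adj_S_S_neq = ck_familyD(6)[OF ck]

lemma P_mult_P: "v \<in> verts G \<Longrightarrow> w \<in> verts G \<Longrightarrow> P v * P w = (if v = w then P v else 0)"
  using ck_familyD(2,3)[OF ck] by auto

lemma finite_out_arcs: "finite (out_arcs G v)"
  by (rule finite_subset[OF _ finite_arcs]) auto

lemma P_eq_sum: "v \<in> verts G \<Longrightarrow> P v = (\<Sum>e\<in>out_arcs G v. S e * adj (S e))"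
  by (rule ck_familyD(8)[OF ck _ finite_out_arcs no_sinks])

lemma sum_P: "(\<Sum>v\<in>verts G. P v) = 1"
  by (rule graph_cstar_unit[OF fin_digraph_axioms universal])

lemma P_nonzero: "v \<in> verts G \<Longrightarrow> P v \<noteq> 0"
  by (rule graph_vertex_projection_nonzero[OF fin_digraph_axioms no_sinks universal])

lemma S_P: "e \<in> arcs G \<Longrightarrow> S e * P (head G e) = S e"
  using S_adj_S_S adj_S_S by (metis mult.assoc)

lemma P_tail_S: "e \<in> arcs G \<Longrightarrow> P (tail G e) * S e = S e"
proof -
  assume e: "e \<in> arcs G"
  have "P (tail G e) * S e = (\<Sum>f\<in>out_arcs G (tail G e). S f * (adj (S f) * S e))"
    using e by (simp add: P_eq_sum sum_distrib_right mult.assoc)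
  also have "\<dots> = (\<Sum>f\<in>out_arcs G (tail G e). if f = e then S e else 0)"
    using e adj_S_S_neq[of _ e] S_adj_S_S[OF e] by (intro sum.cong refl) (auto simp: mult.assoc)
  also have "\<dots> = S e" using e finite_out_arcs by simp
  finally show ?thesis .
qed

abbreviation isom :: "'v \<Rightarrow> 'e list \<Rightarrow> 'a" where "isom \<equiv> path_isometry P S"

abbreviation range_proj :: "'v \<Rightarrow> 'e list \<Rightarrow> 'a" where
  "range_proj v \<mu> \<equiv> isom v \<mu> * adj (isom v \<mu>)"

lemma isom_Nil: "isom v [] = P v"
  by (simp add: path_isometry_def)

lemma isom_Cons: "e \<in> arcs G \<Longrightarrow> isom v (e # \<mu>) = S e * isom (head G e) \<mu>"
  by (simp add: path_isometry_def S_P)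

lemma P_isom:
  assumes "awalk v \<mu> w" "u \<in> verts G"
  shows "P u * isom v \<mu> = (if u = v then isom v \<mu> else 0)"
proof (cases \<mu>)
  case Nil
  then show ?thesis using assms by (auto simp: isom_Nil P_mult_P awalk_Nil_iff)
next
  case (Cons e \<nu>)
  then have e: "e \<in> arcs G" "v = tail G e" using assms by (auto simp: awalk_Cons_iff)
  then have "P u * isom v \<mu> = P u * P v * isom v \<mu>"
    by (simp add: Cons isom_Cons mult.assoc P_tail_S flip: mult.assoc[of "P (tail G e)"])
  then show ?thesis
    using e assms(2) by (simp add: P_mult_P Cons isom_Cons P_tail_S flip: mult.assoc)
qed

lemma isom_append:
  "awalk v \<alpha> a \<Longrightarrow> awalk a \<rho> b \<Longrightarrow> isom v (\<alpha> @ \<rho>) = isom v \<alpha> * isom a \<rho>"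
proof (induction \<alpha> arbitrary: v)
  case Nil
  then show ?case by (auto simp: isom_Nil awalk_Nil_iff P_isom)
next
  case (Cons e \<alpha>)
  then show ?case by (simp add: awalk_Cons_iff isom_Cons mult.assoc)
qed

lemma isom_P: "awalk v \<alpha> a \<Longrightarrow> isom v \<alpha> * P a = isom v \<alpha>"
  using isom_append[of v \<alpha> a "[]" a] by (simp add: isom_Nil awalk_Nil_iff awalk_last_in_verts)

text \<open>
This is the multiplication rule from which all others follow: distinct edges have orthogonal
ranges, so paths cancel edge by edge until one of them is exhausted, and nothing survives a
mismatch.
\<close>

lemma adj_isom_mult_isom:
  assumes "awalk v \<alpha> a" "awalk u \<mu> w" "length \<alpha> \<le> length \<mu>"
  shows "adj (isom v \<alpha>) * isom u \<mu>
    = (if u = v \<and> take (length \<alpha>) \<mu> = \<alpha> then isom a (drop (length \<alpha>) \<mu>) else 0)"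
  using assms
proof (induction \<alpha> arbitrary: v u \<mu>)
  case Nil
  then show ?case by (auto simp: isom_Nil awalk_Nil_iff adj_P P_isom)
next
  case (Cons e \<alpha>)
  then obtain f \<nu> where \<mu>: "\<mu> = f # \<nu>" by (cases \<mu>) auto
  have e: "e \<in> arcs G" "v = tail G e" "awalk (head G e) \<alpha> a"
    and f: "f \<in> arcs G" "u = tail G f" "awalk (head G f) \<nu> w"
    using Cons.prems by (auto simp: \<mu> awalk_Cons_iff)
  have *: "adj (isom v (e # \<alpha>)) * isom u \<mu>
      = adj (isom (head G e) \<alpha>) * (adj (S e) * S f) * isom (head G f) \<nu>"
    using e f by (simp add: \<mu> isom_Cons adj_mult mult.assoc)
  show ?case
  proof (cases "e = f")
    case True
    have "adj (isom v (e # \<alpha>)) * isom u \<mu> = adj (isom (head G e) \<alpha>) * isom (head G e) \<nu>"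
      using P_isom[OF f(3), of "head G e"] True e f
      unfolding * by (simp add: adj_S_S mult.assoc)
    then show ?thesis
      using Cons.IH[OF e(3), of "head G e" \<nu>] Cons.prems e f True by (simp add: \<mu>)
  next
    case False
    then show ?thesis using * e f by (simp add: adj_S_S_neq \<mu>)
  qed
qed

lemma adj_isom_isom: "awalk v \<mu> w \<Longrightarrow> adj (isom v \<mu>) * isom v \<mu> = P w"
  using adj_isom_mult_isom[of v \<mu> w v \<mu> w] by (simp add: isom_Nil)

lemma range_proj_Cons: "e \<in> arcs G \<Longrightarrow> range_proj v (e # \<mu>) = S e * range_proj (head G e) \<mu> * adj (S e)"
  by (simp add: isom_Cons adj_mult mult.assoc)

lemma adj_range_proj: "adj (range_proj v \<mu>) = range_proj v \<mu>"
  by (simp add: adj_mult adj_adj)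

lemma range_proj_mult:
  assumes "awalk v \<alpha> a" "awalk u \<mu> w" "length \<alpha> \<le> length \<mu>"
  shows "range_proj v \<alpha> * range_proj u \<mu>
    = (if u = v \<and> take (length \<alpha>) \<mu> = \<alpha> then range_proj u \<mu> else 0)"
proof -
  have *: "range_proj v \<alpha> * range_proj u \<mu> = isom v \<alpha> * (adj (isom v \<alpha>) * isom u \<mu>) * adj (isom u \<mu>)"
    by (simp add: mult.assoc)
  show ?thesis
  proof (cases "u = v \<and> take (length \<alpha>) \<mu> = \<alpha>")
    case True
    then have \<mu>: "\<mu> = \<alpha> @ drop (length \<alpha>) \<mu>" by (metis append_take_drop_id)
    then have "awalk v (\<alpha> @ drop (length \<alpha>) \<mu>) w" using assms True by simp
    then have "awalk a (drop (length \<alpha>) \<mu>) w" using assms(1) unfolding awalk_append_iff by auto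
    from isom_append[OF assms(1) this] show ?thesis
      using adj_isom_mult_isom[OF assms] True \<mu> unfolding * by simp
  next
    case False
    then show ?thesis unfolding * adj_isom_mult_isom[OF assms] by auto
  qed
qed

lemma range_proj_idem: "awalk v \<mu> w \<Longrightarrow> range_proj v \<mu> * range_proj v \<mu> = range_proj v \<mu>"
  using range_proj_mult[of v \<mu> w v \<mu> w] by simp

lemma range_proj_commute:
  assumes "awalk v \<alpha> a" "awalk u \<mu> w"
  shows "range_proj v \<alpha> * range_proj u \<mu> = range_proj u \<mu> * range_proj v \<alpha>"
proof -
  have *: "range_proj v \<alpha> * range_proj u \<mu> = range_proj u \<mu> * range_proj v \<alpha>"
    if w: "awalk v \<alpha> a" "awalk u \<mu> w" "length \<alpha> \<le> length \<mu>" for v \<alpha> a u \<mu> w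
  proof -
    have "range_proj u \<mu> * range_proj v \<alpha> = adj (range_proj v \<alpha> * range_proj u \<mu>)"
      by (simp only: adj_mult[of "range_proj v \<alpha>"] adj_range_proj)
    then show ?thesis by (simp add: range_proj_mult[OF w] adj_range_proj)
  qed
  show ?thesis using *[OF assms] *[OF assms(2,1)] by (metis nat_le_linear)
qed

definition paths_from :: "'v \<Rightarrow> nat \<Rightarrow> 'e list set" where
  "paths_from v k = {\<mu>. length \<mu> = k \<and> (\<exists>w. awalk v \<mu> w)}"

lemma paths_from_Suc:
  "paths_from v (Suc k) = (\<Union>e\<in>out_arcs G v. (#) e ` paths_from (head G e) k)"
proof
  show "paths_from v (Suc k) \<subseteq> (\<Union>e\<in>out_arcs G v. (#) e ` paths_from (head G e) k)"
  proof
    fix \<mu> assume "\<mu> \<in> paths_from v (Suc k)"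
    then obtain e \<nu> w where "\<mu> = e # \<nu>" "length \<nu> = k" "awalk v (e # \<nu>) w"
      by (auto simp: paths_from_def length_Suc_conv)
    then show "\<mu> \<in> (\<Union>e\<in>out_arcs G v. (#) e ` paths_from (head G e) k)"
      by (auto simp: awalk_Cons_iff paths_from_def intro!: bexI[of _ e] imageI)
  qed
qed (auto simp: paths_from_def awalk_Cons_iff)

text \<open>
Iterating the relation \<open>P v = (\<Sum>e. S e * adj (S e))\<close>, which is available at every vertex since
none is a sink.
\<close>

lemma sum_paths_from:
  "v \<in> verts G \<Longrightarrow> finite (paths_from v k) \<and> (\<Sum>\<mu>\<in>paths_from v k. range_proj v \<mu>) = P v"
proof (induction k arbitrary: v)
  case 0
  then have "paths_from v 0 = {[]}" by (auto simp: paths_from_def awalk_Nil_iff)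
  then show ?case using 0 by (simp add: isom_Nil adj_P P_P)
next
  case (Suc k)
  have fin: "finite (paths_from (head G e) k)"
    and sum: "(\<Sum>\<mu>\<in>paths_from (head G e) k. range_proj (head G e) \<mu>) = P (head G e)"
    if "e \<in> out_arcs G v" for e
    using Suc.IH[of "head G e"] that by auto
  have "(\<Sum>\<mu>\<in>paths_from v (Suc k). range_proj v \<mu>)
      = (\<Sum>e\<in>out_arcs G v. \<Sum>\<mu>\<in>(#) e ` paths_from (head G e) k. range_proj v \<mu>)"
    unfolding paths_from_Suc by (rule sum.UNION_disjoint) (use fin finite_out_arcs in auto)
  also have "\<dots> = (\<Sum>e\<in>out_arcs G v. S e * adj (S e))"
  proof (rule sum.cong[OF refl])
    fix e assume e: "e \<in> out_arcs G v"
    have "(\<Sum>\<mu>\<in>(#) e ` paths_from (head G e) k. range_proj v \<mu>)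
        = (\<Sum>\<mu>\<in>paths_from (head G e) k. range_proj v (e # \<mu>))"
      by (subst sum.reindex) auto
    also have "\<dots> = (\<Sum>\<mu>\<in>paths_from (head G e) k. S e * range_proj (head G e) \<mu> * adj (S e))"
      using e by (intro sum.cong refl) (auto simp: range_proj_Cons)
    also have "\<dots> = S e * P (head G e) * adj (S e)"
      unfolding sum[OF e, symmetric] sum_distrib_left sum_distrib_right ..
    finally show "(\<Sum>\<mu>\<in>(#) e ` paths_from (head G e) k. range_proj v \<mu>) = S e * adj (S e)"
      using e by (simp add: S_P)
  qed
  finally show ?case using Suc.prems fin finite_out_arcs
    by (simp add: paths_from_Suc flip: P_eq_sum)
qed

definition paths :: "nat \<Rightarrow> ('v \<times> 'e list) set" where
  "paths k = (SIGMA v:verts G. paths_from v k)"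

lemma finite_paths: "finite (paths k)"
  unfolding paths_def using sum_paths_from by (intro finite_SigmaI) auto

lemma pathsE:
  assumes "i \<in> paths k"
  obtains v \<mu> w where "i = (v, \<mu>)" "awalk v \<mu> w" "length \<mu> = k"
  using assms by (auto simp: paths_def paths_from_def)

lemma sum_paths: "(\<Sum>(v, \<mu>)\<in>paths k. range_proj v \<mu>) = 1"
  unfolding paths_def using sum_paths_from sum_P by (simp flip: sum.Sigma)

abbreviation "\<D> \<equiv> diagonal G P S"

definition path_projections :: "'a set" where
  "path_projections = {range_proj v \<mu> |v \<mu> w. awalk v \<mu> w}"

lemma diagonal_eq: "\<D> = cstar_generated path_projections"
  by (simp add: diagonal_def path_projections_def)

lemma adj_path_projections: "x \<in> path_projections \<Longrightarrow> adj x \<in> path_projections"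
  by (force simp: path_projections_def adj_mult adj_adj)

lemma cstar_subalgebra_diagonal: "cstar_subalgebra \<D>"
  unfolding diagonal_eq by (rule cstar_subalgebra_generated)

lemma range_proj_diagonal: "awalk v \<mu> w \<Longrightarrow> range_proj v \<mu> \<in> \<D>"
  unfolding diagonal_eq
  by (rule subsetD[OF cstar_generated_superset]) (auto simp: path_projections_def)

lemma P_diagonal: "v \<in> verts G \<Longrightarrow> P v \<in> \<D>"
  using range_proj_diagonal[of v "[]" v] by (simp add: awalk_Nil_iff isom_Nil adj_P P_P)

lemma one_diagonal: "1 \<in> \<D>"
  unfolding sum_P[symmetric] by (rule cstar_subalgebra_sum[OF cstar_subalgebra_diagonal P_diagonal])

lemma commutant_diagonal: "commutant \<D> = commutant path_projections"
  unfolding diagonal_eq by (rule commutant_cstar_generated[OF adj_path_projections])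

lemma diagonal_commutative: "\<D> \<subseteq> commutant \<D>"
  unfolding commutant_diagonal unfolding diagonal_eq
  by (rule cstar_generated_minimal[OF cstar_subalgebra_commutant[OF adj_path_projections]])
     (auto simp: path_projections_def commutant_def intro: range_proj_commute)

lemma commutant_commutes: "x \<in> commutant \<D> \<Longrightarrow> d \<in> \<D> \<Longrightarrow> d * x = x * d"
  by (simp add: commutant_def)

lemma norm_isom_le: "awalk v \<mu> w \<Longrightarrow> norm (isom v \<mu>) \<le> 1"
proof -
  assume w: "awalk v \<mu> w"
  then have "w \<in> verts G" by (rule awalk_last_in_verts)
  then have "norm (P w) \<le> 1" by (intro norm_projection_le) (simp add: adj_P P_P)
  then have "norm (isom v \<mu>) ^ 2 \<le> 1" by (simp add: adj_isom_isom[OF w] flip: cstar_identity)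
  then show ?thesis by (simp add: power_le_one_iff)
qed

lemma norm_range_proj_le: "awalk v \<mu> w \<Longrightarrow> norm (range_proj v \<mu>) \<le> 1"
  by (rule norm_projection_le) (simp add: adj_range_proj range_proj_idem)

section \<open>Density of the span of monomials\<close>

definition monomials :: "'a set" where
  "monomials = {scaleC c (isom v \<alpha> * adj (isom u \<beta>)) |c v \<alpha> u \<beta> a. awalk v \<alpha> a \<and> awalk u \<beta> a}"

lemma monomialsI: "awalk v \<alpha> a \<Longrightarrow> awalk u \<beta> a \<Longrightarrow> scaleC c (isom v \<alpha> * adj (isom u \<beta>)) \<in> monomials"
  unfolding monomials_def by blast

lemma monomialsI': "awalk v \<alpha> a \<Longrightarrow> awalk u \<beta> a \<Longrightarrow> isom v \<alpha> * adj (isom u \<beta>) \<in> monomials"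
  using monomialsI[of v \<alpha> a u \<beta> 1] by (simp add: scaleC_1)

text \<open>
A generator \<open>S e\<close> lengthens the first path of a monomial and \<open>adj (S e)\<close> shortens it. When that
path is a vertex, \<open>adj (S e)\<close> is absorbed into the second path instead, as
\<open>adj (S e) * adj (S\<^sub>\<beta>) = adj (S\<^sub>\<beta> * S e)\<close>.
\<close>

lemma generator_mult_monomial:
  assumes m: "m \<in> monomials"
  shows "v \<in> verts G \<Longrightarrow> P v * m \<in> span monomials" "e \<in> arcs G \<Longrightarrow> S e * m \<in> span monomials"
    "e \<in> arcs G \<Longrightarrow> adj (S e) * m \<in> span monomials"
proof -
  obtain c u \<alpha> t \<beta> a where w: "awalk u \<alpha> a" "awalk t \<beta> a"
    and m: "m = scaleC c (isom u \<alpha> * adj (isom t \<beta>))"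
    using m by (auto simp: monomials_def)
  have u: "u \<in> verts G" using w awalk_hd_in_verts by blast
  have mu: "P u * m = m"
    using P_isom[OF w(1) u] by (simp add: m scaleC_mult_right flip: mult.assoc)
  show "P v * m \<in> span monomials" if "v \<in> verts G"
  proof -
    have "P v * m = (if v = u then m else 0)"
      using P_isom[OF w(1) that] by (simp add: m scaleC_mult_right flip: mult.assoc)
    then show ?thesis using monomialsI[OF w] by (simp add: m span_base span_zero)
  qed
  show "S e * m \<in> span monomials" if e: "e \<in> arcs G"
  proof (cases "head G e = u")
    case True
    then have "S e * m = scaleC c (isom (tail G e) (e # \<alpha>) * adj (isom t \<beta>))"
      using e by (simp add: m scaleC_mult_right isom_Cons mult.assoc)
    then show ?thesis
      using monomialsI[of "tail G e" "e # \<alpha>" a t \<beta> c] w e True by (simp add: awalk_Cons_iff span_base)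
  next
    case False
    have "S e * m = S e * (P (head G e) * P u) * m"
      using mu S_P[OF e] by (metis mult.assoc)
    also have "\<dots> = 0" using False u e by (simp add: P_mult_P)
    finally show ?thesis by (simp add: span_zero)
  qed
  show "adj (S e) * m \<in> span monomials" if e: "e \<in> arcs G"
  proof (cases \<alpha>)
    case Nil
    show ?thesis
    proof (cases "u = tail G e")
      case True
      have a: "a = tail G e" "awalk a [e] (head G e)" using w Nil True e by (auto simp: awalk_Nil_iff awalk_Cons_iff)
      have t: "awalk t (\<beta> @ [e]) (head G e)" using w(2) a(2) by (rule awalk_appendI)
      have "P u * S e = S e" using P_tail_S[OF e] True by simp
      then have "adj (S e) * P u = adj (S e)" by (metis adj_P adj_mult u)
      then have "adj (S e) * m = scaleC c (adj (S e) * adj (isom t \<beta>))"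
        by (simp add: m Nil isom_Nil scaleC_mult_right flip: mult.assoc)
      also have "adj (S e) * adj (isom t \<beta>) = adj (isom t (\<beta> @ [e]))"
        using isom_append[OF w(2) a(2)] e by (simp add: isom_Cons isom_Nil S_P adj_mult)
      also have "\<dots> = isom (head G e) [] * adj (isom t (\<beta> @ [e]))"
        using isom_P[OF t] e by (metis adj_P adj_mult head_in_verts isom_Nil)
      finally show ?thesis
        using monomialsI[of "head G e" "[]" "head G e" t "\<beta> @ [e]" c] t e
        by (simp add: awalk_Nil_iff span_base)
    next
      case False
      have "P u * S e = P u * P (tail G e) * S e" using P_tail_S[OF e] by (simp add: mult.assoc)
      then have "P u * S e = 0" using False u e by (simp add: P_mult_P)
      then have "adj (S e) * P u = 0" by (metis adj_0 adj_P adj_mult u)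
      then have "adj (S e) * m = 0" using mu by (metis mult.assoc mult_zero_left)
      then show ?thesis by (simp add: span_zero)
    qed
  next
    case (Cons f \<nu>)
    then have f: "f \<in> arcs G" "awalk (head G f) \<nu> a" using w by (auto simp: awalk_Cons_iff)
    have *: "adj (S e) * m = scaleC c (adj (S e) * S f * isom (head G f) \<nu> * adj (isom t \<beta>))"
      using f by (simp add: m Cons isom_Cons scaleC_mult_right mult.assoc)
    show ?thesis
    proof (cases "e = f")
      case True
      then have "adj (S e) * m = scaleC c (isom (head G f) \<nu> * adj (isom t \<beta>))"
        using * P_isom[OF f(2), of "head G f"] f by (simp add: adj_S_S)
      then show ?thesis using monomialsI[OF f(2) w(2)] by (simp add: span_base)
    next
      case False
      then have "adj (S e) * m = 0"
        using * e f by (simp add: adj_S_S_neq)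
      then show ?thesis by (simp add: span_zero)
    qed
  qed
qed

lemma scaleC_span_monomials: "x \<in> span monomials \<Longrightarrow> scaleC c x \<in> span monomials"
proof (induction rule: span_induct_alt)
  case base
  then show ?case by (simp add: span_zero)
next
  case (step r x y)
  obtain d v \<alpha> u \<beta> a where x: "awalk v \<alpha> a" "awalk u \<beta> a" "x = scaleC d (isom v \<alpha> * adj (isom u \<beta>))"
    using step(1) by (auto simp: monomials_def)
  have "scaleC c x \<in> monomials"
    unfolding x(3) scaleC_scaleC by (rule monomialsI[OF x(1,2)])
  moreover have "scaleC c (r *\<^sub>R x) = r *\<^sub>R scaleC c x"
    by (simp add: scaleC_scaleC mult.commute flip: scaleC_of_real)
  ultimately show ?case using step by (simp add: scaleC_add_right span_add span_scale span_base)
qed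

lemma closure_mapI:
  fixes f :: "'a \<Rightarrow> 'a"
  assumes "bounded_linear f" "\<And>m. m \<in> span monomials \<Longrightarrow> f m \<in> closure (span monomials)"
    "x \<in> closure (span monomials)"
  shows "f x \<in> closure (span monomials)"
  using image_closure_subset[of "span monomials" f "closure (span monomials)"] assms
    linear_continuous_on[OF assms(1)] by blast

text \<open>
The elements that map the closed span into itself by left multiplication, and whose adjoints do so
too, form a C*-subalgebra that contains the generators. So all elements do, and they may be
applied to the unit, which lies in the span as the sum of the vertex projections.
\<close>

lemma closure_span_monomials: "closure (span monomials) = UNIV"
proof -
  let ?V = "closure (span monomials)"
  define C where "C = {x. \<forall>y\<in>?V. x * y \<in> ?V \<and> adj x * y \<in> ?V}"
  have sub: "subspace ?V"
  proof (rule subspaceI)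
    show "0 \<in> ?V" using closure_subset span_zero by blast
    fix x y assume "x \<in> ?V" "y \<in> ?V"
    then obtain s t where "\<And>n. s n \<in> span monomials" "s \<longlonglongrightarrow> x" "\<And>n. t n \<in> span monomials" "t \<longlonglongrightarrow> y"
      unfolding closure_sequential by blast
    then show "x + y \<in> ?V" unfolding closure_sequential
      by (intro exI[of _ "\<lambda>n. s n + t n"]) (auto intro: span_add tendsto_add)
    show "r *\<^sub>R x \<in> ?V" for r
      by (rule closure_mapI[OF bounded_linear_scaleR_right _ \<open>x \<in> ?V\<close>])
         (use closure_subset span_scale in blast)
  qed
  have gen: "x \<in> C" if "\<And>m. m \<in> monomials \<Longrightarrow> x * m \<in> span monomials"
    "\<And>m. m \<in> monomials \<Longrightarrow> adj x * m \<in> span monomials" for x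
  proof -
    have "x * y \<in> ?V" if x: "\<And>m. m \<in> monomials \<Longrightarrow> x * m \<in> span monomials" and y: "y \<in> ?V" for x y
    proof (rule closure_mapI[OF bounded_linear_mult_right _ y])
      fix m assume "m \<in> span monomials"
      then have "x * m \<in> span monomials"
      proof (induction rule: span_induct_alt)
        case (step r m y)
        then show ?case using x by (simp add: distrib_left span_add span_scale)
      qed (simp add: span_zero)
      then show "x * m \<in> ?V" using closure_subset by blast
    qed
    then show ?thesis using that by (simp add: C_def)
  qed
  have "cstar_subalgebra C"
    unfolding cstar_subalgebra_def
  proof (intro conjI ballI allI)
    have "C = (\<Inter>y\<in>?V. ((\<lambda>x. x * y) -` ?V) \<inter> ((\<lambda>x. adj x * y) -` ?V))"
      by (auto simp: C_def)
    moreover have "closed ((\<lambda>x. x * y) -` ?V)" "closed ((\<lambda>x. adj x * y) -` ?V)" for y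
      using linear_continuous_on[OF bounded_linear_adj]
      by (auto intro!: closed_vimage continuous_intros)
    ultimately show "closed C" by auto
  next
    fix x y assume xy: "x \<in> C" "y \<in> C"
    then show "x + y \<in> C"
      using subspace_add[OF sub] by (simp add: C_def distrib_right adj_add)
    show "x * y \<in> C" using xy by (simp add: C_def adj_mult mult.assoc)
  next
    fix c x assume x: "x \<in> C"
    have "scaleC d z \<in> ?V" if "z \<in> ?V" for d z
      by (rule closure_mapI[OF bounded_linear_scaleC _ that])
         (use closure_subset scaleC_span_monomials in blast)
    then show "scaleC c x \<in> C" using x by (simp add: C_def adj_scaleC scaleC_mult_left)
  next
    fix x assume x: "x \<in> C"
    then show "adj x \<in> C" by (simp add: C_def adj_adj)
  next
    show "0 \<in> C" using subspace_0[OF sub] by (simp add: C_def)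
  qed
  moreover have "P ` verts G \<union> S ` arcs G \<subseteq> C"
    using gen generator_mult_monomial by (auto simp: adj_P)
  ultimately have C: "C = UNIV" using cstar_generated_minimal[of C] generated by blast
  have "(\<Sum>v\<in>verts G. P v) \<in> span monomials"
  proof (rule span_sum)
    show "P v \<in> span monomials" if "v \<in> verts G" for v
      using monomialsI'[of v "[]" v v "[]"] that by (simp add: awalk_Nil_iff isom_Nil adj_P P_P span_base)
  qed
  then have "1 \<in> ?V" using closure_subset by (auto simp: sum_P)
  then have "x * 1 \<in> ?V" for x using C unfolding C_def by blast
  then show ?thesis by auto
qed

text \<open>
The form in which density is used: a property of elements that is stable under linear combinations
need only be checked for monomials.
\<close>

lemma dense_if_contains_monomials:
  assumes "subspace V" "monomials \<subseteq> V"
  shows "closure V = UNIV"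
  using closure_mono[OF span_minimal[OF assms(2,1)]] closure_span_monomials by auto

end

section \<open>The gauge action and its Fourier coefficients\<close>

lemma sum_swap3:
  "(\<Sum>j\<in>J. \<Sum>k\<in>K. \<Sum>l\<in>L. f j k l) = (\<Sum>k\<in>K. \<Sum>l\<in>L. \<Sum>j\<in>J. f j k l)"
  by (rule trans[OF sum.swap], rule sum.cong[OF refl], rule sum.swap)

lemma sum_roots_of_unity:
  assumes N: "N > 0"
  shows "(\<Sum>j<N. cis (2 * pi * of_int k * real j / real N)) = (if int N dvd k then of_nat N else 0)"
proof -
  define z where "z = cis (2 * pi * of_int k / real N)"
  have pow: "cis (2 * pi * of_int k * real j / real N) = z ^ j" for j
    unfolding z_def Complex.DeMoivre by (rule arg_cong[of _ _ cis]) simp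
  show ?thesis
  proof (cases "int N dvd k")
    case True
    then obtain m where "k = int N * m" by blast
    then have "z = cis (2 * pi * of_int m)" using N unfolding z_def by (intro arg_cong[of _ _ cis]) simp
    moreover have "cis (2 * pi * of_int m) = 1" by (rule cis_multiple_2pi) simp
    ultimately have "z = 1" by simp
    then show ?thesis using True by (simp add: pow)
  next
    case False
    have zN: "z ^ N = 1" using pow[of N] N by (simp add: cis_multiple_2pi flip: pow)
    have "z \<noteq> 1"
    proof
      assume "z = 1"
      then obtain m :: int where "2 * pi * of_int k / real N = 2 * pi * of_int m"
        by (auto simp: z_def complex_eq_iff cos_one_2pi_int)
      then have "real_of_int k = real_of_int (int N * m)" using N by (simp add: field_simps)
      then show False using False by (metis dvd_triv_left of_int_eq_iff)
    qed
    then show ?thesis using False zN by (simp add: pow geometric_sum)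
  qed
qed

context graph_algebra
begin

lemma star_hom_fixes_diagonal:
  assumes \<phi>: "star_hom \<phi>" "\<phi> 1 = 1" and p: "\<And>p. p \<in> path_projections \<Longrightarrow> \<phi> p = p" and d: "d \<in> \<D>"
  shows "\<phi> d = d"
proof -
  have "\<D> \<subseteq> {x. \<phi> x = x}"
    unfolding diagonal_eq
    by (rule cstar_generated_minimal[OF cstar_subalgebra_equalizer[OF \<phi> star_hom_id refl]])
       (use p in auto)
  then show ?thesis using d by blast
qed

definition gauge_action :: "complex \<Rightarrow> 'a \<Rightarrow> 'a" where
  "gauge_action z = lambda_endo G P S (scaleC z 1)"

lemma gauge_action:
  assumes "cmod z = 1"
  shows "star_hom (gauge_action z)" "gauge_action z 1 = 1" "e \<in> arcs G \<Longrightarrow> gauge_action z (S e) = scaleC z (S e)"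
    "v \<in> verts G \<Longrightarrow> gauge_action z (P v) = P v"
proof -
  have "cnj z * z = 1" using assms complex_norm_square[of z] by (simp add: mult.commute)
  then have "unitary (scaleC z (1::'a))"
    by (simp add: unitary_def adj_scaleC scaleC_mult_left scaleC_mult_right scaleC_scaleC scaleC_1 mult.commute)
  note l = lambda_endo_exists[OF fin_digraph_axioms universal this, folded gauge_action_def]
  show "star_hom (gauge_action z)" "gauge_action z 1 = 1" "e \<in> arcs G \<Longrightarrow> gauge_action z (S e) = scaleC z (S e)"
    "v \<in> verts G \<Longrightarrow> gauge_action z (P v) = P v"
    using l by (simp_all add: scaleC_mult_left scaleC_mult_right)
qed

lemma gauge_isom:
  assumes z: "cmod z = 1"
  shows "awalk v \<mu> w \<Longrightarrow> gauge_action z (isom v \<mu>) = scaleC (z ^ length \<mu>) (isom v \<mu>)"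
proof (induction \<mu> arbitrary: v)
  case Nil
  then show ?case by (auto simp: isom_Nil awalk_Nil_iff gauge_action[OF z] scaleC_1)
next
  case (Cons e \<mu>)
  then show ?case
    by (simp add: awalk_Cons_iff isom_Cons star_homD[OF gauge_action(1)[OF z]] gauge_action[OF z]
        scaleC_mult_left scaleC_mult_right scaleC_scaleC mult.commute)
qed

lemma gauge_monomial:
  assumes "awalk v \<alpha> a" "awalk u \<beta> b"
  shows "gauge_action (cis t) (isom v \<alpha> * adj (isom u \<beta>))
    = scaleC (cis ((real (length \<alpha>) - real (length \<beta>)) * t)) (isom v \<alpha> * adj (isom u \<beta>))"
proof -
  have "cis t ^ length \<alpha> * cnj (cis t ^ length \<beta>) = cis ((real (length \<alpha>) - real (length \<beta>)) * t)"
    unfolding Complex.DeMoivre cis_cnj cis_mult left_diff_distrib by simp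
  then show ?thesis
    by (simp add: star_homD[OF gauge_action(1)] gauge_isom[OF _ assms(1)] gauge_isom[OF _ assms(2)] adj_scaleC
        scaleC_mult_left scaleC_mult_right scaleC_scaleC mult.commute)
qed

lemma gauge_diagonal: "cmod z = 1 \<Longrightarrow> d \<in> \<D> \<Longrightarrow> gauge_action z d = d"
proof (rule star_hom_fixes_diagonal[OF gauge_action(1,2)])
  fix p assume z: "cmod z = 1" and "p \<in> path_projections"
  then obtain v \<mu> w where p: "p = range_proj v \<mu>" "awalk v \<mu> w" by (auto simp: path_projections_def)
  obtain t where "z = cis t" using z by (metis cis_conv_exp complex_norm_eq_1_exp)
  then show "gauge_action z p = p" using gauge_monomial[OF p(2,2)] by (simp add: p scaleC_1)
qed auto

lemma gauge_commutant:
  assumes z: "cmod z = 1" and x: "x \<in> commutant \<D>"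
  shows "gauge_action z x \<in> commutant \<D>"
  unfolding commutant_def
proof clarify
  fix d assume d: "d \<in> \<D>"
  have "gauge_action z (d * x) = gauge_action z (x * d)" using commutant_commutes[OF x d] by simp
  then show "d * gauge_action z x = gauge_action z x * d"
    by (simp add: star_homD[OF gauge_action(1)[OF z]] gauge_diagonal[OF z d])
qed

text \<open>
The coefficient of degree \<open>n\<close> for the gauge action, with the integral over the circle replaced by
the average over the \<open>N\<close>-th roots of unity. It therefore collects all degrees congruent to \<open>n\<close>
modulo \<open>N\<close>, and is the true coefficient on any finite combination of monomials once \<open>N\<close> is large.
\<close>

definition fourier :: "nat \<Rightarrow> int \<Rightarrow> 'a \<Rightarrow> 'a" where
  "fourier N n x = (\<Sum>j<N. scaleC (cis (- (2 * pi * of_int n * real j / real N)) / of_nat N)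
     (gauge_action (cis (2 * pi * real j / real N)) x))"

lemma gauge_cis: "star_hom (gauge_action (cis t))" "gauge_action (cis t) 1 = 1"
  by (simp_all add: gauge_action)

lemma fourier_linear: "fourier N n (x + y) = fourier N n x + fourier N n y"
    "fourier N n (x - y) = fourier N n x - fourier N n y"
    "fourier N n (scaleC c x) = scaleC c (fourier N n x)" "fourier N n (r *\<^sub>R x) = r *\<^sub>R fourier N n x"
    "fourier N n 0 = 0"
  unfolding fourier_def
  by (simp_all add: star_homD[OF gauge_cis(1)] scaleC_add_right scaleC_diff_right sum.distrib sum_subtractf
      scaleC_sum_right scaleC_scaleC mult.commute scaleR_sum_right flip: scaleC_of_real)

lemma norm_fourier_le: "norm (fourier N n x) \<le> norm x"
proof -
  have "norm (fourier N n x) \<le> (\<Sum>j<N. norm x / N)"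
    unfolding fourier_def
  proof (rule sum_norm_le)
    show "norm (scaleC (cis (- (2 * pi * of_int n * real j / real N)) / of_nat N)
      (gauge_action (cis (2 * pi * real j / real N)) x)) \<le> norm x / N" for j
      using star_hom_contractive[OF gauge_cis, of "2 * pi * real j / real N" x]
      by (simp add: norm_scaleC norm_divide divide_right_mono)
  qed
  also have "\<dots> \<le> norm x" by simp
  finally show ?thesis .
qed

lemma cstar_subalgebra_commutant_diagonal: "cstar_subalgebra (commutant \<D>)"
  by (rule cstar_subalgebra_commutant) (use cstar_subalgebra_diagonal in \<open>auto simp: cstar_subalgebra_def\<close>)

lemma fourier_commutant: "x \<in> commutant \<D> \<Longrightarrow> fourier N n x \<in> commutant \<D>"
  unfolding fourier_def
  by (rule cstar_subalgebra_sum[OF cstar_subalgebra_commutant_diagonal])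
     (use cstar_subalgebra_commutant_diagonal gauge_commutant in \<open>auto simp: cstar_subalgebra_def\<close>)

lemma adj_fourier: "adj (fourier N n x) = fourier N (- n) (adj x)"
  unfolding fourier_def adj_sum
  by (intro sum.cong refl) (simp add: adj_scaleC cis_cnj star_homD[OF gauge_cis(1)])

lemma fourier_monomial:
  assumes w: "awalk v \<alpha> a" "awalk u \<beta> b" and N: "N > 0"
  shows "fourier N n (isom v \<alpha> * adj (isom u \<beta>))
    = (if int N dvd int (length \<alpha>) - int (length \<beta>) - n then isom v \<alpha> * adj (isom u \<beta>) else 0)"
proof -
  let ?m = "isom v \<alpha> * adj (isom u \<beta>)" and ?k = "int (length \<alpha>) - int (length \<beta>) - n"
  have "fourier N n ?m = (\<Sum>j<N. scaleC (cis (2 * pi * of_int ?k * real j / real N) / of_nat N) ?m)"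
    unfolding fourier_def
  proof (intro sum.cong refl)
    fix j
    have "cis (- (2 * pi * of_int n * real j / real N))
        * cis ((real (length \<alpha>) - real (length \<beta>)) * (2 * pi * real j / real N))
        = cis (2 * pi * of_int ?k * real j / real N)"
      unfolding cis_mult using N by (intro arg_cong[of _ _ cis]) (simp add: field_simps)
    then show "scaleC (cis (- (2 * pi * of_int n * real j / real N)) / of_nat N)
        (gauge_action (cis (2 * pi * real j / real N)) ?m)
      = scaleC (cis (2 * pi * of_int ?k * real j / real N) / of_nat N) ?m"
      by (simp add: gauge_monomial[OF w] scaleC_scaleC)
  qed
  also have "\<dots> = scaleC ((\<Sum>j<N. cis (2 * pi * of_int ?k * real j / real N)) / of_nat N) ?m"
    by (simp only: scaleC_sum_left sum_divide_distrib)
  also have "\<dots> = (if int N dvd ?k then ?m else 0)"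
    unfolding sum_roots_of_unity[OF N] using N scaleC_of_real[of 0 ?m] by (simp add: scaleC_1)
  finally show ?thesis .
qed

section \<open>Homogeneous elements commuting with the diagonal\<close>

text \<open>
What is retained of the combinations of monomials \<open>S\<^sub>\<alpha> S\<^sub>\<beta>\<^sup>*\<close> with \<open>\<alpha>\<close> longer than \<open>\<beta>\<close> by \<open>n\<close>: cut
down to a long path \<open>\<mu>\<close> on the left and to its prefix on the right, they become multiples of a
single monomial. Stated this way the property is linear in \<open>y\<close>, and it suffices to verify it for
one monomial.
\<close>

definition homogeneous :: "nat \<Rightarrow> 'a set" where
  "homogeneous n = {y. \<exists>L\<^sub>0. \<forall>L\<ge>L\<^sub>0. \<forall>v \<mu> w. awalk v \<mu> w \<and> length \<mu> = L + n \<longrightarrow>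
     (\<exists>c. range_proj v \<mu> * y * range_proj v (take L \<mu>) = scaleC c (isom v \<mu> * adj (isom v (take L \<mu>))))}"

lemma homogeneousE:
  assumes "y \<in> homogeneous n"
  obtains L\<^sub>0 where "\<And>L v \<mu> w. L \<ge> L\<^sub>0 \<Longrightarrow> awalk v \<mu> w \<Longrightarrow> length \<mu> = L + n \<Longrightarrow>
     \<exists>c. range_proj v \<mu> * y * range_proj v (take L \<mu>) = scaleC c (isom v \<mu> * adj (isom v (take L \<mu>)))"
  using assms unfolding homogeneous_def by blast

lemma homogeneous_scaleC: "y \<in> homogeneous n \<Longrightarrow> scaleC c y \<in> homogeneous n"
  unfolding homogeneous_def mem_Collect_eq scaleC_mult_right scaleC_mult_left
  by (metis scaleC_scaleC)

lemma subspace_homogeneous: "subspace (homogeneous n)"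
proof (rule subspaceI)
  show "0 \<in> homogeneous n"
    using scaleC_of_real[of 0] by (auto simp: homogeneous_def intro!: exI[of _ "0::complex"])
  fix x y assume "x \<in> homogeneous n" "y \<in> homogeneous n"
  then obtain K M where
    K: "\<And>L v \<mu> w. L \<ge> K \<Longrightarrow> awalk v \<mu> w \<Longrightarrow> length \<mu> = L + n \<Longrightarrow>
     \<exists>c. range_proj v \<mu> * x * range_proj v (take L \<mu>) = scaleC c (isom v \<mu> * adj (isom v (take L \<mu>)))"
    and M: "\<And>L v \<mu> w. L \<ge> M \<Longrightarrow> awalk v \<mu> w \<Longrightarrow> length \<mu> = L + n \<Longrightarrow>
     \<exists>c. range_proj v \<mu> * y * range_proj v (take L \<mu>) = scaleC c (isom v \<mu> * adj (isom v (take L \<mu>)))"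
    by (meson homogeneousE)
  show "x + y \<in> homogeneous n"
    unfolding homogeneous_def mem_Collect_eq
  proof (intro exI[of _ "max K M"] allI impI)
    fix L v \<mu> w assume L: "max K M \<le> L" and w: "awalk v \<mu> w \<and> length \<mu> = L + n"
    obtain c d where
      "range_proj v \<mu> * x * range_proj v (take L \<mu>) = scaleC c (isom v \<mu> * adj (isom v (take L \<mu>)))"
      "range_proj v \<mu> * y * range_proj v (take L \<mu>) = scaleC d (isom v \<mu> * adj (isom v (take L \<mu>)))"
      using K[of L v \<mu> w] M[of L v \<mu> w] w L by auto
    then show "\<exists>c. range_proj v \<mu> * (x + y) * range_proj v (take L \<mu>)
        = scaleC c (isom v \<mu> * adj (isom v (take L \<mu>)))"
      by (intro exI[of _ "c + d"]) (simp only: distrib_left distrib_right scaleC_add_left)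
  qed
  show "r *\<^sub>R x \<in> homogeneous n" for r
    using homogeneous_scaleC[OF \<open>x \<in> homogeneous n\<close>, of "complex_of_real r"] by (simp only: scaleC_of_real)
qed

text \<open>
If \<open>\<mu> = \<alpha>\<rho>\<close> and its prefix of length \<open>L\<close> is \<open>\<nu> = \<beta>\<sigma>\<close>, the compression is \<open>S\<^sub>\<mu> (S\<^sub>\<rho>\<^sup>* S\<^sub>\<sigma>) S\<^sub>\<nu>\<^sup>*\<close>. The
excess \<open>n\<close> of \<open>\<alpha>\<close> over \<open>\<beta>\<close> is what makes \<open>\<rho>\<close> and \<open>\<sigma>\<close> equally long, so that they are equal or have
orthogonal ranges.
\<close>

lemma monomial_homogeneous:
  assumes w: "awalk v \<alpha> a" "awalk u \<beta> a" and len: "length \<alpha> = length \<beta> + n"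
  shows "isom v \<alpha> * adj (isom u \<beta>) \<in> homogeneous n"
  unfolding homogeneous_def mem_Collect_eq
proof (intro exI[of _ "length \<beta>"] allI impI)
  fix L t \<mu> b assume L: "length \<beta> \<le> L" and \<mu>: "awalk t \<mu> b \<and> length \<mu> = L + n"
  define \<nu> where "\<nu> = take L \<mu>"
  have "\<mu> = \<nu> @ drop L \<mu>" by (simp add: \<nu>_def)
  then obtain d where \<nu>: "awalk t \<nu> d" using \<mu> by (metis awalk_append_iff)
  have len_\<nu>: "length \<nu> = L" using \<mu> by (simp add: \<nu>_def)
  have split: "range_proj t \<mu> * (isom v \<alpha> * adj (isom u \<beta>)) * range_proj t \<nu>
      = isom t \<mu> * (adj (adj (isom v \<alpha>) * isom t \<mu>) * (adj (isom u \<beta>) * isom t \<nu>)) * adj (isom t \<nu>)"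
    by (simp add: adj_mult adj_adj mult.assoc)
  have zero: "\<exists>c. 0 = scaleC c (isom t \<mu> * adj (isom t \<nu>))"
    using scaleC_of_real[of 0] by (intro exI[of _ 0]) simp
  have "\<exists>c. range_proj t \<mu> * (isom v \<alpha> * adj (isom u \<beta>)) * range_proj t \<nu>
      = scaleC c (isom t \<mu> * adj (isom t \<nu>))"
  proof (cases "t = v \<and> take (length \<alpha>) \<mu> = \<alpha> \<and> t = u \<and> take (length \<beta>) \<nu> = \<beta>")
    case True
    define \<rho> \<sigma> where "\<rho> = drop (length \<alpha>) \<mu>" and "\<sigma> = drop (length \<beta>) \<nu>"
    have "\<mu> = \<alpha> @ \<rho>" "\<nu> = \<beta> @ \<sigma>" using True by (metis \<rho>_def \<sigma>_def append_take_drop_id)+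
    then have \<rho>: "awalk a \<rho> b" and \<sigma>: "awalk a \<sigma> d"
      using \<mu> \<nu> w True by auto
    have l: "length \<rho> = length \<sigma>" using \<mu> len len_\<nu> by (simp add: \<rho>_def \<sigma>_def)
    have "adj (isom a \<rho>) * isom a \<sigma> = (if \<sigma> = \<rho> then P b else 0)"
      using adj_isom_mult_isom[OF \<rho> \<sigma> eq_imp_le[OF l]] unfolding l by (simp add: isom_Nil)
    moreover have "adj (isom v \<alpha>) * isom t \<mu> = isom a \<rho>" "adj (isom u \<beta>) * isom t \<nu> = isom a \<sigma>"
      using adj_isom_mult_isom[OF w(1), of t \<mu> b] adj_isom_mult_isom[OF w(2) \<nu>] \<mu> len len_\<nu> L True
      by (auto simp: \<rho>_def \<sigma>_def)
    ultimately have "range_proj t \<mu> * (isom v \<alpha> * adj (isom u \<beta>)) * range_proj t \<nu>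
        = (if \<sigma> = \<rho> then isom t \<mu> * adj (isom t \<nu>) else 0)"
      unfolding split using isom_P[of t \<mu> b] \<mu> by simp
    then show ?thesis using zero by (metis scaleC_1)
  next
    case False
    then have "adj (isom v \<alpha>) * isom t \<mu> = 0 \<or> adj (isom u \<beta>) * isom t \<nu> = 0"
      using adj_isom_mult_isom[OF w(1), of t \<mu> b] adj_isom_mult_isom[OF w(2) \<nu>] \<mu> len len_\<nu> L by auto
    then show ?thesis unfolding split using zero by auto
  qed
  then show "\<exists>c. range_proj t \<mu> * (isom v \<alpha> * adj (isom u \<beta>)) * range_proj t (take L \<mu>)
      = scaleC c (isom t \<mu> * adj (isom t (take L \<mu>)))"
    by (simp only: \<nu>_def)
qed

lemma fourier_homogeneous_dense:
  "closure {y. \<forall>n. \<exists>N\<^sub>0. \<forall>N\<ge>N\<^sub>0. fourier N (int n) y \<in> homogeneous n} = UNIV"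
  (is "closure ?V = _")
proof (rule dense_if_contains_monomials)
  show "subspace ?V"
  proof (rule subspaceI)
    fix x y assume xy: "x \<in> ?V" "y \<in> ?V"
    show "x + y \<in> ?V"
    proof (clarify)
      fix n
      obtain K M where "\<forall>N\<ge>K. fourier N (int n) x \<in> homogeneous n" "\<forall>N\<ge>M. fourier N (int n) y \<in> homogeneous n"
        using xy by blast
      then show "\<exists>N\<^sub>0. \<forall>N\<ge>N\<^sub>0. fourier N (int n) (x + y) \<in> homogeneous n"
        by (intro exI[of _ "max K M"]) (simp add: fourier_linear subspace_add[OF subspace_homogeneous])
    qed
    show "r *\<^sub>R x \<in> ?V" for r
    proof (clarify)
      fix n
      obtain K where "\<forall>N\<ge>K. fourier N (int n) x \<in> homogeneous n"
        using xy by blast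
      then show "\<exists>N\<^sub>0. \<forall>N\<ge>N\<^sub>0. fourier N (int n) (r *\<^sub>R x) \<in> homogeneous n"
        by (intro exI[of _ K]) (simp add: fourier_linear subspace_scale[OF subspace_homogeneous])
    qed
  qed (simp add: fourier_linear subspace_0[OF subspace_homogeneous])
  show "monomials \<subseteq> ?V"
  proof (clarify)
    fix m n assume "m \<in> monomials"
    then obtain c v \<alpha> u \<beta> a where w: "awalk v \<alpha> a" "awalk u \<beta> a"
      and m: "m = scaleC c (isom v \<alpha> * adj (isom u \<beta>))" by (auto simp: monomials_def)
    define k where "k = int (length \<alpha>) - int (length \<beta>) - int n"
    show "\<exists>N\<^sub>0. \<forall>N\<ge>N\<^sub>0. fourier N (int n) m \<in> homogeneous n"
    proof (intro exI[of _ "nat \<bar>k\<bar> + 1"] allI impI)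
      fix N assume N: "nat \<bar>k\<bar> + 1 \<le> N"
      show "fourier N (int n) m \<in> homogeneous n"
      proof (cases "k = 0")
        case True
        then have "length \<alpha> = length \<beta> + n" by (simp add: k_def)
        then show ?thesis
          using fourier_monomial[OF w, of N "int n"] N True homogeneous_scaleC[OF monomial_homogeneous[OF w]]
          by (simp add: m fourier_linear k_def)
      next
        case False
        then have "\<not> int N dvd k" using N zdvd_imp_le[of "int N" "\<bar>k\<bar>"] by auto
        then show ?thesis
          using fourier_monomial[OF w, of N "int n"] N
          by (simp add: m fourier_linear k_def[symmetric] subspace_0[OF subspace_homogeneous])
      qed
    qed
  qed
qed

lemma norm_le_of_path_blocks:
  assumes x: "x \<in> commutant \<D>" and K: "K \<ge> 0"
    and blk: "\<And>v \<mu> w. awalk v \<mu> w \<Longrightarrow> length \<mu> = k \<Longrightarrow> norm (range_proj v \<mu> * x) \<le> K"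
  shows "norm x \<le> K"
proof (rule norm_le_of_blocks[OF finite_paths[of k], of "\<lambda>(v, \<mu>). range_proj v \<mu>"])
  fix i assume "i \<in> paths k"
  then obtain v \<mu> w where i: "i = (v, \<mu>)" "awalk v \<mu> w" "length \<mu> = k" by (rule pathsE)
  show "adj (case i of (v, \<mu>) \<Rightarrow> range_proj v \<mu>) = (case i of (v, \<mu>) \<Rightarrow> range_proj v \<mu>)"
    by (simp add: i(1) adj_mult adj_adj)
  show "(case i of (v, \<mu>) \<Rightarrow> range_proj v \<mu>) * (case i of (v, \<mu>) \<Rightarrow> range_proj v \<mu>)
      = (case i of (v, \<mu>) \<Rightarrow> range_proj v \<mu>)"
    using range_proj_idem[OF i(2)] by (simp add: i(1))
  show "(case i of (v, \<mu>) \<Rightarrow> range_proj v \<mu>) * x = x * (case i of (v, \<mu>) \<Rightarrow> range_proj v \<mu>)"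
    using commutant_commutes[OF x range_proj_diagonal[OF i(2)]] by (simp add: i(1))
  show "norm ((case i of (v, \<mu>) \<Rightarrow> range_proj v \<mu>) * x) \<le> K"
    using blk[OF i(2,3)] by (simp add: i(1))
qed (use sum_paths K in auto)

lemma commutant_range_proj:
  assumes "x \<in> commutant \<D>" "awalk v \<mu> w"
  shows "range_proj v \<mu> * x = range_proj v \<mu> * x * range_proj v \<mu>"
proof -
  define p where "p = range_proj v \<mu>"
  have "p * p = p" "p * x = x * p"
    using range_proj_idem[OF assms(2)] commutant_commutes[OF assms(1) range_proj_diagonal[OF assms(2)]]
    by (simp_all add: p_def)
  then have "p * x = p * x * p" by (metis mult.assoc)
  then show ?thesis by (simp only: p_def)
qed

text \<open>
The block diagonal part of \<open>y\<close> over the paths of a fixed large length is a combination of range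
projections. On each block it differs from \<open>x\<close> by a compression of \<open>x - y\<close>.
\<close>

lemma homogeneous_zero_near_diagonal:
  assumes x: "x \<in> commutant \<D>" and y: "y \<in> homogeneous 0" and near: "norm (x - y) \<le> \<delta>"
  shows "\<exists>d\<in>\<D>. norm (x - d) \<le> \<delta>"
proof -
  obtain L where L: "\<And>v \<mu> w. awalk v \<mu> w \<Longrightarrow> length \<mu> = L + 0 \<Longrightarrow>
     \<exists>c. range_proj v \<mu> * y * range_proj v (take L \<mu>) = scaleC c (isom v \<mu> * adj (isom v (take L \<mu>)))"
    by (rule homogeneousE[OF y]) (blast intro: order_refl)
  define d where "d = (\<Sum>(v, \<mu>)\<in>paths L. range_proj v \<mu> * y * range_proj v \<mu>)"
  have d: "d \<in> \<D>"
    unfolding d_def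
  proof (rule cstar_subalgebra_sum[OF cstar_subalgebra_diagonal])
    fix i assume "i \<in> paths L"
    then obtain v \<mu> w where i: "i = (v, \<mu>)" "awalk v \<mu> w" "length \<mu> = L" by (rule pathsE)
    then obtain c where "range_proj v \<mu> * y * range_proj v \<mu> = scaleC c (range_proj v \<mu>)"
      using L[OF i(2)] i(3) by auto
    then show "(case i of (v, \<mu>) \<Rightarrow> range_proj v \<mu> * y * range_proj v \<mu>) \<in> \<D>"
      using range_proj_diagonal[OF i(2)] cstar_subalgebra_diagonal by (simp add: i(1) cstar_subalgebra_def)
  qed
  have "norm (x - d) \<le> \<delta>"
  proof (rule norm_le_of_path_blocks[where k=L])
    have "d \<in> commutant \<D>" using d diagonal_commutative by blast
    then show "x - d \<in> commutant \<D>" using x by (simp add: commutant_def left_diff_distrib right_diff_distrib)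
    show "\<delta> \<ge> 0" using near norm_ge_zero order_trans by blast
    fix v \<mu> w assume \<mu>: "awalk v \<mu> w" "length \<mu> = L"
    have v: "(v, \<mu>) \<in> paths L" using \<mu> awalk_hd_in_verts[OF \<mu>(1)] by (auto simp: paths_def paths_from_def)
    have "range_proj v \<mu> * d = (\<Sum>i\<in>paths L. if i = (v, \<mu>) then range_proj v \<mu> * y * range_proj v \<mu> else 0)"
      unfolding d_def sum_distrib_left
    proof (rule sum.cong[OF refl])
      fix i assume "i \<in> paths L"
      then obtain u \<nu> b where i: "i = (u, \<nu>)" "awalk u \<nu> b" "length \<nu> = L" by (rule pathsE)
      have "range_proj v \<mu> * (range_proj u \<nu> * y * range_proj u \<nu>)
          = (range_proj v \<mu> * range_proj u \<nu>) * y * range_proj u \<nu>"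
        by (simp only: mult.assoc)
      also have "range_proj v \<mu> * range_proj u \<nu> = (if i = (v, \<mu>) then range_proj v \<mu> else 0)"
        using range_proj_mult[OF \<mu>(1) i(2)] \<mu>(2) i by auto
      finally show "range_proj v \<mu> * (case i of (v, \<mu>) \<Rightarrow> range_proj v \<mu> * y * range_proj v \<mu>)
          = (if i = (v, \<mu>) then range_proj v \<mu> * y * range_proj v \<mu> else 0)"
        unfolding i(1) prod.case by (cases "u = v \<and> \<nu> = \<mu>") auto
    qed
    then have "range_proj v \<mu> * d = range_proj v \<mu> * y * range_proj v \<mu>"
      using v finite_paths by simp
    then have "range_proj v \<mu> * (x - d) = range_proj v \<mu> * (x - y) * range_proj v \<mu>"
      using commutant_range_proj[OF x \<mu>(1)] by (simp only: right_diff_distrib left_diff_distrib)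
    then show "norm (range_proj v \<mu> * (x - d)) \<le> \<delta>"
      using norm_compress_le[OF norm_range_proj_le[OF \<mu>(1)] norm_range_proj_le[OF \<mu>(1)]] near
      by (metis order_trans)
  qed
  then show ?thesis using d by blast
qed

text \<open>
Leaving \<open>\<tau>\<close> at the exit \<open>f\<close> gives a path \<open>\<mu>\<close> whose range lies under \<open>P b\<close> and is orthogonal to the
range of \<open>\<tau>\<close>; it is nonzero since vertex projections do not vanish.
\<close>

lemma loop_projection_neq:
  assumes exit: "\<exists>e\<in>set \<tau>. \<exists>f\<in>out_arcs G (tail G e). f \<noteq> e" and \<tau>: "awalk b \<tau> w"
  shows "P b \<noteq> range_proj b \<tau>"
proof
  assume eq: "P b = range_proj b \<tau>"
  obtain e f where ef: "e \<in> set \<tau>" "f \<in> arcs G" "tail G f = tail G e" "f \<noteq> e" using exit by auto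
  obtain \<alpha> \<beta> where \<tau>': "\<tau> = \<alpha> @ e # \<beta>" using split_list[OF ef(1)] by blast
  define \<mu> where "\<mu> = \<alpha> @ [f]"
  have \<mu>: "awalk b \<mu> (head G f)"
    using \<tau> ef by (auto simp: \<tau>' \<mu>_def awalk_Cons_iff awalk_Nil_iff)
  have "adj (isom b \<mu>) * isom b \<tau> = 0"
    using adj_isom_mult_isom[OF \<mu> \<tau>] ef by (simp add: \<mu>_def \<tau>')
  then have "adj (isom b \<mu>) * P b = 0" unfolding eq by (simp flip: mult.assoc)
  moreover have "P b * isom b \<mu> = isom b \<mu>" using P_isom[OF \<mu>] awalk_hd_in_verts[OF \<mu>] by simp
  ultimately have "adj (isom b \<mu>) * isom b \<mu> = 0" by (metis mult.assoc mult_zero_left)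
  then show False using adj_isom_isom[OF \<mu>] P_nonzero[of "head G f"] ef by simp
qed

end

locale graph_algebra_exits = graph_algebra +
  assumes loops_have_exits: "\<And>v \<mu>. awalk v \<mu> v \<Longrightarrow> \<mu> \<noteq> [] \<Longrightarrow>
      \<exists>e\<in>set \<mu>. \<exists>f\<in>out_arcs G (tail G e). \<exists>g\<in>out_arcs G (tail G e). f \<noteq> g"
begin

text \<open>
The projection \<open>p = P\<^sub>\<nu> - P\<^sub>\<mu>\<close> separates \<open>x\<close> from the monomial: \<open>P\<^sub>\<mu> x p = 0\<close> as \<open>x\<close> commutes with
\<open>P\<^sub>\<mu>\<close>, while \<open>P\<^sub>\<mu> y p = c S\<^sub>\<mu> S\<^sub>\<nu>\<^sup>* p\<close>, which the partial isometries carry to \<open>c\<close> times the projection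
\<open>q = P b - P\<^sub>\<tau>\<close>. The exit of \<open>\<tau>\<close> makes \<open>q\<close> nonzero, hence of norm 1.
\<close>

lemma homogeneous_coefficient_le:
  assumes x: "x \<in> commutant \<D>" and near: "norm (x - y) \<le> \<delta>"
    and \<nu>: "awalk v \<nu> b" and \<tau>: "awalk b \<tau> b" "\<tau> \<noteq> []"
    and c: "range_proj v (\<nu> @ \<tau>) * y * range_proj v \<nu> = scaleC c (isom v (\<nu> @ \<tau>) * adj (isom v \<nu>))"
  shows "cmod c \<le> \<delta>"
proof -
  define \<mu> where "\<mu> = \<nu> @ \<tau>"
  have \<mu>: "awalk v \<mu> b" unfolding \<mu>_def using \<nu> \<tau>(1) by (rule awalk_appendI)
  have b: "b \<in> verts G" by (rule awalk_last_in_verts[OF \<nu>])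
  have \<nu>\<mu>: "range_proj v \<nu> * range_proj v \<mu> = range_proj v \<mu>"
    using range_proj_mult[OF \<nu> \<mu>] by (simp add: \<mu>_def)
  have \<mu>\<nu>: "range_proj v \<mu> * range_proj v \<nu> = range_proj v \<mu>"
    using range_proj_commute[OF \<mu> \<nu>] \<nu>\<mu> by simp
  note idem = range_proj_idem[OF \<mu>] range_proj_idem[OF \<nu>]
  define p where "p = range_proj v \<nu> - range_proj v \<mu>"
  define q where "q = P b - range_proj b \<tau>"
  have "adj p * p = p"
    unfolding p_def adj_diff adj_range_proj by (simp only: left_diff_distrib right_diff_distrib idem \<nu>\<mu> \<mu>\<nu>) simp
  then have p: "norm p \<le> 1" by (rule norm_projection_le)
  have "P b * range_proj b \<tau> = range_proj b \<tau>" using P_isom[OF \<tau>(1) b] by (simp flip: mult.assoc)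
  moreover from this have "range_proj b \<tau> * P b = range_proj b \<tau>"
    by (metis adj_P adj_mult adj_range_proj b)
  ultimately have "adj q * q = q"
    unfolding q_def adj_diff adj_range_proj adj_P[OF b]
    by (simp only: left_diff_distrib right_diff_distrib range_proj_idem[OF \<tau>(1)] P_P[OF b]) simp
  moreover have "q \<noteq> 0"
  proof -
    have "\<exists>e\<in>set \<tau>. \<exists>f\<in>out_arcs G (tail G e). f \<noteq> e" using loops_have_exits[OF \<tau>] by metis
    from loop_projection_neq[OF this \<tau>(1)] show ?thesis by (simp add: q_def)
  qed
  ultimately have q: "norm q = 1" by (rule norm_projection_eq)
  have "range_proj v \<mu> * x * p = x * (range_proj v \<mu> * p)"
    using commutant_commutes[OF x range_proj_diagonal[OF \<mu>]] by (simp only: mult.assoc)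
  also have "range_proj v \<mu> * p = 0" by (simp add: p_def right_diff_distrib idem \<mu>\<nu>)
  finally have xp: "range_proj v \<mu> * x * p = 0" by simp
  have "range_proj v \<nu> * p = p" by (simp only: p_def right_diff_distrib idem \<nu>\<mu>)
  then have "range_proj v \<mu> * y * p = range_proj v \<mu> * y * range_proj v \<nu> * p" by (simp only: mult.assoc)
  then have yp: "range_proj v \<mu> * y * p = scaleC c (isom v \<mu> * adj (isom v \<nu>) * p)"
    using c by (simp only: scaleC_mult_left \<mu>_def)
  have "adj (isom v \<nu>) * isom v \<mu> = isom b \<tau>"
    using adj_isom_mult_isom[OF \<nu> \<mu>] by (simp add: \<mu>_def)
  then have adj': "adj (isom v \<mu>) * isom v \<nu> = adj (isom b \<tau>)" by (metis adj_adj adj_mult)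
  have "adj (isom v \<nu>) * p * isom v \<nu> = q"
  proof -
    have "adj (isom v \<nu>) * p * isom v \<nu> = (adj (isom v \<nu>) * isom v \<nu>) * (adj (isom v \<nu>) * isom v \<nu>)
        - (adj (isom v \<nu>) * isom v \<mu>) * (adj (isom v \<mu>) * isom v \<nu>)"
      by (simp only: p_def right_diff_distrib left_diff_distrib mult.assoc)
    then show ?thesis
      by (simp only: adj_isom_isom[OF \<nu>] P_P[OF b] adj' \<open>adj (isom v \<nu>) * isom v \<mu> = isom b \<tau>\<close> q_def)
  qed
  moreover have "P b * q = q"
    using \<open>P b * range_proj b \<tau> = range_proj b \<tau>\<close> by (simp add: q_def right_diff_distrib P_P[OF b])
  ultimately have "adj (isom v \<mu>) * (isom v \<mu> * adj (isom v \<nu>) * p) * isom v \<nu> = q"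
    using adj_isom_isom[OF \<mu>] by (metis mult.assoc)
  then have "scaleC c q = adj (isom v \<mu>) * (range_proj v \<mu> * (y - x) * p) * isom v \<nu>"
    by (simp add: right_diff_distrib left_diff_distrib xp yp scaleC_mult_left scaleC_mult_right)
  then have "cmod c = norm (adj (isom v \<mu>) * (range_proj v \<mu> * (y - x) * p) * isom v \<nu>)"
    using q by (metis mult.right_neutral norm_scaleC)
  also have "\<dots> \<le> norm (range_proj v \<mu> * (y - x) * p)"
    by (rule norm_compress_le) (simp_all add: norm_adj norm_isom_le[OF \<mu>] norm_isom_le[OF \<nu>])
  also have "\<dots> \<le> norm (y - x)" by (rule norm_compress_le[OF norm_range_proj_le[OF \<mu>] p])
  finally show ?thesis using near by (simp add: norm_minus_commute)
qed

text \<open>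
A block \<open>P\<^sub>\<mu> y P\<^sub>\<mu>\<close> is a multiple of one monomial. Either the end of \<open>\<mu>\<close> is not the end of its
prefix \<open>\<nu>\<close>, and the monomial is zero, or the rest of \<open>\<mu>\<close> is a loop and the coefficient is small.
So each block of \<open>x\<close> is bounded by \<open>2 * \<delta>\<close>, once for \<open>x - y\<close> and once for \<open>y\<close>.
\<close>

lemma homogeneous_positive_near_zero:
  assumes x: "x \<in> commutant \<D>" and y: "y \<in> homogeneous n" and n: "n > 0" and near: "norm (x - y) \<le> \<delta>"
  shows "norm x \<le> 2 * \<delta>"
proof -
  have \<delta>: "\<delta> \<ge> 0" using near norm_ge_zero order_trans by blast
  obtain L where L: "\<And>v \<mu> w. awalk v \<mu> w \<Longrightarrow> length \<mu> = L + n \<Longrightarrow>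
     \<exists>c. range_proj v \<mu> * y * range_proj v (take L \<mu>) = scaleC c (isom v \<mu> * adj (isom v (take L \<mu>)))"
    by (rule homogeneousE[OF y]) (blast intro: order_refl)
  show ?thesis
  proof (rule norm_le_of_path_blocks[OF x, where k="L + n"])
    fix v \<mu> w assume \<mu>: "awalk v \<mu> w" "length \<mu> = L + n"
    define \<nu> \<tau> where "\<nu> = take L \<mu>" and "\<tau> = drop L \<mu>"
    have \<mu>_eq: "\<mu> = \<nu> @ \<tau>" by (simp add: \<nu>_def \<tau>_def)
    then obtain b where \<nu>: "awalk v \<nu> b" and \<tau>: "awalk b \<tau> w" using \<mu>(1) by auto
    have "\<tau> \<noteq> []" using \<mu>(2) n by (simp add: \<tau>_def)
    obtain c where c: "range_proj v \<mu> * y * range_proj v \<nu> = scaleC c (isom v \<mu> * adj (isom v \<nu>))"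
      using L[OF \<mu>] unfolding \<nu>_def by blast
    have "range_proj v \<nu> * range_proj v \<mu> = range_proj v \<mu>"
      using range_proj_mult[OF \<nu> \<mu>(1)] by (simp add: \<mu>_eq)
    then have "range_proj v \<mu> * y * range_proj v \<mu> = range_proj v \<mu> * y * range_proj v \<nu> * range_proj v \<mu>"
      by (simp only: mult.assoc)
    then have y_eq: "range_proj v \<mu> * y * range_proj v \<mu> = scaleC c (isom v \<mu> * adj (isom v \<nu>) * range_proj v \<mu>)"
      by (simp only: c scaleC_mult_left)
    have "norm (range_proj v \<mu> * y * range_proj v \<mu>) \<le> \<delta>"
    proof (cases "w = b")
      case True
      have "cmod c \<le> \<delta>"
        by (rule homogeneous_coefficient_le[OF x near \<nu> _ \<open>\<tau> \<noteq> []\<close>]) (use \<tau> c True \<mu>_eq in auto)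
      moreover have "norm (isom v \<mu> * adj (isom v \<nu>) * range_proj v \<mu>) \<le> norm (adj (isom v \<nu>))"
        by (rule norm_compress_le[OF norm_isom_le[OF \<mu>(1)] norm_range_proj_le[OF \<mu>(1)]])
      then have "norm (isom v \<mu> * adj (isom v \<nu>) * range_proj v \<mu>) \<le> 1"
        using norm_isom_le[OF \<nu>] by (simp add: norm_adj)
      ultimately show ?thesis
        unfolding y_eq norm_scaleC using mult_mono[of "cmod c" \<delta> _ 1] \<delta> by fastforce
    next
      case False
      have "isom v \<mu> * adj (isom v \<nu>) = isom v \<mu> * (P w * P b) * adj (isom v \<nu>)"
        using isom_P[OF \<mu>(1)] isom_P[OF \<nu>] adj_mult[of "isom v \<nu>" "P b"] adj_P awalk_last_in_verts[OF \<nu>]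
        by (metis mult.assoc)
      also have "\<dots> = 0"
        using False P_mult_P awalk_last_in_verts[OF \<nu>] awalk_last_in_verts[OF \<mu>(1)] by simp
      finally show ?thesis using \<delta> by (simp add: y_eq)
    qed
    moreover have "norm (range_proj v \<mu> * (x - y) * range_proj v \<mu>) \<le> \<delta>"
      using norm_compress_le[OF norm_range_proj_le[OF \<mu>(1)] norm_range_proj_le[OF \<mu>(1)]] near order_trans by blast
    moreover have "range_proj v \<mu> * x = range_proj v \<mu> * (x - y) * range_proj v \<mu> + range_proj v \<mu> * y * range_proj v \<mu>"
      using commutant_range_proj[OF x \<mu>(1)] by (simp add: left_diff_distrib right_diff_distrib)
    then have "norm (range_proj v \<mu> * x)
        \<le> norm (range_proj v \<mu> * (x - y) * range_proj v \<mu>) + norm (range_proj v \<mu> * y * range_proj v \<mu>)"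
      by (simp only: norm_triangle_ineq)
    ultimately show "norm (range_proj v \<mu> * x) \<le> 2 * \<delta>" by linarith
  qed (use \<delta> in simp)
qed

end

section \<open>Cesaro means\<close>

context graph_algebra
begin

text \<open>
The Fejer mean \<open>(\<Sum>\<bar>n\<bar><R. (1 - \<bar>n\<bar> / R) * x\<^sub>n)\<close> of the Fourier coefficients, written as a double sum
over \<open>n = l - k\<close>. In this form it is visibly the average of the gauge orbit against the squared
modulus of a Dirichlet kernel.
\<close>

definition cesaro :: "nat \<Rightarrow> nat \<Rightarrow> 'a \<Rightarrow> 'a" where
  "cesaro R N x = (1 / real R) *\<^sub>R (\<Sum>k<R. \<Sum>l<R. fourier N (int l - int k) x)"

lemma cesaro_linear: "cesaro R N (x + y) = cesaro R N x + cesaro R N y"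
  "cesaro R N (x - y) = cesaro R N x - cesaro R N y" "cesaro R N (r *\<^sub>R x) = r *\<^sub>R cesaro R N x"
  "cesaro R N 0 = 0"
  unfolding cesaro_def
  by (simp_all add: fourier_linear sum.distrib sum_subtractf scaleR_add_right scaleR_diff_right
      scaleR_sum_right mult.commute)

text \<open>
The Fejer kernel \<open>w\<close> is nonnegative and, on the \<open>N\<close>-th roots of unity with \<open>N \<ge> R\<close>, has total mass
1. So the mean is a convex combination of the elements \<open>gauge_action z x\<close>, none of norm larger
than that of \<open>x\<close>.
\<close>

lemma norm_cesaro_le:
  assumes R: "R > 0" "R \<le> N"
  shows "norm (cesaro R N x) \<le> norm x"
proof -
  have N: "N > 0" using R by simp
  define c where "c = (\<lambda>j. \<Sum>k<R. cis (2 * pi * real k * real j / real N))"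
  define w where "w = (\<lambda>j. (cmod (c j))\<^sup>2 / (real N * real R))"
  have w: "complex_of_real (w j) =
      (\<Sum>k<R. \<Sum>l<R. cis (2 * pi * of_int (int k - int l) * real j / real N) / (of_nat N * of_nat R))" for j
  proof -
    have "complex_of_real ((cmod (c j))\<^sup>2) = c j * cnj (c j)" by (rule complex_norm_square)
    also have "\<dots> = (\<Sum>k<R. \<Sum>l<R.
        cis (2 * pi * real k * real j / real N) * cis (- (2 * pi * real l * real j / real N)))"
      by (simp add: c_def cis_cnj sum_product)
    also have "\<dots> = (\<Sum>k<R. \<Sum>l<R. cis (2 * pi * of_int (int k - int l) * real j / real N))"
      unfolding cis_mult using N
      by (intro sum.cong refl arg_cong[of _ _ cis]) (simp add: field_simps)
    finally show ?thesis by (simp add: w_def sum_divide_distrib)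
  qed
  have "complex_of_real (\<Sum>j<N. w j) = (\<Sum>k<R. \<Sum>l<R.
      (\<Sum>j<N. cis (2 * pi * of_int (int k - int l) * real j / real N)) / (of_nat N * of_nat R))"
    unfolding of_real_sum w sum_divide_distrib by (rule sum_swap3)
  also have "\<dots> = (\<Sum>k<R. \<Sum>l<R. if l = k then 1 / of_nat R else 0)"
  proof (intro sum.cong refl)
    fix k l assume "k \<in> {..<R}" "l \<in> {..<R}"
    then have "\<bar>int k - int l\<bar> < int N" using R by auto
    then have "int N dvd int k - int l \<longleftrightarrow> l = k"
      using zdvd_imp_le[of "int N" "\<bar>int k - int l\<bar>"] by fastforce
    then show "(\<Sum>j<N. cis (2 * pi * of_int (int k - int l) * real j / real N)) / (of_nat N * of_nat R)
        = (if l = k then 1 / of_nat R else 0)"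
      unfolding sum_roots_of_unity[OF N] using N by simp
  qed
  also have "\<dots> = 1" using R by simp
  finally have sum_w: "(\<Sum>j<N. w j) = 1" using of_real_eq_1_iff by blast
  have "cesaro R N x = (\<Sum>k<R. \<Sum>l<R. \<Sum>j<N. scaleC
      (cis (2 * pi * of_int (int k - int l) * real j / real N) / (of_nat N * of_nat R))
      (gauge_action (cis (2 * pi * real j / real N)) x))"
    unfolding cesaro_def scaleR_sum_right fourier_def scaleC_of_real[symmetric] scaleC_sum_right scaleC_scaleC
  proof (intro sum.cong refl arg_cong2[of _ _ _ _ scaleC])
    fix k l j
    have "cis (- (2 * pi * real_of_int (int l - int k) * real j / real N))
        = cis (2 * pi * real_of_int (int k - int l) * real j / real N)"
      using N by (intro arg_cong[of _ _ cis]) (simp add: field_simps)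
    then show "complex_of_real (1 / real R) * (cis (- (2 * pi * real_of_int (int l - int k) * real j / real N)) / of_nat N)
        = cis (2 * pi * real_of_int (int k - int l) * real j / real N) / (of_nat N * of_nat R)"
      by simp
  qed
  also have "\<dots> = (\<Sum>j<N. w j *\<^sub>R gauge_action (cis (2 * pi * real j / real N)) x)"
    unfolding scaleC_of_real[symmetric] w scaleC_sum_left by (rule sum_swap3[symmetric])
  also have "norm \<dots> \<le> (\<Sum>j<N. w j * norm x)"
  proof (rule sum_norm_le)
    show "norm (w j *\<^sub>R gauge_action (cis (2 * pi * real j / real N)) x) \<le> w j * norm x" for j
      using star_hom_contractive[OF gauge_cis, of "2 * pi * real j / real N" x]
      by (simp add: w_def divide_right_mono mult_left_mono)
  qed
  also have "\<dots> = norm x" by (simp add: sum_w flip: sum_distrib_right)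
  finally show ?thesis .
qed

text \<open>
A monomial of degree \<open>d\<close> survives in the terms with \<open>l - k = d\<close>, of which there are at most \<open>R\<close>
and at least \<open>R - \<bar>d\<bar>\<close>, so its mean is a multiple of itself by a factor between \<open>1 - \<bar>d\<bar> / R\<close> and
1. The bound on \<open>N\<close> excludes further terms where this holds only modulo \<open>N\<close>.
\<close>

lemma cesaro_monomial:
  assumes w: "awalk v \<alpha> a" "awalk u \<beta> b" and R: "R > 0"
    and N: "nat \<bar>int (length \<alpha>) - int (length \<beta>)\<bar> + R < N"
  shows "norm (cesaro R N (isom v \<alpha> * adj (isom u \<beta>)) - isom v \<alpha> * adj (isom u \<beta>))
    \<le> \<bar>int (length \<alpha>) - int (length \<beta>)\<bar> / R"
proof -
  define d where "d = int (length \<alpha>) - int (length \<beta>)"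
  define m where "m = isom v \<alpha> * adj (isom u \<beta>)"
  \<comment> \<open>The rows of the double sum that contain the degree \<open>d\<close>.\<close>
  define K where "K = {k\<in>{..<R}. 0 \<le> int k + d \<and> int k + d < int R}"
  have "(\<Sum>l<R. fourier N (int l - int k) m) = (if k \<in> K then m else 0)" if k: "k < R" for k
  proof -
    have "fourier N (int l - int k) m = (if int l = int k + d then m else 0)" if l: "l < R" for l
    proof -
      have "int N dvd d - (int l - int k) \<longleftrightarrow> int l = int k + d"
      proof
        assume "int N dvd d - (int l - int k)"
        moreover have "\<bar>d - (int l - int k)\<bar> < int N" using k l N unfolding d_def by arith
        ultimately show "int l = int k + d"
          using zdvd_imp_le[of "int N" "\<bar>d - (int l - int k)\<bar>"] by fastforce
      qed simp
      then show ?thesis using fourier_monomial[OF w, of N "int l - int k"] N by (simp add: d_def m_def)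
    qed
    then have "(\<Sum>l<R. fourier N (int l - int k) m) = (\<Sum>l<R. if int l = int k + d then m else 0)"
      by simp
    also have "\<dots> = (if k \<in> K then m else 0)"
    proof (cases "k \<in> K")
      case True
      then have "int l = int k + d \<longleftrightarrow> l = nat (int k + d)" for l by (auto simp: K_def)
      then show ?thesis using True by (auto simp: K_def)
    next
      case False
      then show ?thesis using k by (auto simp: K_def intro!: sum.neutral)
    qed
    finally show ?thesis .
  qed
  then have "cesaro R N m = (1 / real R) *\<^sub>R (\<Sum>k<R. if k \<in> K then m else 0)" by (simp add: cesaro_def)
  also have "(\<Sum>k<R. if k \<in> K then m else 0) = real (card K) *\<^sub>R m"
    by (simp add: K_def sum.If_cases Int_def sum_constant_scaleR)
  finally have "cesaro R N m - m = - ((real (R - card K) / real R) *\<^sub>R m)"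
  proof -
    have "card K \<le> card {..<R}" by (rule card_mono) (auto simp: K_def)
    then have "card K \<le> R" by simp
    then have "real (R - card K) / real R = 1 - real (card K) / real R"
      using R by (simp add: of_nat_diff diff_divide_distrib)
    moreover assume "cesaro R N m = (1 / real R) *\<^sub>R (real (card K) *\<^sub>R m)"
    ultimately show ?thesis by (simp add: scaleR_left_diff_distrib)
  qed
  moreover have "real (R - card K) \<le> \<bar>d\<bar>"
  proof -
    have "R - card K = card ({..<R} - K)" by (subst card_Diff_subset) (auto simp: K_def)
    also have "\<dots> \<le> card (if d \<ge> 0 then {R - nat d..<R} else {..<nat (- d)})"
      by (rule card_mono) (auto simp: K_def)
    also have "\<dots> \<le> nat \<bar>d\<bar>" by auto
    finally show ?thesis by linarith
  qed
  moreover have "norm m \<le> 1"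
    unfolding m_def using norm_mult_ineq[of "isom v \<alpha>" "adj (isom u \<beta>)"]
      norm_isom_le[OF w(1)] norm_isom_le[OF w(2)] mult_mono[of "norm (isom v \<alpha>)" 1 "norm (isom u \<beta>)" 1]
    by (simp add: norm_adj)
  ultimately have "real (R - card K) * norm m \<le> real_of_int \<bar>d\<bar> * 1" by (intro mult_mono) auto
  then have "real (R - card K) / R * norm m \<le> \<bar>d\<bar> / R" using R by (simp add: divide_right_mono)
  then show ?thesis using \<open>cesaro R N m - m = _\<close> by (simp add: m_def d_def)
qed

lemma cesaro_scaleC: "cesaro R N (scaleC c x) = scaleC c (cesaro R N x)"
  by (simp add: cesaro_def fourier_linear scaleC_sum_right scaleC_scaleC mult.commute flip: scaleC_of_real)

lemma cesaro_dense:
  "closure {y. \<forall>e>0. \<exists>R\<^sub>0. \<forall>R\<ge>R\<^sub>0. \<forall>\<^sub>F N in sequentially. norm (cesaro R N y - y) \<le> e} = UNIV"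
  (is "closure ?V = _")
proof (rule dense_if_contains_monomials)
  show "subspace ?V"
  proof (rule subspaceI)
    fix x y assume xy: "x \<in> ?V" "y \<in> ?V"
    show "x + y \<in> ?V"
    proof (clarify)
      fix e :: real assume "e > 0"
      then have "e / 2 > 0" by simp
      then obtain K M where
        K: "\<And>R. R \<ge> K \<Longrightarrow> \<forall>\<^sub>F N in sequentially. norm (cesaro R N x - x) \<le> e / 2" and
        M: "\<And>R. R \<ge> M \<Longrightarrow> \<forall>\<^sub>F N in sequentially. norm (cesaro R N y - y) \<le> e / 2"
        using xy by blast
      have sum: "norm (cesaro R N (x + y) - (x + y)) \<le> e"
        if "norm (cesaro R N x - x) \<le> e / 2" "norm (cesaro R N y - y) \<le> e / 2" for R N
      proof -
        have "cesaro R N (x + y) - (x + y) = (cesaro R N x - x) + (cesaro R N y - y)"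
          by (simp add: cesaro_linear)
        moreover have "norm ((cesaro R N x - x) + (cesaro R N y - y)) \<le> e"
          by (rule norm_triangle_le) (use that in simp)
        ultimately show ?thesis by (simp only:)
      qed
      have "\<forall>\<^sub>F N in sequentially. norm (cesaro R N (x + y) - (x + y)) \<le> e" if "R \<ge> max K M" for R
        using eventually_conj[OF K[of R] M[of R]] that by (auto elim!: eventually_mono intro: sum)
      then show "\<exists>R\<^sub>0. \<forall>R\<ge>R\<^sub>0. \<forall>\<^sub>F N in sequentially. norm (cesaro R N (x + y) - (x + y)) \<le> e" by blast
    qed
    show "r *\<^sub>R x \<in> ?V" for r
    proof (clarify)
      fix e :: real assume "e > 0"
      then have "e / (\<bar>r\<bar> + 1) > 0" by simp
      then obtain K where
        K: "\<And>R. R \<ge> K \<Longrightarrow> \<forall>\<^sub>F N in sequentially. norm (cesaro R N x - x) \<le> e / (\<bar>r\<bar> + 1)"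
        using xy by blast
      have scale: "norm (cesaro R N (r *\<^sub>R x) - r *\<^sub>R x) \<le> e" if "norm (cesaro R N x - x) \<le> e / (\<bar>r\<bar> + 1)" for R N
      proof -
        have "norm (cesaro R N (r *\<^sub>R x) - r *\<^sub>R x) = \<bar>r\<bar> * norm (cesaro R N x - x)"
          by (simp add: cesaro_linear flip: scaleR_diff_right)
        also have "\<dots> \<le> (\<bar>r\<bar> + 1) * (e / (\<bar>r\<bar> + 1))" using that by (intro mult_mono) auto
        also have "\<dots> = e" by simp
        finally show ?thesis .
      qed
      then show "\<exists>R\<^sub>0. \<forall>R\<ge>R\<^sub>0. \<forall>\<^sub>F N in sequentially. norm (cesaro R N (r *\<^sub>R x) - r *\<^sub>R x) \<le> e"
      proof (intro exI[of _ K] allI impI)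
        fix R assume "R \<ge> K"
        then show "\<forall>\<^sub>F N in sequentially. norm (cesaro R N (r *\<^sub>R x) - r *\<^sub>R x) \<le> e"
          by (rule eventually_mono[OF K scale])
      qed
    qed
  qed (auto simp: cesaro_linear)
  show "monomials \<subseteq> ?V"
  proof (clarify)
    fix m and e :: real assume "m \<in> monomials" and e: "e > 0"
    then obtain c v \<alpha> u \<beta> a where w: "awalk v \<alpha> a" "awalk u \<beta> a"
      and m: "m = scaleC c (isom v \<alpha> * adj (isom u \<beta>))" by (auto simp: monomials_def)
    define d where "d = \<bar>int (length \<alpha>) - int (length \<beta>)\<bar>"
    define R\<^sub>0 where "R\<^sub>0 = nat \<lceil>cmod c * d / e\<rceil> + 1"
    have "\<forall>\<^sub>F N in sequentially. norm (cesaro R N m - m) \<le> e" if R: "R \<ge> R\<^sub>0" for R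
      unfolding eventually_sequentially
    proof (intro exI[of _ "nat d + R + 1"] allI impI)
      fix N assume N: "nat d + R + 1 \<le> N"
      have "norm (cesaro R N m - m) 
          = cmod c * norm (cesaro R N (isom v \<alpha> * adj (isom u \<beta>)) - isom v \<alpha> * adj (isom u \<beta>))"
        by (simp add: m cesaro_scaleC norm_scaleC flip: scaleC_diff_right)
      also have "\<dots> \<le> cmod c * (d / R)"
        unfolding d_def using R N by (intro mult_left_mono cesaro_monomial[OF w]) (auto simp: R\<^sub>0_def d_def)
      also have "\<dots> \<le> e"
      proof -
        have "cmod c * d / e \<le> R" "R > 0" using R unfolding R\<^sub>0_def by linarith+
        then show ?thesis using e by (simp add: field_simps)
      qed
      finally show "norm (cesaro R N m - m) \<le> e" .
    qed
    then show "\<exists>R\<^sub>0. \<forall>R\<ge>R\<^sub>0. \<forall>\<^sub>F N in sequentially. norm (cesaro R N m - m) \<le> e" by blast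
  qed
qed

end

section \<open>The diagonal is its own commutant\<close>

context graph_algebra_exits
begin

text \<open>
Averaging is contractive, so it preserves the quality of an approximation of \<open>x\<close> by monomials
while discarding all degrees but \<open>n\<close>.
\<close>

lemma fourier_positive_vanishes:
  assumes x: "x \<in> commutant \<D>" and n: "n > 0" and e: "e > 0"
  shows "\<forall>\<^sub>F N in sequentially. norm (fourier N (int n) x) \<le> e"
proof -
  obtain y where y: "norm (x - y) < e / 2" "\<forall>n. \<exists>N\<^sub>0. \<forall>N\<ge>N\<^sub>0. fourier N (int n) y \<in> homogeneous n"
    using closure_UNIV_approx[OF fourier_homogeneous_dense, of "e / 2" x] e by auto
  then obtain N\<^sub>0 where N\<^sub>0: "\<And>N. N \<ge> N\<^sub>0 \<Longrightarrow> fourier N (int n) y \<in> homogeneous n" by blast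
  have "norm (fourier N (int n) x) \<le> e" if "N \<ge> N\<^sub>0" for N
  proof -
    have "norm (fourier N (int n) x - fourier N (int n) y) \<le> e / 2"
      using norm_fourier_le[of N "int n" "x - y"] y(1) by (simp add: fourier_linear)
    from homogeneous_positive_near_zero[OF fourier_commutant[OF x] N\<^sub>0[OF that] n this]
    show ?thesis by simp
  qed
  then show ?thesis unfolding eventually_sequentially by blast
qed

lemma fourier_nonzero_vanishes:
  assumes x: "x \<in> commutant \<D>" and n: "n \<noteq> 0" and e: "e > 0"
  shows "\<forall>\<^sub>F N in sequentially. norm (fourier N n x) \<le> e"
proof (cases "n > 0")
  case True
  then show ?thesis using fourier_positive_vanishes[OF x, of "nat n" e] e by simp
next
  case False
  have "adj x \<in> commutant \<D>" using x cstar_subalgebra_commutant_diagonal by (simp add: cstar_subalgebra_def)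
  moreover have "norm (fourier N n x) = norm (fourier N (- n) (adj x))" for N
    by (metis adj_fourier norm_adj)
  ultimately show ?thesis using fourier_positive_vanishes[of "adj x" "nat (- n)" e] e n False by simp
qed

lemma fourier_zero_near_diagonal:
  assumes x: "x \<in> commutant \<D>" and e: "e > 0"
  shows "\<forall>\<^sub>F N in sequentially. \<exists>d\<in>\<D>. norm (fourier N 0 x - d) \<le> e"
proof -
  obtain y where y: "norm (x - y) < e" "\<forall>n. \<exists>N\<^sub>0. \<forall>N\<ge>N\<^sub>0. fourier N (int n) y \<in> homogeneous n"
    using closure_UNIV_approx[OF fourier_homogeneous_dense e, of x] by auto
  then obtain N\<^sub>0 where N\<^sub>0: "\<And>N. N \<ge> N\<^sub>0 \<Longrightarrow> fourier N (int 0) y \<in> homogeneous 0" by blast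
  have "\<exists>d\<in>\<D>. norm (fourier N 0 x - d) \<le> e" if "N \<ge> N\<^sub>0" for N
  proof (rule homogeneous_zero_near_diagonal[OF fourier_commutant[OF x]])
    show "fourier N 0 y \<in> homogeneous 0" using N\<^sub>0[OF that] by simp
    show "norm (fourier N 0 x - fourier N 0 y) \<le> e"
      using norm_fourier_le[of N 0 "x - y"] y(1) by (simp add: fourier_linear)
  qed
  then show ?thesis unfolding eventually_sequentially by blast
qed

text \<open>
The order of choices matters. First the length \<open>R\<close> of the Fejer mean is fixed, by an approximation
of \<open>x\<close> of accuracy \<open>e\<close>. Only then are the coefficients of nonzero degree, which occur in fewer
than \<open>R\<^sup>2\<close> terms of the mean with weight \<open>1 / R\<close>, made smaller than \<open>e / R\<close> by taking \<open>N\<close> large.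
\<close>

theorem diagonal_maximal_abelian: "commutant \<D> = \<D>"
proof
  show "\<D> \<subseteq> commutant \<D>" by (rule diagonal_commutative)
  show "commutant \<D> \<subseteq> \<D>"
  proof
    fix x assume x: "x \<in> commutant \<D>"
    have "\<exists>d\<in>\<D>. dist d x < \<epsilon>" if "\<epsilon> > 0" for \<epsilon>
    proof -
      \<comment> \<open>Three errors add up to \<open>5 * e\<close>: the mean differs from \<open>x\<close> by \<open>3 * e\<close>, from its term of
        degree 0 by \<open>e\<close>, and that term from an element of the diagonal by \<open>e\<close>.\<close>
      define e where "e = \<epsilon> / 6"
      have e: "e > 0" using that by (simp add: e_def)
      obtain y where y: "norm (x - y) < e"
        "\<forall>e>0. \<exists>R\<^sub>0. \<forall>R\<ge>R\<^sub>0. \<forall>\<^sub>F N in sequentially. norm (cesaro R N y - y) \<le> e"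
        using closure_UNIV_approx[OF cesaro_dense e, of x] by auto
      then obtain R\<^sub>0 where R\<^sub>0: "\<And>R. R \<ge> R\<^sub>0 \<Longrightarrow> \<forall>\<^sub>F N in sequentially. norm (cesaro R N y - y) \<le> e"
        using e by blast
      define R where "R = Suc R\<^sub>0"
      have R: "R > 0" by (simp add: R_def)
      have "\<forall>\<^sub>F N in sequentially. norm (cesaro R N y - y) \<le> e" using R\<^sub>0[of R] by (simp add: R_def)
      moreover have "\<forall>\<^sub>F N in sequentially. \<exists>d\<in>\<D>. norm (fourier N 0 x - d) \<le> e"
        by (rule fourier_zero_near_diagonal[OF x e])
      moreover have "\<forall>\<^sub>F N in sequentially. \<forall>k\<in>{..<R}. \<forall>l\<in>{..<R}. 
          k \<noteq> l \<longrightarrow> norm (fourier N (int l - int k) x) \<le> e / R"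
      proof (intro eventually_ball_finite ballI finite_lessThan)
        fix k l
        show "\<forall>\<^sub>F N in sequentially. k \<noteq> l \<longrightarrow> norm (fourier N (int l - int k) x) \<le> e / R"
          using fourier_nonzero_vanishes[OF x, of "int l - int k" "e / R"] e R by (cases "k = l") auto
      qed
      moreover have "\<forall>\<^sub>F N in sequentially. N \<ge> R" by (rule eventually_ge_at_top)
      ultimately have "\<forall>\<^sub>F N in sequentially. norm (cesaro R N y - y) \<le> e \<and>
          (\<exists>d\<in>\<D>. norm (fourier N 0 x - d) \<le> e) \<and>
          (\<forall>k\<in>{..<R}. \<forall>l\<in>{..<R}. k \<noteq> l \<longrightarrow> norm (fourier N (int l - int k) x) \<le> e / R) \<and> N \<ge> R"
        by (intro eventually_conj)
      from eventually_happens[OF this] obtain N d where N: "norm (cesaro R N y - y) \<le> e"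
        and d: "d \<in> \<D>" "norm (fourier N 0 x - d) \<le> e"
        and F: "\<And>k l. k < R \<Longrightarrow> l < R \<Longrightarrow> k \<noteq> l \<Longrightarrow> norm (fourier N (int l - int k) x) \<le> e / R" and RN: "R \<le> N"
        by auto
      have 1: "norm (cesaro R N x - x) \<le> 3 * e"
      proof -
        have "cesaro R N x - x = cesaro R N (x - y) + (cesaro R N y - y) - (x - y)"
          by (simp add: cesaro_linear)
        also have "norm \<dots> \<le> norm (cesaro R N (x - y)) + norm (cesaro R N y - y) + norm (x - y)"
          by (meson norm_triangle_ineq4 norm_triangle_ineq order_trans add_right_mono)
        finally show ?thesis using norm_cesaro_le[OF R RN, of "x - y"] N y(1) by linarith
      qed
      have 2: "norm (cesaro R N x - fourier N 0 x) \<le> e"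
      proof -
        let ?g = "\<lambda>k l. if k = l then 0 else fourier N (int l - int k) x"
        have "(\<Sum>l<R. fourier N (int l - int k) x) = fourier N 0 x + (\<Sum>l<R. ?g k l)" if "k < R" for k
        proof -
          have "(\<Sum>l<R. fourier N (int l - int k) x) = (\<Sum>l<R. (if l = k then fourier N 0 x else 0) + ?g k l)"
            by (intro sum.cong refl) auto
          then show ?thesis using that by (simp add: sum.distrib)
        qed
        then have "(\<Sum>k<R. \<Sum>l<R. fourier N (int l - int k) x) = real R *\<^sub>R fourier N 0 x + (\<Sum>k<R. \<Sum>l<R. ?g k l)"
          by (simp add: sum.distrib sum_constant_scaleR)
        then have "cesaro R N x - fourier N 0 x = (1 / real R) *\<^sub>R (\<Sum>k<R. \<Sum>l<R. ?g k l)"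
          using R by (simp add: cesaro_def scaleR_add_right)
        moreover have "norm (\<Sum>k<R. \<Sum>l<R. ?g k l) \<le> (\<Sum>k<R. \<Sum>l<R. e / R)"
          using F e by (intro sum_norm_le) auto
        ultimately show ?thesis using R by (simp add: field_simps)
      qed
      have "d - x = (cesaro R N x - x) - (cesaro R N x - fourier N 0 x) - (fourier N 0 x - d)" by simp
      also have "norm \<dots> \<le> norm (cesaro R N x - x) + norm (cesaro R N x - fourier N 0 x) + norm (fourier N 0 x - d)"
        by (meson norm_triangle_ineq4 order_trans add_right_mono)
      finally have "norm (d - x) \<le> 5 * e" using 1 2 d(2) by linarith
      then show ?thesis using d(1) e by (auto simp: dist_norm e_def intro!: bexI[of _ d])
    qed
    then have "x \<in> closure \<D>" by (simp add: closure_approachable)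
    then show "x \<in> \<D>" using cstar_subalgebra_diagonal by (simp add: cstar_subalgebra_def closure_closed)
  qed
qed

end

section \<open>Automorphisms fixing the diagonal\<close>

context graph_algebra
begin

lemma star_hom_eqI:
  assumes \<phi>: "star_hom \<phi>" "\<phi> (1::'a) = (1::'a)" and \<psi>: "star_hom \<psi>" "\<psi> 1 = 1"
    and "\<And>v. v \<in> verts G \<Longrightarrow> \<phi> (P v) = \<psi> (P v)" "\<And>e. e \<in> arcs G \<Longrightarrow> \<phi> (S e) = \<psi> (S e)"
  shows "\<phi> = \<psi>"
proof -
  have "cstar_generated (P ` verts G \<union> S ` arcs G) \<subseteq> {x. \<phi> x = \<psi> x}"
    by (rule cstar_generated_minimal[OF cstar_subalgebra_equalizer[OF \<phi> \<psi>]]) (use assms in auto)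
  then show ?thesis by (auto simp: generated)
qed

lemma diagonal_commute: "x \<in> \<D> \<Longrightarrow> y \<in> \<D> \<Longrightarrow> x * y = y * x"
  using diagonal_commutative by (auto simp: commutant_def)

lemma diagonal_closed: "x \<in> \<D> \<Longrightarrow> y \<in> \<D> \<Longrightarrow> x * y \<in> \<D>" "x \<in> \<D> \<Longrightarrow> adj x \<in> \<D>"
  using cstar_subalgebra_diagonal by (auto simp: cstar_subalgebra_def)

lemma lambda:
  assumes u: "u \<in> \<D>" "unitary u"
  shows "star_hom (lambda_endo G P S u)" "lambda_endo G P S u 1 = 1"
    and "e \<in> arcs G \<Longrightarrow> lambda_endo G P S u (S e) = u * S e"
    and "v \<in> verts G \<Longrightarrow> lambda_endo G P S u (P v) = P v"
  using lambda_endo_exists[OF fin_digraph_axioms universal u(2)] diagonal_commute[OF u(1) P_diagonal] by auto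

text \<open>
Along a path each edge contributes a conjugation by \<open>u\<close>, which acts trivially on range projections
as these commute with \<open>u\<close>.
\<close>

lemma lambda_range_proj:
  assumes u: "u \<in> \<D>" "unitary u"
  shows "awalk v \<mu> w \<Longrightarrow> lambda_endo G P S u (range_proj v \<mu>) = range_proj v \<mu>"
proof (induction \<mu> arbitrary: v)
  case Nil
  then show ?case by (auto simp: isom_Nil awalk_Nil_iff adj_P P_P lambda[OF u])
next
  case (Cons e \<mu>)
  then have e: "e \<in> arcs G" "awalk (head G e) \<mu> w" by (auto simp: awalk_Cons_iff)
  have "lambda_endo G P S u (range_proj v (e # \<mu>)) = u * S e * range_proj (head G e) \<mu> * adj (u * S e)"
    unfolding range_proj_Cons[OF e(1)] star_homD(2,4)[OF lambda(1)[OF u]] lambda(3)[OF u e(1)]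
    using Cons.IH[OF e(2)] unfolding star_homD(2,4)[OF lambda(1)[OF u]] by simp
  also have "\<dots> = u * range_proj v (e # \<mu>) * adj u"
    unfolding range_proj_Cons[OF e(1)] by (simp add: adj_mult mult.assoc)
  also have "\<dots> = range_proj v (e # \<mu>) * (u * adj u)"
    using diagonal_commute[OF u(1) range_proj_diagonal[OF Cons.prems]] by (simp only: mult.assoc)
  finally show ?case using u(2) by (simp add: unitary_def)
qed

lemma lambda_fixes_diagonal:
  assumes u: "u \<in> \<D>" "unitary u" and d: "d \<in> \<D>"
  shows "lambda_endo G P S u d = d"
  by (rule star_hom_fixes_diagonal[OF lambda(1,2)[OF u] _ d])
     (auto simp: path_projections_def lambda_range_proj[OF u])

text \<open>
On generators, \<open>\<lambda>\<^sub>u (v S e) = v u S e\<close>, since \<open>\<lambda>\<^sub>u\<close> fixes \<open>v\<close>; commutativity of the diagonal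
restores the order.
\<close>

lemma lambda_mult:
  assumes u: "u \<in> \<D>" "unitary u" and v: "v \<in> \<D>" "unitary v"
  shows "lambda_endo G P S (u * v) = lambda_endo G P S u \<circ> lambda_endo G P S v"
proof (rule star_hom_eqI)
  have uv: "u * v \<in> \<D>" "unitary (u * v)" using u v diagonal_closed unitary_mult by auto
  show "star_hom (lambda_endo G P S (u * v))" "lambda_endo G P S (u * v) 1 = 1" by (fact lambda[OF uv])+
  show "star_hom (lambda_endo G P S u \<circ> lambda_endo G P S v)"
    using lambda(1)[OF u] lambda(1)[OF v] by (simp add: star_hom_def)
  show "(lambda_endo G P S u \<circ> lambda_endo G P S v) 1 = 1" by (simp add: lambda[OF u] lambda[OF v])
  show "lambda_endo G P S (u * v) (P w) = (lambda_endo G P S u \<circ> lambda_endo G P S v) (P w)"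
    if "w \<in> verts G" for w using that by (simp add: lambda[OF u] lambda[OF v] lambda[OF uv])
  show "lambda_endo G P S (u * v) (S e) = (lambda_endo G P S u \<circ> lambda_endo G P S v) (S e)"
    if "e \<in> arcs G" for e
  proof -
    have "lambda_endo G P S u (v * S e) = v * (u * S e)"
      by (simp add: star_homD[OF lambda(1)[OF u]] lambda_fixes_diagonal[OF u v(1)] lambda[OF u] that)
    also have "\<dots> = u * v * S e" using diagonal_commute[OF u(1) v(1)] by (simp flip: mult.assoc)
    finally show ?thesis using that by (simp add: lambda[OF v] lambda[OF uv])
  qed
qed

lemma lambda_one: "lambda_endo G P S 1 = id"
proof (rule star_hom_eqI)
  note l = lambda[OF one_diagonal unitary_one]
  show "star_hom (lambda_endo G P S 1)" "lambda_endo G P S 1 1 = 1" by (fact l)+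
  show "star_hom (id :: 'a \<Rightarrow> 'a)" "id (1::'a) = 1" by (simp_all add: star_hom_def)
qed (simp_all add: lambda[OF one_diagonal unitary_one])

lemma lambda_Aut:
  assumes u: "u \<in> \<D>" "unitary u"
  shows "lambda_endo G P S u \<in> Aut_fixing \<D>"
proof -
  have v: "adj u \<in> \<D>" "unitary (adj u)" using u diagonal_closed by (auto simp: unitary_def adj_adj)
  have "lambda_endo G P S u \<circ> lambda_endo G P S (adj u) = id" "lambda_endo G P S (adj u) \<circ> lambda_endo G P S u = id"
    using lambda_mult[OF u v] lambda_mult[OF v u] u(2) lambda_one by (simp_all add: unitary_def)
  then have "bij (lambda_endo G P S u)" by (rule o_bij[rotated])
  then show ?thesis using lambda(1)[OF u] lambda_fixes_diagonal[OF u] by (simp add: Aut_fixing_def)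
qed

text \<open>
Conjugation by \<open>adj (S e)\<close> shortens a path that begins with \<open>e\<close> by this edge and kills the other
paths of positive length; for vertices, it takes \<open>P (tail G e)\<close> to \<open>P (head G e)\<close>.
\<close>

lemma compress_path_projection:
  assumes x: "x \<in> path_projections" and e: "e \<in> arcs G"
  shows "adj (S e) * x * S e \<in> \<D>"
proof -
  have 0: "0 \<in> \<D>" using cstar_subalgebra_diagonal by (simp add: cstar_subalgebra_def)
  obtain v \<mu> w where \<mu>: "x = range_proj v \<mu>" "awalk v \<mu> w" using x by (auto simp: path_projections_def)
  show ?thesis
  proof (cases \<mu>)
    case Nil
    then have "v \<in> verts G" using \<mu> by (auto simp: awalk_Nil_iff)
    moreover from this have "P v * S e = (if v = tail G e then S e else 0)"
      using P_mult_P[of v "tail G e"] P_tail_S[OF e] e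
      by (metis (full_types) mult.assoc mult_zero_left tail_in_verts)
    ultimately show ?thesis
      using P_diagonal[of "head G e"] e 0 by (simp add: \<mu>(1) Nil isom_Nil adj_P P_P mult.assoc adj_S_S)
  next
    case (Cons f \<nu>)
    then have f: "f \<in> arcs G" "awalk (head G f) \<nu> w" using \<mu> by (auto simp: awalk_Cons_iff)
    have *: "adj (S e) * x * S e = (adj (S e) * S f) * range_proj (head G f) \<nu> * (adj (S f) * S e)"
      unfolding \<mu>(1) Cons range_proj_Cons[OF f(1)] by (simp only: mult.assoc)
    show ?thesis
    proof (cases "e = f")
      case True
      have "adj (S e) * x * S e = P (head G e) * range_proj (head G e) \<nu> * P (head G e)"
        unfolding * using True e by (simp add: adj_S_S)
      then show ?thesis
        using True f range_proj_diagonal[OF f(2)] P_diagonal[of "head G e"] diagonal_closed(1) e by simp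
    next
      case False
      then show ?thesis unfolding * using e f 0 by (simp add: adj_S_S_neq)
    qed
  qed
qed

text \<open>For \<open>\<alpha> = \<lambda>\<^sub>u\<close> this returns \<open>u\<close>, because \<open>(\<Sum>e. S e * adj (S e)) = 1\<close>.\<close>

definition endo_unitary :: "('a \<Rightarrow> 'a) \<Rightarrow> 'a" where
  "endo_unitary \<alpha> = (\<Sum>e\<in>arcs G. \<alpha> (S e) * adj (S e))"

lemma sum_S_adj_S: "(\<Sum>e\<in>arcs G. S e * adj (S e)) = 1"
proof -
  have "(\<Sum>v\<in>verts G. \<Sum>e\<in>{e \<in> arcs G. tail G e = v}. S e * adj (S e)) = (\<Sum>e\<in>arcs G. S e * adj (S e))"
    by (rule sum.group) auto
  moreover have "(\<Sum>e\<in>{e \<in> arcs G. tail G e = v}. S e * adj (S e)) = P v" if "v \<in> verts G" for v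
    using P_eq_sum[OF that] by (simp add: out_arcs_def)
  ultimately show ?thesis using sum_P by simp
qed

lemma endo_unitary_lambda:
  assumes u: "u \<in> \<D>" "unitary u"
  shows "endo_unitary (lambda_endo G P S u) = u"
proof -
  have "endo_unitary (lambda_endo G P S u) = (\<Sum>e\<in>arcs G. u * (S e * adj (S e)))"
    unfolding endo_unitary_def by (intro sum.cong refl) (simp add: lambda[OF u] mult.assoc)
  then show ?thesis by (simp add: sum_S_adj_S flip: sum_distrib_left)
qed

context
  fixes \<alpha> assumes \<alpha>: "\<alpha> \<in> End_fixing \<D>"
begin

lemma endo_star_hom: "star_hom \<alpha>" "\<alpha> 1 = 1" and endo_fixes: "d \<in> \<D> \<Longrightarrow> \<alpha> d = d"
  using \<alpha> by (auto simp: End_fixing_def)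

lemma endo_unitary_S: "e \<in> arcs G \<Longrightarrow> endo_unitary \<alpha> * S e = \<alpha> (S e)"
proof -
  assume e: "e \<in> arcs G"
  have "endo_unitary \<alpha> * S e = (\<Sum>f\<in>arcs G. if f = e then \<alpha> (S e * P (head G e)) else 0)"
    unfolding endo_unitary_def sum_distrib_right
    using e adj_S_S_neq[of _ e] endo_fixes[OF P_diagonal[of "head G e"]]
    by (intro sum.cong refl) (auto simp: mult.assoc adj_S_S star_homD[OF endo_star_hom(1)])
  then show ?thesis using e by (simp add: S_P)
qed

text \<open>
All cross terms vanish: \<open>\<alpha> (S e)\<^sup>* \<alpha> (S f) = \<alpha> (S e\<^sup>* S f)\<close> is zero for \<open>e \<noteq> f\<close>, and is
\<open>P (head f)\<close>, which \<open>\<alpha>\<close> fixes, for \<open>e = f\<close>.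
\<close>

lemma adj_endo_unitary_mult: "adj (endo_unitary \<alpha>) * endo_unitary \<alpha> = 1"
proof -
  have "adj (endo_unitary \<alpha>) * endo_unitary \<alpha>
      = (\<Sum>f\<in>arcs G. adj (endo_unitary \<alpha>) * (\<alpha> (S f) * adj (S f)))"
    by (subst (2) endo_unitary_def) (rule sum_distrib_left)
  also have "\<dots> = (\<Sum>f\<in>arcs G. S f * adj (S f))"
  proof (intro sum.cong refl)
    fix f assume f: "f \<in> arcs G"
    have "adj (endo_unitary \<alpha>) * \<alpha> (S f) = (\<Sum>e\<in>arcs G. if e = f then S f else 0)"
      unfolding endo_unitary_def adj_sum sum_distrib_right
    proof (intro sum.cong refl)
      fix e assume e: "e \<in> arcs G"
      have "adj (\<alpha> (S e) * adj (S e)) * \<alpha> (S f) = S e * \<alpha> (adj (S e) * S f)"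
        by (simp add: adj_mult adj_adj mult.assoc star_homD[OF endo_star_hom(1)])
      also have "\<dots> = (if e = f then S f else 0)"
        using e f adj_S_S_neq[OF e f] endo_fixes[OF P_diagonal[of "head G f"]]
        by (auto simp: adj_S_S S_P star_homD(7)[OF endo_star_hom(1)])
      finally show "adj (\<alpha> (S e) * adj (S e)) * \<alpha> (S f) = (if e = f then S f else 0)" .
    qed
    then have "adj (endo_unitary \<alpha>) * \<alpha> (S f) = S f" using f by simp
    then show "adj (endo_unitary \<alpha>) * (\<alpha> (S f) * adj (S f)) = S f * adj (S f)" by (metis mult.assoc)
  qed
  finally show ?thesis by (simp add: sum_S_adj_S)
qed

lemma endo_unitary_mult_adj: "endo_unitary \<alpha> * adj (endo_unitary \<alpha>) = 1"
proof -
  have "endo_unitary \<alpha> * adj (endo_unitary \<alpha>) = (\<Sum>e\<in>arcs G. endo_unitary \<alpha> * (S e * adj (\<alpha> (S e))))"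
    by (subst (2) endo_unitary_def) (simp add: adj_sum adj_mult adj_adj sum_distrib_left)
  also have "\<dots> = (\<Sum>e\<in>arcs G. \<alpha> (S e * adj (S e)))"
    by (intro sum.cong refl) (simp add: endo_unitary_S star_homD[OF endo_star_hom(1)] flip: mult.assoc)
  also have "\<dots> = 1"
    by (simp add: sum_S_adj_S endo_star_hom flip: star_hom_sum[OF endo_star_hom(1)])
  finally show ?thesis .
qed

text \<open>
The element \<open>y = adj (S e) * x * S e\<close> again lies in the diagonal, so \<open>\<alpha>\<close> fixes it, and \<open>x\<close> can be
moved through \<open>\<alpha> (S e) * adj (S e)\<close> as \<open>S e * y = x * S e\<close>.
\<close>

lemma endo_unitary_commutant: "endo_unitary \<alpha> \<in> commutant \<D>"
proof -
  have "x * endo_unitary \<alpha> = endo_unitary \<alpha> * x" if x: "x \<in> path_projections" for x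
  proof -
    have xD: "x \<in> \<D>" using x by (auto simp: path_projections_def range_proj_diagonal)
    have "endo_unitary \<alpha> * x = (\<Sum>e\<in>arcs G. \<alpha> (x * S e) * adj (S e))"
      unfolding endo_unitary_def sum_distrib_right
    proof (intro sum.cong refl)
      fix e assume e: "e \<in> arcs G"
      have "range_proj (tail G e) [e] = S e * adj (S e)" using e by (simp add: isom_Cons isom_Nil S_P)
      moreover have "awalk (tail G e) [e] (head G e)" using e by (simp add: awalk_Cons_iff awalk_Nil_iff)
      ultimately have D: "S e * adj (S e) \<in> \<D>" using range_proj_diagonal by metis
      define y where "y = adj (S e) * x * S e"
      have y: "y \<in> \<D>" unfolding y_def by (rule compress_path_projection[OF x e])
      have Sy: "S e * y = x * S e"
      proof -
        have "S e * y = (S e * adj (S e)) * x * S e" by (simp only: y_def mult.assoc)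
        also have "\<dots> = x * (S e * adj (S e) * S e)"
          unfolding diagonal_commute[OF D xD] by (simp only: mult.assoc)
        finally show ?thesis unfolding S_adj_S_S[OF e] .
      qed
      have "adj (S e * adj (S e) * S e) = adj (S e)" unfolding S_adj_S_S[OF e] ..
      then have "adj (S e) = adj (S e) * (S e * adj (S e))" by (simp add: adj_mult adj_adj mult.assoc)
      then have "adj (S e) * x = adj (S e) * (S e * adj (S e)) * x" by simp
      also have "\<dots> = y * adj (S e)"
        using diagonal_commute[OF D xD] unfolding y_def mult.assoc[of "adj (S e)" "S e * adj (S e)" x]
        by (simp only: mult.assoc)
      finally have "\<alpha> (S e) * adj (S e) * x = \<alpha> (S e) * y * adj (S e)" by (simp add: mult.assoc)
      also have "\<alpha> (S e) * y = \<alpha> (S e * y)"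
        by (simp only: star_homD(2)[OF endo_star_hom(1)] endo_fixes[OF y])
      also note Sy
      finally show "\<alpha> (S e) * adj (S e) * x = \<alpha> (x * S e) * adj (S e)" .
    qed
    also have "\<dots> = x * endo_unitary \<alpha>"
      by (simp add: endo_unitary_def sum_distrib_left mult.assoc star_homD[OF endo_star_hom(1)] endo_fixes[OF xD])
    finally show ?thesis by simp
  qed
  then show ?thesis unfolding commutant_diagonal by (simp add: commutant_def)
qed

end

end

context graph_algebra_exits
begin

lemma endo_is_lambda:
  assumes \<alpha>: "\<alpha> \<in> End_fixing \<D>"
  shows "endo_unitary \<alpha> \<in> \<D>" "unitary (endo_unitary \<alpha>)" "lambda_endo G P S (endo_unitary \<alpha>) = \<alpha>"
proof -
  show u: "endo_unitary \<alpha> \<in> \<D>" using endo_unitary_commutant[OF \<alpha>] diagonal_maximal_abelian by simp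
  show un: "unitary (endo_unitary \<alpha>)"
    using adj_endo_unitary_mult[OF \<alpha>] endo_unitary_mult_adj[OF \<alpha>] by (simp add: unitary_def)
  show "lambda_endo G P S (endo_unitary \<alpha>) = \<alpha>"
    by (rule star_hom_eqI[OF lambda(1,2)[OF u un] endo_star_hom[OF \<alpha>]])
       (simp_all add: lambda[OF u un] endo_unitary_S[OF \<alpha>] endo_fixes[OF \<alpha> P_diagonal])
qed

lemma Aut_fixing_subset_End: "Aut_fixing \<D> \<subseteq> End_fixing \<D>"
  using one_diagonal by (auto simp: Aut_fixing_def End_fixing_def)

lemma End_eq_Aut: "End_fixing \<D> = Aut_fixing \<D>"
proof
  show "End_fixing \<D> \<subseteq> Aut_fixing \<D>"
  proof
    fix \<alpha> assume "\<alpha> \<in> End_fixing \<D>"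
    from lambda_Aut[OF endo_is_lambda(1,2)[OF this]] show "\<alpha> \<in> Aut_fixing \<D>"
      unfolding endo_is_lambda(3)[OF \<open>\<alpha> \<in> End_fixing \<D>\<close>] .
  qed
qed (rule Aut_fixing_subset_End)

lemma group_unitary_group: "group (unitary_group \<D>)"
proof (rule groupI)
  fix u assume "u \<in> carrier (unitary_group \<D>)"
  then have u: "u \<in> \<D>" "unitary u" by (auto simp: unitary_group_def)
  then show "\<exists>v\<in>carrier (unitary_group \<D>). v \<otimes>\<^bsub>unitary_group \<D>\<^esub> u = \<one>\<^bsub>unitary_group \<D>\<^esub>"
    by (intro bexI[of _ "adj u"]) (auto simp: unitary_group_def unitary_def adj_adj diagonal_closed)
qed (auto simp: unitary_group_def diagonal_closed unitary_mult one_diagonal unitary_one mult.assoc)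

lemma bij_betw_lambda:
  "bij_betw (lambda_endo G P S) {u \<in> \<D>. unitary u} (Aut_fixing \<D>)"
  by (rule bij_betw_byWitness[where f'=endo_unitary])
     (use endo_is_lambda lambda_Aut endo_unitary_lambda in \<open>auto simp: End_eq_Aut\<close>)

lemma group_Aut_fixing_group: "group (Aut_fixing_group \<D>)"
proof (rule groupI)
  fix \<alpha> assume "\<alpha> \<in> carrier (Aut_fixing_group \<D>)"
  then obtain u where u: "u \<in> \<D>" "unitary u" "\<alpha> = lambda_endo G P S u"
    using bij_betw_lambda by (auto simp: Aut_fixing_group_def bij_betw_def)
  then have v: "adj u \<in> \<D>" "unitary (adj u)" using diagonal_closed by (auto simp: unitary_def adj_adj)
  have "lambda_endo G P S (adj u) \<circ> \<alpha> = id"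
    using lambda_mult[OF v u(1,2)] u lambda_one by (simp add: unitary_def)
  then show "\<exists>\<beta>\<in>carrier (Aut_fixing_group \<D>). \<beta> \<otimes>\<^bsub>Aut_fixing_group \<D>\<^esub> \<alpha> = \<one>\<^bsub>Aut_fixing_group \<D>\<^esub>"
    using lambda_Aut[OF v] by (auto simp: Aut_fixing_group_def)
qed (auto simp: Aut_fixing_group_def Aut_fixing_def star_hom_def bij_comp o_assoc)

lemma lambda_iso: "lambda_endo G P S \<in> iso (unitary_group \<D>) (Aut_fixing_group \<D>)"
  using bij_betw_lambda lambda_mult lambda_Aut
  by (auto simp: iso_def hom_def unitary_group_def Aut_fixing_group_def)

end

theorem proposition3p2:
  fixes G :: "('v, 'e) pre_digraph"
    and P :: "'v \<Rightarrow> 'a::unital_cstar_algebra"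
    and S :: "'e \<Rightarrow> 'a"
  assumes "fin_digraph G"
    and no_sinks: "\<And>v. v \<in> verts G \<Longrightarrow> out_arcs G v \<noteq> {}"
    and loops_have_exits: "\<And>v \<mu>. \<lbrakk>pre_digraph.awalk G v \<mu> v; \<mu> \<noteq> []\<rbrakk> \<Longrightarrow>
      \<exists>e\<in>set \<mu>. \<exists>f\<in>out_arcs G (tail G e). \<exists>g\<in>out_arcs G (tail G e). f \<noteq> g"
    and universal: "graph_cstar_algebra G P S"
  shows "End_fixing (diagonal G P S) = Aut_fixing (diagonal G P S) \<and>
    group (unitary_group (diagonal G P S)) \<and>
    group (Aut_fixing_group (diagonal G P S)) \<and>
    lambda_endo G P S \<in> iso (unitary_group (diagonal G P S)) (Aut_fixing_group (diagonal G P S))"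
proof -
  interpret fin_digraph G by (rule assms(1))
  interpret graph_algebra_exits G P S
    by unfold_locales (use no_sinks loops_have_exits universal in auto)
  show ?thesis
    using End_eq_Aut group_unitary_group group_Aut_fixing_group lambda_iso by blast
qed

end
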